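(* Let $M$ be a closed (compact, boundaryless) topological manifold, and let $\mathrm{Homeo}_0(M)$ denote the connected component of the identity of the group $\mathrm{Homeo}(M)$ of homeomorphisms $M\to M$, equipped with the compact-open topology. Then $\mathrm{Homeo}_0(M)$, regarded as an abstract group, is SB-generated.
   Context: A subset $A$ of a group $G$ is strongly bounded if $A$ has finite diameter with respect to every left-invariant metric on $G$ (no continuity or topology is involved). A group is SB-generated if it is generated by a strongly bounded subset. *)

theory Defs
  imports "HOL-Analysis.Analysis" "HOL-Algebra.Generated_Groups"
begin

definition closed_manifold :: "'a topology \<Rightarrow> nat \<Rightarrow> bool" where
  "closed_manifold X n \<longleftrightarrow>
     compact_space X \<and> Hausdorff_space X \<and> second_countable X \<and>
     (\<forall>x \<in> topspace X. \<exists>U V. openin X U \<and> x \<in> U \<and>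
         openin (Euclidean_space n) V \<and>
         (subtopology X U) homeomorphic_space (subtopology (Euclidean_space n) V))"

text \<open>Homeo(M): homeomorphisms of X, normalised to be the identity outside the
  carrier so that they form a group under composition with unit id.\<close>
definition Homeo :: "'a topology \<Rightarrow> ('a \<Rightarrow> 'a) set" where
  "Homeo X = {f. homeomorphic_map X X f \<and> (\<forall>x. x \<notin> topspace X \<longrightarrow> f x = x)}"

definition compact_open_topology :: "'a topology \<Rightarrow> ('a \<Rightarrow> 'a) topology" where
  "compact_open_topology X =
     subtopology
       (topology_generated_by
          {{f \<in> Homeo X. f ` K \<subseteq> U} | K U. compactin X K \<and> openin X U})
       (Homeo X)"

definition Homeo0 :: "'a topology \<Rightarrow> ('a \<Rightarrow> 'a) set" where
  "Homeo0 X = {f. connected_component_of (compact_open_topology X) id f}"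

definition Homeo0_group :: "'a topology \<Rightarrow> ('a \<Rightarrow> 'a) monoid" where
  "Homeo0_group X = \<lparr>carrier = Homeo0 X, monoid.mult = (\<circ>), one = id\<rparr>"

definition left_invariant_metric :: "('g, 'b) monoid_scheme \<Rightarrow> ('g \<Rightarrow> 'g \<Rightarrow> real) \<Rightarrow> bool" where
  "left_invariant_metric G d \<longleftrightarrow> Metric_space (carrier G) d \<and>
     (\<forall>g \<in> carrier G. \<forall>x \<in> carrier G. \<forall>y \<in> carrier G. d (g \<otimes>\<^bsub>G\<^esub> x) (g \<otimes>\<^bsub>G\<^esub> y) = d x y)"

definition strongly_bounded :: "('g, 'b) monoid_scheme \<Rightarrow> 'g set \<Rightarrow> bool" where
  "strongly_bounded G A \<longleftrightarrow> A \<subseteq> carrier G \<and>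
     (\<forall>d. left_invariant_metric G d \<longrightarrow> (\<exists>B. \<forall>a \<in> A. \<forall>b \<in> A. d a b \<le> B))"

definition SB_generated :: "('g, 'b) monoid_scheme \<Rightarrow> bool" where
  "SB_generated G \<longleftrightarrow> (\<exists>A. strongly_bounded G A \<and> generate G A = carrier G)"

end

theory Submission
  imports Defs
begin

text \<open>
  Let \<open>F\<close> be the group generated by the homeomorphisms supported in finitely many chart boxes.
  By the Alexander isotopy it lies in the identity component, and it is everything once it contains
  a neighbourhood of the identity. The latter is fragmentation, that is, local straightening of
  near-identity homeomorphisms relative to handles, one cell of a fine cubical grid at a time.

  Straightening avoids the torus trick. Let \<open>h\<close> be close to the identity and defined on a
  box, let \<open>T\<close> be a translation in one coordinate, and let \<open>s\<close> act on this coordinate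
  as the identity far to the left and as \<open>T\<^sup>-\<^sup>1\<close> far to the right. The conjugate by \<open>T\<close> of the
  commutator of \<open>h\<close> and \<open>s\<close>, composed with \<open>h\<close>, agrees with \<open>h\<close> on the left and
  with the conjugate of \<open>h\<close> by \<open>T\<close> on the right, so it can be continued periodically.
  Treating the coordinates transverse to a handle one after the other gives a homeomorphism of
  Euclidean space at bounded distance from the identity which agrees with \<open>h\<close> near the core
  of the handle, and conjugation with a radial contraction makes its support compact.

  The homeomorphisms supported in one box are strongly bounded because any sequence of them can be
  encoded, by two nested infinite products, in three homeomorphisms such that the \<open>m\<close>-th term
  is a word of length \<open>4 m + 4\<close> in these and their inverses.
\<close>

section \<open>Translations and gluing along one coordinate\<close>

text \<open>The invariant carried through is bounded displacement in Euclidean space. It survives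
  periodic continuation and infinite products of translates, and it is what the radial contraction
  turns into continuity at the boundary of a compact box. Cells have to be treated in order of
  dimension, because a homeomorphism can be straightened relative to a cell only if it is already
  the identity near the boundary of that cell. Hence splitting is formulated relative to
  neighbourhoods of closed sets, with a remainder that stays close to the identity. Each encoded
  term enters through a commutator with one fixed map \<open>f\<close>. If the other factor
  preserves the support of \<open>f\<close>, the commutator sees it only there, so the conjugate
  that retrieves a term from the infinite product may carry all remaining terms elsewhere. Word
  length linear in \<open>m\<close> suffices, since in a metric unbounded on one box the terms can
  be chosen longer than \<open>m (4 m + 4)\<close>.\<close>

definition eucl :: "nat \<Rightarrow> (nat \<Rightarrow> real) set" where
  "eucl n = {x. \<forall>i\<ge>n. x i = 0}"

text \<open>A sup-norm estimate, kept apart from \<open>dist\<close> because the product metric on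
  \<open>nat \<Rightarrow> real\<close> weights the coordinates.\<close>

definition near :: "real \<Rightarrow> (nat \<Rightarrow> real) \<Rightarrow> (nat \<Rightarrow> real) \<Rightarrow> bool" where
  "near \<delta> x y \<longleftrightarrow> (\<forall>i. \<bar>x i - y i\<bar> \<le> \<delta>)"

text \<open>\<open>J\<close> will be the set of directions transverse to a handle; the remaining
  coordinates below \<open>n\<close> stay unbounded.\<close>

definition slab :: "nat \<Rightarrow> nat set \<Rightarrow> real \<Rightarrow> (nat \<Rightarrow> real) set" where
  "slab n J r = {x \<in> eucl n. \<forall>j\<in>J. \<bar>x j\<bar> \<le> r}"

abbreviation box :: "nat \<Rightarrow> real \<Rightarrow> (nat \<Rightarrow> real) set" where
  "box n \<equiv> slab n {..<n}"

definition on_coord :: "nat \<Rightarrow> (real \<Rightarrow> real) \<Rightarrow> (nat \<Rightarrow> real) \<Rightarrow> (nat \<Rightarrow> real)" where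
  "on_coord j f x = x(j := f (x j))"

text \<open>A homeomorphism known only on a slab is carried as a pair of maps that undo each other
  wherever the first image stays in the slab. No image set has to be described, the notion is
  symmetric in the pair, and for \<open>J = {}\<close> it is a homeomorphism of
  \<open>eucl n\<close> at distance at most \<delta> from the identity.\<close>

definition near_homeo ::
    "nat \<Rightarrow> nat set \<Rightarrow> real \<Rightarrow> real \<Rightarrow> ((nat \<Rightarrow> real) \<Rightarrow> (nat \<Rightarrow> real)) \<Rightarrow> ((nat \<Rightarrow> real) \<Rightarrow> (nat \<Rightarrow> real)) \<Rightarrow> bool" where
  "near_homeo n J r \<delta> h h' \<longleftrightarrow>
     continuous_on (slab n J r) h \<and> continuous_on (slab n J r) h' \<and>
     (\<forall>x \<in> slab n J r. h x \<in> eucl n \<and> near \<delta> (h x) x \<and> (h x \<in> slab n J r \<longrightarrow> h' (h x) = x)) \<and>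
     (\<forall>x \<in> slab n J r. h' x \<in> eucl n \<and> near \<delta> (h' x) x \<and> (h' x \<in> slab n J r \<longrightarrow> h (h' x) = x))"

lemma near_homeo_sym: "near_homeo n J r \<delta> h h' \<Longrightarrow> near_homeo n J r \<delta> h' h"
  by (auto simp: near_homeo_def)

lemma slab_empty [simp]: "slab n {} r = eucl n"
  by (simp add: slab_def)

lemma near_refl [simp]: "0 \<le> \<delta> \<Longrightarrow> near \<delta> x x"
  by (simp add: near_def)

lemma near_sym: "near \<delta> x y \<Longrightarrow> near \<delta> y x"
  by (simp add: near_def abs_minus_commute)

lemma near_trans: "near a x y \<Longrightarrow> near b y z \<Longrightarrow> near (a + b) x z"
proof -
  assume *: "near a x y" "near b y z"
  show ?thesis unfolding near_def
  proof
    fix i show "\<bar>x i - z i\<bar> \<le> a + b"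
      using *[unfolded near_def, rule_format, of i] by linarith
  qed
qed

lemma near_mono: "near a x y \<Longrightarrow> a \<le> b \<Longrightarrow> near b x y"
  unfolding near_def by (meson order_trans)

lemma on_coord_apply: "on_coord j f x i = (if i = j then f (x j) else x i)"
  by (simp add: on_coord_def)

lemma on_coord_on_coord: "on_coord j f (on_coord j g x) = on_coord j (\<lambda>t. f (g t)) x"
  by (simp add: on_coord_def)

lemma on_coord_id: "f (x j) = x j \<Longrightarrow> on_coord j f x = x"
  by (simp add: on_coord_def)

lemma on_coord_in_eucl: "j < n \<Longrightarrow> x \<in> eucl n \<Longrightarrow> on_coord j f x \<in> eucl n"
  by (auto simp: eucl_def on_coord_def)

lemma near_on_coord:
  assumes "near \<delta> x y" "\<And>a b. \<bar>f a - f b\<bar> \<le> \<bar>a - b\<bar>"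
  shows "near \<delta> (on_coord j f x) (on_coord j f y)"
  unfolding near_def
proof
  fix i
  show "\<bar>on_coord j f x i - on_coord j f y i\<bar> \<le> \<delta>"
    using assms(1)[unfolded near_def, rule_format, of i] assms(2)[of "x j" "y j"] by (auto simp: on_coord_def)
qed

lemma continuous_on_on_coord:
  assumes "continuous_on S g" "continuous_on UNIV f"
  shows "continuous_on S (\<lambda>x. on_coord j f (g x))"
proof (rule continuous_on_coordinatewise_then_product)
  fix i
  have g: "continuous_on S (\<lambda>x. g x k)" for k
    by (rule continuous_on_product_then_coordinatewise[OF assms(1)])
  show "continuous_on S (\<lambda>x. on_coord j f (g x) i)"
    using g[of i] continuous_on_compose2[OF assms(2) g[of j]] by (cases "i = j") (auto simp: on_coord_def)
qed

lemma continuous_on_shift: "continuous_on UNIV (\<lambda>t::real. t + a)" "continuous_on UNIV (\<lambda>t::real. t - a)"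
  by (intro continuous_intros)+

text \<open>The profile of \<open>s\<close>: the identity up to -2, translation by -4 from 3 on, and
  slope 1/5 in between, since an interval of length 5 has to fit into one of length 1.\<close>

definition compress :: "real \<Rightarrow> real" where
  "compress t = max (t - 4) (min t ((t - 8) / 5))"

definition expand :: "real \<Rightarrow> real" where
  "expand u = min (u + 4) (max u (5 * u + 8))"

lemma compress_cases: "compress t = (if t \<le> -2 then t else if t \<le> 3 then (t - 8) / 5 else t - 4)"
  by (simp add: compress_def min_def max_def)

lemma expand_cases: "expand u = (if u \<le> -2 then u else if u \<le> -1 then 5 * u + 8 else u + 4)"
  by (simp add: expand_def min_def max_def)

lemma compress_expand [simp]: "compress (expand u) = u"
  by (auto simp: compress_cases expand_cases field_simps)

lemma expand_compress [simp]: "expand (compress t) = t"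
  by (auto simp: compress_cases expand_cases field_simps)

text \<open>Only this half of the pair is 1-Lipschitz, as \<open>expand\<close> stretches by up to
  5. Closeness across an \<open>expand\<close> is therefore estimated only after a
  \<open>compress\<close> has undone it.\<close>

lemma compress_lip: "\<bar>compress a - compress b\<bar> \<le> \<bar>a - b\<bar>"
proof -
  have *: "compress a \<le> compress b \<and> compress b - compress a \<le> b - a" if "a \<le> b" for a b
    using that by (auto simp: compress_cases field_simps)
  show ?thesis
    using *[of a b] *[of b a] by linarith
qed

lemma compress_low: "t \<le> -2 \<Longrightarrow> compress t = t"
  and compress_high: "3 \<le> t \<Longrightarrow> compress t = t - 4"
  and compress_bounds: "t - 4 \<le> compress t" "compress t \<le> t"
  by (simp_all add: compress_cases)

lemma expand_low: "t \<le> -2 \<Longrightarrow> expand t = t"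
  and expand_high: "-1 \<le> t \<Longrightarrow> expand t = t + 4"
  and expand_bounds: "t \<le> expand t" "expand t \<le> t + 4"
  by (simp_all add: expand_cases)

lemma continuous_compress: "continuous_on UNIV compress"
  and continuous_expand: "continuous_on UNIV expand"
  unfolding compress_def expand_def by (intro continuous_intros; simp)+

text \<open>On block \<open>m\<close>, where \<open>c + p m \<le> x j < c + p (m + 1)\<close>, this
  is the conjugate of \<open>K m\<close> by translation through \<open>p m\<close>. A constant
  \<open>K\<close> gives periodic continuation; a varying one places an independent map in each
  block, as in the infinite products.\<close>

definition glue_blocks :: "nat \<Rightarrow> real \<Rightarrow> real \<Rightarrow> (int \<Rightarrow> (nat \<Rightarrow> real) \<Rightarrow> (nat \<Rightarrow> real)) \<Rightarrow> (nat \<Rightarrow> real) \<Rightarrow> (nat \<Rightarrow> real)" where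
  "glue_blocks j p c K x = (let m = \<lfloor>(x j - c) / p\<rfloor> in
     on_coord j (\<lambda>t. t + p * of_int m) (K m (on_coord j (\<lambda>t. t - p * of_int m) x)))"

text \<open>By \<open>eq\<close>, consecutive formulas agree on a collar of width \<eta> to the left
  of each block, so the formula of a block remains valid on its collar, although the floor already
  selects the previous block there.\<close>

lemma glue_blocks_block:
  assumes p: "p > 0"
    and eq: "\<And>m y. y \<in> D \<Longrightarrow> c - \<eta> \<le> y j \<Longrightarrow> y j \<le> c \<Longrightarrow>
       K m y = on_coord j (\<lambda>t. t - p) (K (m - 1) (on_coord j (\<lambda>t. t + p) y))"
    and D: "\<And>y a. y \<in> D \<Longrightarrow> on_coord j (\<lambda>t. t + a) y \<in> D"
    and x: "x \<in> D" "c - \<eta> + p * of_int m \<le> x j" "x j < c + p + p * of_int m" and "\<eta> \<le> p"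
  shows "glue_blocks j p c K x = on_coord j (\<lambda>t. t + p * of_int m) (K m (on_coord j (\<lambda>t. t - p * of_int m) x))"
proof (cases "x j \<ge> c + p * of_int m")
  case True
  then have "\<lfloor>(x j - c) / p\<rfloor> = m"
    using p x by (intro floor_unique) (auto simp: field_simps)
  then show ?thesis by (simp add: glue_blocks_def)
next
  case False
  then have m: "\<lfloor>(x j - c) / p\<rfloor> = m - 1"
    using p x \<open>\<eta> \<le> p\<close> by (intro floor_unique) (auto simp: field_simps)
  define y where "y = on_coord j (\<lambda>t. t - p * of_int m) x"
  have yD: "y \<in> D" using D[OF x(1), of "- p * of_int m"] by (simp add: y_def)
  have "K m y = on_coord j (\<lambda>t. t - p) (K (m - 1) (on_coord j (\<lambda>t. t + p) y))"
    using x False by (intro eq yD) (auto simp: y_def on_coord_def)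
  moreover have "on_coord j (\<lambda>t. t + p) y = on_coord j (\<lambda>t. t - p * of_int (m - 1)) x"
    by (simp add: y_def on_coord_def algebra_simps)
  ultimately have "on_coord j (\<lambda>t. t + p * of_int m) (K m y) = on_coord j (\<lambda>t. t + p * of_int (m - 1)) (K (m - 1) (on_coord j (\<lambda>t. t - p * of_int (m - 1)) x))"
    by (simp add: on_coord_on_coord algebra_simps)
  then show ?thesis by (simp add: glue_blocks_def m y_def)
qed

text \<open>Blocks enlarged by their collars form an open cover, and on each of them one continuous
  formula describes the glued map.\<close>

lemma continuous_on_glue_blocks:
  assumes p: "p > 0" and \<eta>: "0 < \<eta>" "\<eta> \<le> p"
    and eq: "\<And>m y. y \<in> D \<Longrightarrow> c - \<eta> \<le> y j \<Longrightarrow> y j \<le> c \<Longrightarrow>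
       K m y = on_coord j (\<lambda>t. t - p) (K (m - 1) (on_coord j (\<lambda>t. t + p) y))"
    and D: "\<And>y a. y \<in> D \<Longrightarrow> on_coord j (\<lambda>t. t + a) y \<in> D"
    and K: "\<And>m. continuous_on {y \<in> D. c - \<eta> \<le> y j \<and> y j \<le> c + p} (K m)"
  shows "continuous_on D (glue_blocks j p c K)"
proof -
  define U where "U m = {x::nat\<Rightarrow>real. c - \<eta> + p * of_int m < x j \<and> x j < c + p + p * of_int m}" for m :: int
  have U: "open (U m)" for m
    unfolding U_def Collect_conj_eq
    by (intro open_Int open_Collect_less continuous_intros continuous_on_product_coordinates)
  have cov: "D = (\<Union>m. D \<inter> U m)"
  proof -
    have "x \<in> U \<lfloor>(x j - c) / p\<rfloor>" for x
    proof -
      let ?m = "\<lfloor>(x j - c) / p\<rfloor>"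
      have "of_int ?m \<le> (x j - c) / p" "(x j - c) / p < of_int ?m + 1" by linarith+
      then have "p * of_int ?m \<le> x j - c" "x j - c < p * of_int ?m + p"
        unfolding pos_le_divide_eq[OF p] pos_divide_less_eq[OF p] by (simp_all add: algebra_simps)
      then show ?thesis using \<eta> unfolding U_def mem_Collect_eq by linarith
    qed
    then show ?thesis by blast
  qed
  have c: "continuous_on (D \<inter> U m) (glue_blocks j p c K)" for m
  proof -
    have "continuous_on (D \<inter> U m) (\<lambda>x. on_coord j (\<lambda>t. t + p * of_int m) (K m (on_coord j (\<lambda>t. t - p * of_int m) x)))"
    proof (rule continuous_on_on_coord[OF _ continuous_on_shift(1)], rule continuous_on_compose2[OF K[of m]])
      show "continuous_on (D \<inter> U m) (on_coord j (\<lambda>t. t - p * real_of_int m))"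
        by (rule continuous_on_on_coord[OF continuous_on_id continuous_on_shift(2), unfolded id_def])
      show "on_coord j (\<lambda>t. t - p * real_of_int m) ` (D \<inter> U m) \<subseteq> {y \<in> D. c - \<eta> \<le> y j \<and> y j \<le> c + p}"
        using D[of _ "- p * of_int m"] by (auto simp: U_def on_coord_apply)
    qed
    then show ?thesis
      by (rule continuous_on_eq) (auto simp: U_def intro!: glue_blocks_block[symmetric, where D=D and \<eta>=\<eta>] p eq D \<eta>)
  qed
  show ?thesis
    unfolding continuous_on_eq_continuous_within
  proof
    fix x assume x: "x \<in> D"
    then obtain m where m: "x \<in> U m" using cov by blast
    have "at x within D = at x within (D \<inter> U m)"
      using m U[of m] by (intro at_within_nhd[of x "U m"]) auto
    then show "continuous (at x within D) (glue_blocks j p c K)"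
      using c[of m] x m by (simp add: continuous_on_eq_continuous_within)
  qed
qed

section \<open>Unrolling near-identity embeddings\<close>

lemma glue_blocks_near:
  assumes "0 < p" and "\<And>m y. y \<in> D \<Longrightarrow> c \<le> y j \<Longrightarrow> y j \<le> c + p \<Longrightarrow> near \<delta> (K m y) y"
    and "\<And>y a. y \<in> D \<Longrightarrow> on_coord j (\<lambda>t. t + a) y \<in> D" and "x \<in> D"
  shows "near \<delta> (glue_blocks j p c K x) x"
proof -
  define m where "m = \<lfloor>(x j - c) / p\<rfloor>"
  have "of_int m \<le> (x j - c) / p" "(x j - c) / p < of_int m + 1"
    unfolding m_def by linarith+
  then have *: "p * of_int m \<le> x j - c" "x j - c < p * of_int m + p"
    unfolding pos_le_divide_eq[OF assms(1)] pos_divide_less_eq[OF assms(1)] by (simp_all add: algebra_simps)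
  let ?y = "on_coord j (\<lambda>t. t - p * of_int m) x"
  have "near \<delta> (K m ?y) ?y"
    using assms(3)[OF assms(4), of "- p * of_int m"] * by (intro assms(2)) (auto simp: on_coord_def)
  then have "near \<delta> (on_coord j (\<lambda>t. t + p * of_int m) (K m ?y)) (on_coord j (\<lambda>t. t + p * of_int m) ?y)"
    by (rule near_on_coord) auto
  then show ?thesis by (simp add: glue_blocks_def Let_def m_def on_coord_on_coord on_coord_id)
qed

text \<open>The word \<open>K\<close> is \<open>T (h s h' s') T' h\<close>. Where \<open>s\<close>
  is the identity the commutator cancels and \<open>K\<close> is \<open>h\<close>. Where
  \<open>s\<close> is \<open>T'\<close> the commutator is \<open>h T' h' T\<close>, and
  \<open>K\<close> becomes \<open>T h T'\<close>. So \<open>K\<close> at the right end of a block is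
  the translate of \<open>K\<close> at the left end, and it continues periodically. This frees
  coordinate \<open>j\<close> at the price of 1 in the radius and a factor 3 in the displacement.
  The last clause is inherited because \<open>T\<close> and \<open>s\<close> change coordinate
  \<open>j\<close> only.\<close>

lemma unroll:
  assumes P: "near_homeo n J r \<delta> h h'" and j: "j < n" "j \<in> J" and r: "r \<ge> 6" and \<delta>: "0 \<le> \<delta>" "\<delta> \<le> 1/12"
  shows "\<exists>H H'. near_homeo n (J - {j}) (r - 1) (3 * \<delta>) H H' \<and>
    (\<forall>x \<in> slab n (J - {j}) (r - 1). \<bar>x j\<bar> \<le> 1/2 \<longrightarrow> H x = h x) \<and>
    (\<forall>i. j \<noteq> i \<longrightarrow> (\<forall>y \<in> slab n J r. \<bar>y i\<bar> \<ge> 1 \<longrightarrow> h y = y) \<longrightarrow>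
       (\<forall>x \<in> slab n (J - {j}) (r - 1). \<bar>x i\<bar> \<ge> 1 \<longrightarrow> H x = x))"
proof -
  define T where "T = on_coord j (\<lambda>t. t + 4)"
  define T' where "T' = on_coord j (\<lambda>t. t - 4)"
  define s where "s = on_coord j compress"
  define s' where "s' = on_coord j expand"
  define K where "K y = T (h (s (h' (s' (T' (h y))))))" for y
  \<comment> \<open>The word \<open>K\<close> read backwards with every letter inverted.\<close>
  define K' where "K' y = h' (T (s (h (s' (h' (T' y))))))" for y
  define D where "D = slab n J r"
  define D' where "D' = slab n (J - {j}) (r - 1)"
  have near_h: "near \<delta> (h x) x" and near_h': "near \<delta> (h' x) x" if "x \<in> D" for x
    using P that by (auto simp: near_homeo_def D_def)
  have hE: "h x \<in> eucl n" and h'E: "h' x \<in> eucl n" if "x \<in> D" for x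
    using P that by (auto simp: near_homeo_def D_def)
  have h'h: "h' (h x) = x" if "x \<in> D" "h x \<in> D" for x
    using P that by (auto simp: near_homeo_def D_def)
  have hh': "h (h' x) = x" if "x \<in> D" "h' x \<in> D" for x
    using P that by (auto simp: near_homeo_def D_def)
  have ch: "continuous_on D h" and ch': "continuous_on D h'"
    using P by (auto simp: near_homeo_def D_def)
  have eucl: "T x \<in> eucl n" "T' x \<in> eucl n" "s x \<in> eucl n" "s' x \<in> eucl n" if "x \<in> eucl n" for x
    unfolding T_def T'_def s_def s'_def using j(1) that by (auto intro: on_coord_in_eucl)
  have nT: "near d (T x) (T y)" "near d (T' x) (T' y)" "near d (s x) (s y)" if "near d x y" for d x y
    unfolding T_def T'_def s_def using that compress_lip by (auto intro!: near_on_coord)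
  have inv: "T (T' x) = x" "T' (T x) = x" "s (s' x) = x" "s' (s x) = x" for x
    unfolding T_def T'_def s_def s'_def by (simp_all add: on_coord_on_coord on_coord_id)
  \<comment> \<open>\<open>B k\<close> collects what is reached from the block after at most \<open>k\<close> applications of \<open>h\<close> or \<open>h'\<close>.\<close>
  define B where "B k = {x \<in> eucl n. (\<forall>i\<in>J-{j}. \<bar>x i\<bar> \<le> r - 1 + of_nat k * \<delta>)}" for k
  have B0: "x \<in> B 0" if "x \<in> D'" for x
    using that by (auto simp: B_def D'_def slab_def)
  have Bact: "T x \<in> B k" "T' x \<in> B k" "s x \<in> B k" "s' x \<in> B k" if "x \<in> B k" for x k
    using that eucl by (auto simp: B_def T_def T'_def s_def s'_def on_coord_def)
  \<comment> \<open>Four applications move a coordinate by at most 4/12, less than the 1 given up in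
    the radius; \<open>r \<ge> 6\<close> leaves room in coordinate \<open>j\<close>.\<close>
  have BD: "x \<in> D" if "x \<in> B k" "k \<le> 4" "\<bar>x j\<bar> \<le> 5" for x k
  proof -
    have "of_nat k * \<delta> \<le> 4 * (1/12)" using that \<delta> by (intro mult_mono) auto
    then have "\<bar>x i\<bar> \<le> r" if "i \<in> J" for i
      using \<open>x \<in> B k\<close> \<open>\<bar>x j\<bar> \<le> 5\<close> r that by (cases "i = j") (auto simp: B_def dest!: bspec[of _ _ i])
    then show ?thesis using that by (auto simp: B_def D_def slab_def)
  qed
  have near_B: "y \<in> B (Suc k)" if "x \<in> B k" "y \<in> eucl n" "near \<delta> y x" for x y k
  proof -
    have "\<bar>y i\<bar> \<le> r - 1 + real (Suc k) * \<delta>" if "i \<in> J - {j}" for i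
    proof -
      have "\<bar>y i - x i\<bar> \<le> \<delta>" using \<open>near \<delta> y x\<close> by (auto simp: near_def)
      moreover have "\<bar>x i\<bar> \<le> r - 1 + real k * \<delta>" using \<open>x \<in> B k\<close> that by (auto simp: B_def)
      ultimately show ?thesis by (simp add: algebra_simps)
    qed
    then show ?thesis using \<open>y \<in> eucl n\<close> by (auto simp: B_def)
  qed
  have hB: "h x \<in> B (Suc k)" "\<bar>h x j - x j\<bar> \<le> \<delta>" if "x \<in> B k" "x \<in> D" for x k
    using near_B[OF that(1) hE[OF that(2)] near_h[OF that(2)]] near_h[OF that(2)] by (auto simp: near_def)
  have h'B: "h' x \<in> B (Suc k)" "\<bar>h' x j - x j\<bar> \<le> \<delta>" if "x \<in> B k" "x \<in> D" for x k
    using near_B[OF that(1) h'E[OF that(2)] near_h'[OF that(2)]] near_h'[OF that(2)] by (auto simp: near_def)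
  have co: "T x j = x j + 4" "T' x j = x j - 4" "s x j = compress (x j)" "s' x j = expand (x j)" for x
    by (auto simp: T_def T'_def s_def s'_def on_coord_def)

  have K: "y \<in> D \<and> h y \<in> B 1 \<and> h y \<in> D \<and> s' (T' (h y)) \<in> D \<and> h' (s' (T' (h y))) \<in> D \<and> h' (s' (T' (h y))) \<in> B 2 \<and>
      s (h' (s' (T' (h y)))) \<in> D \<and> s (h' (s' (T' (h y)))) \<in> B 2 \<and> h (s (h' (s' (T' (h y))))) \<in> D \<and> K y \<in> eucl n \<and> near (3 * \<delta>) (K y) y"
    if y: "y \<in> D'" "-1/2 \<le> y j" "y j \<le> 4" for y
  proof -
    have yD: "y \<in> D" using BD[OF B0] y by force
    have 1: "h y \<in> B 1" "\<bar>h y j - y j\<bar> \<le> \<delta>" using hB[OF B0 yD] y by auto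
    have hD: "h y \<in> D" using BD[OF 1(1)] 1 y \<delta> by force
    have 2: "s' (T' (h y)) \<in> B 1" using 1 Bact by blast
    have b: "h y j - 4 \<le> s' (T' (h y)) j" "s' (T' (h y)) j \<le> h y j"
      using expand_bounds[of "h y j - 4"] by (auto simp: co)
    have 3: "s' (T' (h y)) \<in> D" using BD[OF 2] b 1 y \<delta> by force
    have 4: "h' (s' (T' (h y))) \<in> B 2" "\<bar>h' (s' (T' (h y))) j - s' (T' (h y)) j\<bar> \<le> \<delta>"
      using h'B[OF 2 3] by (auto simp: numeral_2_eq_2)
    have 5: "h' (s' (T' (h y))) \<in> D" using BD[OF 4(1)] 4 b 1 y \<delta> by force
    have 6: "s (h' (s' (T' (h y)))) \<in> B 2" using 4 Bact by blast
    \<comment> \<open>The map \<open>h'\<close> moves \<open>s' (T' (h y))\<close> by at most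
      \<delta>, and the 1-Lipschitz \<open>s\<close> then cancels \<open>s'\<close>, so the
      stretching of \<open>s'\<close> does not enter.\<close>
    have n1: "near \<delta> (s (h' (s' (T' (h y))))) (T' (h y))"
      using nT(3)[OF near_h'[OF 3]] by (simp add: inv)
    then have "\<bar>s (h' (s' (T' (h y)))) j - T' (h y) j\<bar> \<le> \<delta>" by (auto simp: near_def)
    then have 7: "s (h' (s' (T' (h y)))) \<in> D" using BD[OF 6] 1 y \<delta> co(2)[of "h y"] by force
    note 8 = hB[OF 6 7]
    have n2: "near (\<delta> + \<delta>) (h (s (h' (s' (T' (h y)))))) (T' (h y))"
      by (rule near_trans[OF near_h[OF 7] n1])
    then have "\<bar>h (s (h' (s' (T' (h y))))) j - T' (h y) j\<bar> \<le> \<delta> + \<delta>" by (auto simp: near_def)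
    then have 9: "h (s (h' (s' (T' (h y))))) \<in> D" using BD[OF 8(1)] 1 y \<delta> co(2)[of "h y"] by force
    have 10: "K y \<in> eucl n" unfolding K_def using hE[OF 7] eucl by blast
    have "near (\<delta> + \<delta>) (K y) (h y)" using nT(1)[OF n2] by (simp add: inv K_def)
    from near_trans[OF this near_h[OF yD]] have 11: "near (3 * \<delta>) (K y) y" by simp
    show ?thesis using yD 1(1) hD 3 4(1) 5 6 7 9 10 11 by simp
  qed
  have K': "y \<in> D \<and> T' y \<in> D \<and> h' (T' y) \<in> D \<and> s' (h' (T' y)) \<in> D \<and> h (s' (h' (T' y))) \<in> D \<and>
      T (s (h (s' (h' (T' y))))) \<in> D \<and> s (h (s' (h' (T' y)))) \<in> D \<and> K' y \<in> D \<and> K' y \<in> eucl n \<and> near (3 * \<delta>) (K' y) y"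
    if y: "y \<in> D'" "-1/2 \<le> y j" "y j \<le> 4" for y
  proof -
    have yD: "y \<in> D" using BD[OF B0] y by force
    have 1: "T' y \<in> B 0" using B0 Bact y by blast
    have TD: "T' y \<in> D" using BD[OF 1] y co(2)[of y] by force
    note 2 = h'B[OF 1 TD]
    have 3: "h' (T' y) \<in> D" using BD[OF 2(1)] 2(2) y \<delta> co(2)[of y] by force
    have 4: "s' (h' (T' y)) \<in> B 1" using 2 Bact by (metis One_nat_def)
    have b: "h' (T' y) j \<le> s' (h' (T' y)) j" "s' (h' (T' y)) j \<le> h' (T' y) j + 4"
      using expand_bounds[of "h' (T' y) j"] by (auto simp: co(4))
    have 5: "s' (h' (T' y)) \<in> D" using BD[OF 4] b 2(2) y \<delta> co(2)[of y] by force
    note 6 = hB[OF 4 5]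
    have 7: "h (s' (h' (T' y))) \<in> D" using BD[OF 6(1)] 6(2) b 2(2) y \<delta> co(2)[of y] by force
    have n1: "near \<delta> (s (h (s' (h' (T' y))))) (h' (T' y))"
      using nT(3)[OF near_h[OF 5]] by (simp add: inv)
    have n2: "near (\<delta> + \<delta>) (s (h (s' (h' (T' y))))) (T' y)"
      by (rule near_trans[OF n1 near_h'[OF TD]])
    then have c: "\<bar>s (h (s' (h' (T' y)))) j - T' y j\<bar> \<le> \<delta> + \<delta>" by (auto simp: near_def)
    have 8: "s (h (s' (h' (T' y)))) \<in> B (Suc 1)" "T (s (h (s' (h' (T' y))))) \<in> B (Suc 1)" using 6 Bact by auto
    have 9: "s (h (s' (h' (T' y)))) \<in> D" using BD[OF 8(1)] c y \<delta> co(2)[of y] by force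
    have 10: "T (s (h (s' (h' (T' y))))) \<in> D" using BD[OF 8(2)] c y \<delta> co(2)[of y] co(1)[of "s (h (s' (h' (T' y))))"] by force
    note 11 = h'B[OF 8(2) 10]
    have 12: "K' y \<in> D" unfolding K'_def
      using BD[OF 11(1)] 11(2) c y \<delta> co(2)[of y] co(1)[of "s (h (s' (h' (T' y))))"] by force
    have 13: "K' y \<in> eucl n" unfolding K'_def using h'E[OF 10] .
    have "near (\<delta> + \<delta>) (T (s (h (s' (h' (T' y)))))) y" using nT(1)[OF n2] by (simp add: inv)
    from near_trans[OF near_h'[OF 10] this] have 14: "near (3 * \<delta>) (K' y) y" by (simp add: K'_def)
    show ?thesis using yD TD 3 5 7 9 10 12 13 14 by blast
  qed
  have KK': "K' (K y) = y" if "y \<in> D'" "-1/2 \<le> y j" "y j \<le> 4" for y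
    using K[OF that] by (simp add: K_def K'_def inv h'h hh')
  have K'K: "K (K' y) = y" if "y \<in> D'" "-1/2 \<le> y j" "y j \<le> 4" for y
    using K'[OF that] by (simp add: K_def K'_def inv h'h hh')
  \<comment> \<open>On the left both \<open>s'\<close> and \<open>s\<close> meet points with
    coordinate at most -2 and do nothing.\<close>
  have K_low: "K y = h y" if "y \<in> D'" "-1/2 \<le> y j" "y j \<le> 2 - 3 * \<delta>" for y
  proof -
    have k: "y \<in> D" "h y \<in> D" "\<bar>h y j - y j\<bar> \<le> \<delta>" "s' (T' (h y)) \<in> D" "h' (s' (T' (h y))) \<in> D"
      using K[of y] that \<delta> hB(2)[OF B0] by auto
    have a: "T' (h y) j \<le> -2 - 2 * \<delta>" using k that co(2)[of "h y"] by auto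
    have "s' (T' (h y)) = T' (h y)" unfolding s'_def
      using a \<delta> by (intro on_coord_id expand_low) auto
    then have b: "h' (s' (T' (h y))) = h' (T' (h y))" "T' (h y) \<in> D" "h' (T' (h y)) \<in> D" using k by auto
    then have "h' (T' (h y)) j \<le> -2" using a near_h'[OF b(2)] unfolding near_def by (smt (verit) \<delta>)
    then have "s (h' (T' (h y))) = h' (T' (h y))" unfolding s_def by (intro on_coord_id compress_low)
    then show ?thesis using b by (simp add: K_def hh' inv)
  qed
  \<comment> \<open>On the right \<open>s'\<close> undoes \<open>T'\<close>, so \<open>h'\<close>
    meets \<open>h y\<close> and cancels it, and \<open>s\<close> then acts on \<open>y\<close> as
    \<open>T'\<close>.\<close>
  have K_high: "K y = T (h (T' y))" if "y \<in> D'" "3 + 3 * \<delta> \<le> y j" "y j \<le> 4" for y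
  proof -
    have k: "y \<in> D" "h y \<in> D" "\<bar>h y j - y j\<bar> \<le> \<delta>" "s' (T' (h y)) \<in> D" "h' (s' (T' (h y))) \<in> D"
      using K[of y] that \<delta> hB(2)[OF B0] by auto
    have "s' (T' (h y)) = T (T' (h y))" unfolding s'_def T_def
      using k that \<delta> co(2)[of "h y"] by (simp add: on_coord_def expand_high)
    then have "h' (s' (T' (h y))) = y" using k by (simp add: inv h'h)
    moreover have "s y = T' y" unfolding s_def T'_def using that \<delta> by (simp add: on_coord_def compress_high)
    ultimately show ?thesis by (simp add: K_def)
  qed
  have K'_low: "K' y = h' y" if "y \<in> D'" "-1/2 \<le> y j" "y j \<le> 2 - 3 * \<delta>" for y
  proof -
    have k: "T' y \<in> D" "h' (T' y) \<in> D" using K'[of y] that \<delta> by auto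
    have "h' (T' y) j \<le> -2" using that near_h'[OF k(1)] co(2)[of y] unfolding near_def by (smt (verit) \<delta>)
    then have "s' (h' (T' y)) = h' (T' y)" unfolding s'_def by (intro on_coord_id expand_low)
    moreover have "s (T' y) = T' y" unfolding s_def using that \<delta> co(2)[of y] by (intro on_coord_id compress_low) auto
    ultimately show ?thesis using k by (simp add: K'_def hh' inv)
  qed
  have K'_high: "K' y = T (h' (T' y))" if "y \<in> D'" "3 + 3 * \<delta> \<le> y j" "y j \<le> 4" for y
  proof -
    have k: "T' y \<in> D" "h' (T' y) \<in> D" "s' (h' (T' y)) \<in> D" "h (s' (h' (T' y))) \<in> D" using K'[of y] that \<delta> by auto
    have a: "\<bar>h' (T' y) j - T' y j\<bar> \<le> \<delta>" using near_h'[OF k(1)] by (auto simp: near_def)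
    have e: "s' (h' (T' y)) = T (h' (T' y))" unfolding s'_def T_def
      using a that \<delta> co(2)[of y] by (simp add: on_coord_def expand_high)
    then have "\<bar>h (T (h' (T' y))) j - T (h' (T' y)) j\<bar> \<le> \<delta>" using near_h[OF k(3)] by (auto simp: near_def)
    then have "s (h (T (h' (T' y)))) = T' (h (T (h' (T' y))))" unfolding s_def T'_def
      using a that \<delta> co(1)[of "h' (T' y)"] co(2)[of y] by (simp add: on_coord_def compress_high T'_def)
    then show ?thesis using k e by (simp add: K'_def inv h'h)
  qed
  have D'shift: "on_coord j (\<lambda>t. t + a) y \<in> D'" if "y \<in> D'" for y a
    using that on_coord_in_eucl[OF j(1)] by (auto simp: D'_def slab_def on_coord_def)
  have T_in_D': "T y \<in> D'" if "y \<in> D'" for y using D'shift[OF that, of 4] by (simp add: T_def)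
  define H where "H = glue_blocks j 4 0 (\<lambda>_. K)"
  define H' where "H' = glue_blocks j 4 0 (\<lambda>_. K')"
  \<comment> \<open>The left formula at \<open>y\<close> is compared with the right formula at
    \<open>T y\<close>. The latter applies because \<open>T y\<close> has coordinate at least 7/2,
    while \<open>3 + 3 * \<delta>\<close> is at most 13/4.\<close>
  have per: "K y = on_coord j (\<lambda>t. t - 4) (K (on_coord j (\<lambda>t. t + 4) y))"
    "K' y = on_coord j (\<lambda>t. t - 4) (K' (on_coord j (\<lambda>t. t + 4) y))"
    if "y \<in> D'" "0 - 1/2 \<le> y j" "y j \<le> 0" for y
  proof -
    have *: "3 + 3 * \<delta> \<le> T y j" "T y j \<le> 4" "T y \<in> D'" "y j \<le> 2 - 3 * \<delta>" "-1/2 \<le> y j"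
      using that \<delta> co(1)[of y] T_in_D' by auto
    show "K y = on_coord j (\<lambda>t. t - 4) (K (on_coord j (\<lambda>t. t + 4) y))"
      "K' y = on_coord j (\<lambda>t. t - 4) (K' (on_coord j (\<lambda>t. t + 4) y))"
      using K_low[OF that(1) *(5,4)] K_high[OF *(3,1,2)] K'_low[OF that(1) *(5,4)] K'_high[OF *(3,1,2)]
      by (simp_all flip: T_def T'_def add: inv)
  qed
  have nearHH': "near (3 * \<delta>) (H x) x" "near (3 * \<delta>) (H' x) x" if "x \<in> D'" for x
    unfolding H_def H'_def
    using K K' by (intro glue_blocks_near[where D=D'] D'shift that; auto)+
  have cK: "continuous_on {y \<in> D'. 0 - 1/2 \<le> y j \<and> y j \<le> 0 + 4} K"
    "continuous_on {y \<in> D'. 0 - 1/2 \<le> y j \<and> y j \<le> 0 + 4} K'" (is "continuous_on ?S K'")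
  proof -
    have cc: "continuous_on ?S (\<lambda>y. T (g y))" "continuous_on ?S (\<lambda>y. T' (g y))" 
      "continuous_on ?S (\<lambda>y. s (g y))" "continuous_on ?S (\<lambda>y. s' (g y))" if "continuous_on ?S g" for g
      unfolding T_def T'_def s_def s'_def
      by (intro continuous_on_on_coord that continuous_on_shift continuous_compress continuous_expand)+
    have chh: "continuous_on ?S (\<lambda>y. h (g y))" if "continuous_on ?S g" "\<And>y. y \<in> ?S \<Longrightarrow> g y \<in> D" for g
      using continuous_on_compose2[OF ch that(1)] that(2) by blast
    have chh': "continuous_on ?S (\<lambda>y. h' (g y))" if "continuous_on ?S g" "\<And>y. y \<in> ?S \<Longrightarrow> g y \<in> D" for g
      using continuous_on_compose2[OF ch' that(1)] that(2) by blast
    show "continuous_on ?S K" unfolding K_def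
      by (intro cc chh chh' continuous_on_id[unfolded id_def]) (use K in auto)
    show "continuous_on ?S K'" unfolding K'_def
      by (intro cc chh chh' continuous_on_id[unfolded id_def]) (use K' in auto)
  qed
  have cH: "continuous_on D' H" "continuous_on D' H'"
    unfolding H_def H'_def
    using per cK by (intro continuous_on_glue_blocks[where \<eta>="1/2"] D'shift; force)+
  have blk: "H x = on_coord j (\<lambda>t. t + 4 * of_int m) (K (on_coord j (\<lambda>t. t - 4 * of_int m) x))"
    "H' x = on_coord j (\<lambda>t. t + 4 * of_int m) (K' (on_coord j (\<lambda>t. t - 4 * of_int m) x))"
    if "x \<in> D'" "-1/2 + 4 * of_int m \<le> x j" "x j < 4 + 4 * of_int m" for x m
    unfolding H_def H'_def
    using per that by (intro glue_blocks_block[where \<eta>="1/2" and D=D'] D'shift; force)+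
  \<comment> \<open>The blocks are moved by 1/4: a displacement of at most
    \<open>3 * \<delta> \<le> 1/4\<close> then keeps the image in the range from -1/2 to 4 where
    \<open>blk\<close> holds with the same \<open>m\<close>, so the inverse is computed in one
    block.\<close>
  have block: "\<exists>m. -1/4 + 4 * of_int m \<le> x j \<and> x j < 4 - 1/4 + 4 * of_int m" for x :: "nat \<Rightarrow> real"
  proof -
    have "of_int \<lfloor>(x j + 1/4) / 4\<rfloor> \<le> (x j + 1/4) / 4" "(x j + 1/4) / 4 < of_int \<lfloor>(x j + 1/4) / 4\<rfloor> + 1" by linarith+
    then show ?thesis by (intro exI[of _ "\<lfloor>(x j + 1/4) / 4\<rfloor>"]) (auto simp: field_simps)
  qed
  have EH: "H x \<in> eucl n \<and> (H x \<in> D' \<longrightarrow> H' (H x) = x)" if x: "x \<in> D'" for x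
  proof -
    obtain m where m: "-1/4 + 4 * of_int m \<le> x j" "x j < 4 - 1/4 + 4 * of_int m" using block by blast
    define y where "y = on_coord j (\<lambda>t. t - 4 * of_int m) x"
    have y: "y \<in> D'" "-1/4 \<le> y j" "y j \<le> 4"
      using D'shift[OF x, of "- 4 * of_int m"] m by (auto simp: y_def on_coord_def)
    have Hx: "H x = on_coord j (\<lambda>t. t + 4 * of_int m) (K y)"
      unfolding y_def using m by (intro blk x) auto
    have yy: "K y \<in> eucl n" "K' (K y) = y" using K[of y] KK'[of y] y by auto
    have "H' (H x) = x" if "H x \<in> D'"
    proof -
      have "\<bar>H x j - x j\<bar> \<le> 1/4" 
        using nearHH'(1)[OF x, unfolded near_def, rule_format, of j] \<delta> by linarith
      then have "H' (H x) = on_coord j (\<lambda>t. t + 4 * of_int m) (K' (on_coord j (\<lambda>t. t - 4 * of_int m) (H x)))"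
        using m by (intro blk(2) that; linarith)
      then show ?thesis using Hx yy(2) by (simp add: on_coord_on_coord on_coord_id y_def)
    qed
    then show ?thesis using Hx yy(1) on_coord_in_eucl[OF j(1)] by auto
  qed
  have EH': "H' x \<in> eucl n \<and> (H' x \<in> D' \<longrightarrow> H (H' x) = x)" if x: "x \<in> D'" for x
  proof -
    obtain m where m: "-1/4 + 4 * of_int m \<le> x j" "x j < 4 - 1/4 + 4 * of_int m" using block by blast
    define y where "y = on_coord j (\<lambda>t. t - 4 * of_int m) x"
    have y: "y \<in> D'" "-1/4 \<le> y j" "y j \<le> 4"
      using D'shift[OF x, of "- 4 * of_int m"] m by (auto simp: y_def on_coord_def)
    have Hx: "H' x = on_coord j (\<lambda>t. t + 4 * of_int m) (K' y)"
      unfolding y_def using m by (intro blk x) auto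
    have yy: "K' y \<in> eucl n" "K (K' y) = y" using K'[of y] K'K[of y] y by auto
    have "H (H' x) = x" if "H' x \<in> D'"
    proof -
      have "\<bar>H' x j - x j\<bar> \<le> 1/4" 
        using nearHH'(2)[OF x, unfolded near_def, rule_format, of j] \<delta> by linarith
      then have "H (H' x) = on_coord j (\<lambda>t. t + 4 * of_int m) (K (on_coord j (\<lambda>t. t - 4 * of_int m) (H' x)))"
        using m by (intro blk(1) that; linarith)
      then show ?thesis using Hx yy(2) by (simp add: on_coord_on_coord on_coord_id y_def)
    qed
    then show ?thesis using Hx yy(1) on_coord_in_eucl[OF j(1)] by auto
  qed
  have 1: "near_homeo n (J - {j}) (r - 1) (3 * \<delta>) H H'"
    unfolding near_homeo_def D'_def[symmetric] using cH EH EH' nearHH' by blast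
  have 2: "H x = h x" if "x \<in> D'" "\<bar>x j\<bar> \<le> 1/2" for x
  proof -
    have "H x = K x"
      using blk(1)[OF that(1), of 0] that(2) by (auto simp: on_coord_id abs_if split: if_splits)
    also have "K x = h x"
      using that \<delta> by (intro K_low) (auto simp: abs_if split: if_splits)
    finally show ?thesis .
  qed
  have 3: "H x = x" if "j \<noteq> i" and fx: "\<forall>y \<in> slab n J r. \<bar>y i\<bar> \<ge> 1 \<longrightarrow> h y = y" and x: "x \<in> D'" "\<bar>x i\<bar> \<ge> 1" for x i
  proof -
    have fx': "h' y = y" if "y \<in> D" "\<bar>y i\<bar> \<ge> 1" for y
      using fx[unfolded D_def[symmetric]] h'h[OF that(1)] that by auto
    obtain m where m: "-1/4 + 4 * of_int m \<le> x j" "x j < 4 - 1/4 + 4 * of_int m" using block by blast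
    define y where "y = on_coord j (\<lambda>t. t - 4 * of_int m) x"
    have y: "y \<in> D'" "-1/2 \<le> y j" "y j \<le> 4" "y i = x i"
      using D'shift[OF x(1), of "- 4 * of_int m"] m \<open>j \<noteq> i\<close> by (auto simp: y_def on_coord_def)
    have Hx: "H x = on_coord j (\<lambda>t. t + 4 * of_int m) (K y)"
      unfolding y_def using m by (intro blk x) auto
    note k = K[OF y(1-3)]
    have hy: "h y = y" using fx k y x by (simp add: D_def)
    have "\<bar>s' (T' y) i\<bar> \<ge> 1" using y x \<open>j \<noteq> i\<close> by (simp add: s'_def T'_def on_coord_def)
    then have a: "h' (s' (T' y)) = s' (T' y)" using fx' k hy by simp
    have "\<bar>T' y i\<bar> \<ge> 1" using y x \<open>j \<noteq> i\<close> by (simp add: T'_def on_coord_def)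
    then have "h (T' y) = T' y" using fx k hy a by (simp add: D_def inv)
    then have "K y = y" by (simp add: K_def hy a inv)
    then show ?thesis using Hx by (simp add: y_def on_coord_on_coord on_coord_id)
  qed
  show ?thesis using 1 2 3 unfolding D'_def by blast
qed

text \<open>One transverse coordinate is freed at a time. The radius \<open>6 + card J\<close> pays
  1 for each, and as long as \<open>J\<close> is nonempty \<open>3 * \<delta>\<close> stays below
  \<open>3 ^ card J * \<delta> \<le> 1/4\<close>, the bound that \<open>unroll\<close> asks for. The
  set \<open>I\<close> holds the directions along the handle, where the map is already the identity
  beyond 1.\<close>

lemma unroll_all:
  assumes "finite J" "J \<subseteq> {..<n}" "near_homeo n J (6 + card J) \<delta> h h'" "0 \<le> \<delta>" "3 ^ card J * \<delta> \<le> 1/4"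
    and "I \<inter> J = {}" "\<And>x i. x \<in> slab n J (6 + card J) \<Longrightarrow> i \<in> I \<Longrightarrow> \<bar>x i\<bar> \<ge> 1 \<Longrightarrow> h x = x"
  obtains H H' where "near_homeo n {} 0 (3 ^ card J * \<delta>) H H'"
    "\<And>x. x \<in> slab n J (1/2) \<Longrightarrow> H x = h x"
    "\<And>x i. x \<in> eucl n \<Longrightarrow> i \<in> I \<Longrightarrow> \<bar>x i\<bar> \<ge> 1 \<Longrightarrow> H x = x"
proof -
  have "\<exists>H H'. near_homeo n {} 0 (3 ^ card J * \<delta>) H H' \<and> (\<forall>x \<in> slab n J (1/2). H x = h x) \<and>
     (\<forall>x \<in> eucl n. \<forall>i \<in> I. \<bar>x i\<bar> \<ge> 1 \<longrightarrow> H x = x)"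
    using assms
  proof (induction "card J" arbitrary: J \<delta> h h')
    case 0
    then show ?case by (intro exI[of _ h] exI[of _ h']) (simp add: near_homeo_def)
  next
    case (Suc k)
    from Suc(2) obtain j where j: "j \<in> J" by fastforce
    have k: "k = card (J - {j})" using Suc(2,3) j by simp
    have J: "real (6 + card J) - 1 = real (6 + card (J - {j}))" using k Suc(2) by simp
    have 3: "3 ^ card J * \<delta> = 3 ^ card (J - {j}) * (3 * \<delta>)" using k Suc(2)[symmetric] by simp
    have "3 * \<delta> \<le> 3 ^ card J * \<delta>"
      using Suc(2)[symmetric] \<open>0 \<le> \<delta>\<close> by (intro mult_right_mono) auto
    then have \<delta>: "\<delta> \<le> 1/12" using Suc by linarith
    have jn: "j < n" and r: "6 \<le> real (6 + card J)" using j Suc.prems(2) by auto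
    obtain H H' where H: "near_homeo n (J - {j}) (real (6 + card J) - 1) (3 * \<delta>) H H'"
      "\<forall>x \<in> slab n (J - {j}) (real (6 + card J) - 1). \<bar>x j\<bar> \<le> 1/2 \<longrightarrow> H x = h x"
      "\<forall>i. j \<noteq> i \<longrightarrow> (\<forall>y \<in> slab n J (real (6 + card J)). \<bar>y i\<bar> \<ge> 1 \<longrightarrow> h y = y) \<longrightarrow>
         (\<forall>x \<in> slab n (J - {j}) (real (6 + card J) - 1). \<bar>x i\<bar> \<ge> 1 \<longrightarrow> H x = x)"
      using unroll[OF Suc.prems(3) jn j r Suc.prems(4) \<delta>] by blast
    have fixH: "H x = x" if "x \<in> slab n (J - {j}) (real (6 + card (J - {j})))" "i \<in> I" "\<bar>x i\<bar> \<ge> 1" for x i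
    proof -
      have "j \<noteq> i" using Suc.prems(6) j that by blast
      then show ?thesis using H(3) Suc.prems(7) that unfolding J by blast
    qed
    have "\<exists>G G'. near_homeo n {} 0 (3 ^ card (J - {j}) * (3 * \<delta>)) G G' \<and> (\<forall>x \<in> slab n (J - {j}) (1/2). G x = H x) \<and>
      (\<forall>x \<in> eucl n. \<forall>i \<in> I. \<bar>x i\<bar> \<ge> 1 \<longrightarrow> G x = x)"
      using Suc.prems H(1) fixH J 3 by (intro Suc.hyps(1)[OF k, of "3 * \<delta>" H H']) auto
    then obtain G G' where G: "near_homeo n {} 0 (3 ^ card J * \<delta>) G G'" "\<And>x. x \<in> slab n (J - {j}) (1/2) \<Longrightarrow> G x = H x"
      "\<forall>x \<in> eucl n. \<forall>i \<in> I. \<bar>x i\<bar> \<ge> 1 \<longrightarrow> G x = x"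
      unfolding 3 by blast
    have "G x = h x" if x: "x \<in> slab n J (1/2)" for x
    proof -
      have "x \<in> slab n (J - {j}) (1/2)" "\<bar>x j\<bar> \<le> 1/2" using x j by (auto simp: slab_def)
      moreover from this have "x \<in> slab n (J - {j}) (real (6 + card J) - 1)" by (force simp: slab_def)
      ultimately show ?thesis using G(2) H(2) by simp
    qed
    then show ?case using G(1,3) by blast
  qed
  then show ?thesis using that by blast
qed

section \<open>Radial squeezing\<close>

text \<open>The sup norm cut off below at 1; the cutoff makes \<open>shrink\<close> the identity on
  the unit box.\<close>

primrec max_norm :: "nat \<Rightarrow> (nat \<Rightarrow> real) \<Rightarrow> real" where
  "max_norm 0 x = 1"
| "max_norm (Suc n) x = max (max_norm n x) \<bar>x n\<bar>"

lemma max_norm_ge_1 [simp]: "1 \<le> max_norm n x"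
  by (induction n) auto

lemma max_norm_pos [simp]: "0 < 1 + max_norm n x" "1 + max_norm n x \<noteq> 0"
  using max_norm_ge_1[of n x] by linarith+

lemma max_norm_le_iff: "max_norm n x \<le> c \<longleftrightarrow> 1 \<le> c \<and> (\<forall>i<n. \<bar>x i\<bar> \<le> c)"
  by (induction n) (auto simp: less_Suc_eq)

lemma max_norm_attained: "max_norm n x = 1 \<or> (\<exists>i<n. max_norm n x = \<bar>x i\<bar>)"
  by (induction n) (auto simp: less_Suc_eq max_def)

lemma coord_le_max_norm: "x \<in> eucl n \<Longrightarrow> \<bar>x i\<bar> \<le> max_norm n x"
  using max_norm_le_iff[of n x "max_norm n x"] order_trans[OF zero_le_one max_norm_ge_1[of n x]] by (cases "i < n") (auto simp: eucl_def)

lemma max_norm_near: "near D x y \<Longrightarrow> \<bar>max_norm n x - max_norm n y\<bar> \<le> D"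
proof (induction n)
  case 0
  then show ?case by (auto simp: near_def dest: spec[of _ 0])
next
  case (Suc n)
  then have "\<bar>max_norm n x - max_norm n y\<bar> \<le> D" "\<bar>x n - y n\<bar> \<le> D" by (auto simp: near_def)
  then show ?case unfolding max_norm.simps by linarith
qed

lemma continuous_on_coord: "continuous_on S (\<lambda>x::nat\<Rightarrow>real. x i)"
  by (rule continuous_on_subset[OF continuous_on_product_coordinates]) simp

lemma continuous_on_max_norm: "continuous_on S (max_norm n)"
  by (induction n) (auto intro!: continuous_intros continuous_on_coord)

text \<open>Radially, \<open>m\<close> becomes \<open>2 m / (1 + m)\<close>: all of
  \<open>eucl n\<close> goes onto the open box of radius 2, and the unit box is fixed pointwise.
  Solving for \<open>m\<close> gives the factor in \<open>unshrink\<close>, which is meaningful for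
  \<open>max_norm\<close> below 2.\<close>

definition shrink :: "nat \<Rightarrow> (nat \<Rightarrow> real) \<Rightarrow> (nat \<Rightarrow> real)" where
  "shrink n x = (\<lambda>i. 2 * x i / (1 + max_norm n x))"

definition unshrink :: "nat \<Rightarrow> (nat \<Rightarrow> real) \<Rightarrow> (nat \<Rightarrow> real)" where
  "unshrink n y = (\<lambda>i. y i / (2 - max_norm n y))"

lemma max_norm_shrink: "max_norm n (shrink n x) = 2 * max_norm n x / (1 + max_norm n x)"
proof (rule antisym)
  have m: "1 \<le> max_norm n x" by simp
  have "\<bar>shrink n x i\<bar> \<le> 2 * max_norm n x / (1 + max_norm n x)" if "i < n" for i
  proof -
    have "\<bar>x i\<bar> \<le> max_norm n x" using max_norm_le_iff[of n x "max_norm n x"] that by simp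
    then show ?thesis using m by (auto simp: shrink_def abs_mult intro!: divide_right_mono)
  qed
  then show "max_norm n (shrink n x) \<le> 2 * max_norm n x / (1 + max_norm n x)"
    unfolding max_norm_le_iff using m by (auto simp: le_divide_eq)
  show "2 * max_norm n x / (1 + max_norm n x) \<le> max_norm n (shrink n x)"
    using max_norm_attained[of n x]
  proof
    assume "\<exists>i<n. max_norm n x = \<bar>x i\<bar>"
    then obtain i where i: "i < n" "max_norm n x = \<bar>x i\<bar>" by blast
    have "\<bar>shrink n x i\<bar> \<le> max_norm n (shrink n x)" using max_norm_le_iff[of n "shrink n x" "max_norm n (shrink n x)"] i by simp
    moreover have "\<bar>shrink n x i\<bar> = 2 * max_norm n x / (1 + max_norm n x)" using i m by (simp add: shrink_def abs_mult)
    ultimately show ?thesis by simp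
  qed simp
qed

lemma max_norm_unshrink: assumes "max_norm n y < 2" shows "max_norm n (unshrink n y) = max_norm n y / (2 - max_norm n y)"
proof (rule antisym)
  have m: "1 \<le> max_norm n y" by simp
  have "\<bar>unshrink n y i\<bar> \<le> max_norm n y / (2 - max_norm n y)" if "i < n" for i
  proof -
    have "\<bar>y i\<bar> \<le> max_norm n y" using max_norm_le_iff[of n y "max_norm n y"] that by simp
    then show ?thesis using m assms by (auto simp: unshrink_def intro!: divide_right_mono)
  qed
  then show "max_norm n (unshrink n y) \<le> max_norm n y / (2 - max_norm n y)"
    unfolding max_norm_le_iff using m assms by (auto simp: field_simps)
  show "max_norm n y / (2 - max_norm n y) \<le> max_norm n (unshrink n y)"
    using max_norm_attained[of n y]
  proof
    assume "\<exists>i<n. max_norm n y = \<bar>y i\<bar>"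
    then obtain i where i: "i < n" "max_norm n y = \<bar>y i\<bar>" by blast
    have "\<bar>unshrink n y i\<bar> \<le> max_norm n (unshrink n y)" using max_norm_le_iff[of n "unshrink n y" "max_norm n (unshrink n y)"] i by simp
    moreover have "\<bar>unshrink n y i\<bar> = max_norm n y / (2 - max_norm n y)" using i m assms by (simp add: unshrink_def)
    ultimately show ?thesis by simp
  qed simp
qed

lemma max_norm_shrink_less: "max_norm n (shrink n x) < 2"
  by (simp add: max_norm_shrink pos_divide_less_eq)

lemma unshrink_shrink [simp]: "unshrink n (shrink n x) = x"
proof
  fix i
  have "2 - 2 * max_norm n x / (1 + max_norm n x) = (2 * (1 + max_norm n x) - 2 * max_norm n x) / (1 + max_norm n x)"
    by (simp add: diff_divide_distrib del: distrib_left_numeral)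
  also have "\<dots> = 2 / (1 + max_norm n x)" by simp
  finally show "unshrink n (shrink n x) i = x i"
    unfolding unshrink_def max_norm_shrink unfolding shrink_def by simp
qed

lemma shrink_unshrink: assumes "max_norm n y < 2" shows "shrink n (unshrink n y) = y"
proof
  fix i
  have "1 + max_norm n y / (2 - max_norm n y) = 2 / (2 - max_norm n y)" using assms by (simp add: field_simps)
  then show "shrink n (unshrink n y) i = y i"
    unfolding shrink_def max_norm_unshrink[OF assms] unfolding unshrink_def using assms by (simp add: field_simps)
qed

lemma shrink_in_eucl: "x \<in> eucl n \<Longrightarrow> shrink n x \<in> eucl n" and unshrink_in_eucl: "x \<in> eucl n \<Longrightarrow> unshrink n x \<in> eucl n"
  by (auto simp: eucl_def shrink_def unshrink_def)

lemma shrink_id: "max_norm n x = 1 \<Longrightarrow> shrink n x = x" and unshrink_id: "max_norm n x = 1 \<Longrightarrow> unshrink n x = x"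
  by (auto simp: shrink_def unshrink_def)

text \<open>The contraction grows with the norm, so a displacement bounded by \<open>D\<close>
  becomes one of order \<open>D\<close> over the norm. The difference is split into a change of
  numerator and a change of denominator, each contributing \<open>2 D / (1 + m)\<close>.\<close>

lemma shrink_near:
  assumes "near D x y" "x \<in> eucl n" "y \<in> eucl n"
  shows "near (4 * D / (1 + max_norm n x)) (shrink n x) (shrink n y)"
  unfolding near_def
proof
  fix i
  define m m' where "m = max_norm n x" and "m' = max_norm n y"
  have m: "1 \<le> m" "1 \<le> m'" "\<bar>m - m'\<bar> \<le> D" "\<bar>x i - y i\<bar> \<le> D" "\<bar>y i\<bar> \<le> m'"
    using max_norm_near[OF assms(1)] assms(1) coord_le_max_norm[OF assms(3)] by (auto simp: m_def m'_def near_def)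
  have "shrink n x i - shrink n y i = 2 * (x i - y i) / (1 + m) + 2 * (y i / (1 + m')) * ((m' - m) / (1 + m))"
    using m by (simp add: shrink_def m_def[symmetric] m'_def[symmetric] divide_simps) (simp add: algebra_simps)
  also have "\<bar>\<dots>\<bar> \<le> 2 * D / (1 + m) + 2 * 1 * (D / (1 + m))"
  proof (rule order_trans[OF abs_triangle_ineq add_mono])
    show "\<bar>2 * (x i - y i) / (1 + m)\<bar> \<le> 2 * D / (1 + m)"
      using m by (auto simp: abs_mult intro!: divide_right_mono)
    show "\<bar>2 * (y i / (1 + m')) * ((m' - m) / (1 + m))\<bar> \<le> 2 * 1 * (D / (1 + m))"
      unfolding abs_mult using m by (intro mult_mono) (auto simp: divide_right_mono)
  qed
  finally show "\<bar>shrink n x i - shrink n y i\<bar> \<le> 4 * D / (1 + max_norm n x)" by (simp add: m_def)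
qed

lemma continuous_on_shrink: "continuous_on S (shrink n)"
proof (rule continuous_on_coordinatewise_then_product)
  have "1 + max_norm n x \<noteq> 0" for x using max_norm_ge_1[of n x] by linarith
  then show "continuous_on S (\<lambda>x. shrink n x i)" for i
    unfolding shrink_def by (intro continuous_intros continuous_on_coord continuous_on_max_norm) auto
qed

lemma continuous_on_unshrink: "S \<subseteq> {y. max_norm n y < 2} \<Longrightarrow> continuous_on S (unshrink n)"
proof (rule continuous_on_coordinatewise_then_product)
  show "continuous_on S (\<lambda>x. unshrink n x i)" if "S \<subseteq> {y. max_norm n y < 2}" for i
    unfolding unshrink_def using that by (intro continuous_intros continuous_on_coord continuous_on_max_norm) force
qed

definition squeeze :: "nat \<Rightarrow> ((nat \<Rightarrow> real) \<Rightarrow> (nat \<Rightarrow> real)) \<Rightarrow> (nat \<Rightarrow> real) \<Rightarrow> (nat \<Rightarrow> real)" where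
  "squeeze n H y = (if max_norm n y < 2 then shrink n (H (unshrink n y)) else y)"

lemma squeeze_outside: "\<not> max_norm n y < 2 \<Longrightarrow> squeeze n H y = y"
  by (simp add: squeeze_def)

lemma squeeze_fixed: "H (unshrink n y) = unshrink n y \<Longrightarrow> squeeze n H y = y"
  by (simp add: squeeze_def shrink_unshrink)

lemma squeeze_core: "max_norm n y = 1 \<Longrightarrow> max_norm n (H y) = 1 \<Longrightarrow> squeeze n H y = H y"
  by (simp add: squeeze_def shrink_id unshrink_id)

lemma squeeze_comp: "squeeze n (\<lambda>x. H (G x)) y = squeeze n H (squeeze n G y)"
  by (simp add: squeeze_def max_norm_shrink_less)

lemma squeeze_in_eucl: "(\<And>x. x \<in> eucl n \<Longrightarrow> H x \<in> eucl n) \<Longrightarrow> y \<in> eucl n \<Longrightarrow> squeeze n H y \<in> eucl n"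
  by (simp add: squeeze_def shrink_in_eucl unshrink_in_eucl)

lemma squeeze_cong: "(\<And>x. x \<in> eucl n \<Longrightarrow> H x = G x) \<Longrightarrow> y \<in> eucl n \<Longrightarrow> squeeze n H y = squeeze n G y"
  by (simp add: squeeze_def unshrink_in_eucl)

text \<open>For \<open>x = unshrink n y\<close> the factor \<open>2 - max_norm n y\<close> equals
  \<open>2 / (1 + max_norm n x)\<close>. It vanishes on the boundary of the box of radius 2, where
  \<open>squeeze\<close> is continued by the identity.\<close>

lemma squeeze_near:
  assumes "near_homeo n {} r D H H'" "y \<in> eucl n" "0 \<le> D"
  shows "near (2 * D * max 0 (2 - max_norm n y)) (squeeze n H y) y"
proof (cases "max_norm n y < 2")
  case True
  let ?x = "unshrink n y"
  have x: "?x \<in> eucl n" using unshrink_in_eucl assms by blast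
  have "near (4 * D / (1 + max_norm n ?x)) (shrink n ?x) (shrink n (H ?x))"
    using assms(1) x by (intro shrink_near) (auto simp: near_homeo_def intro: near_sym)
  moreover have "4 * D / (1 + max_norm n ?x) = 2 * D * max 0 (2 - max_norm n y)"
    using True by (simp add: max_norm_unshrink field_simps)
  ultimately show ?thesis using True by (simp add: squeeze_def shrink_unshrink near_sym)
qed (simp add: squeeze_def)

text \<open>Inside the open box of radius 2 the map is a composition; at the other points the bound
  of \<open>squeeze_near\<close> tends to 0.\<close>

lemma continuous_on_squeeze:
  assumes "near_homeo n {} r D H H'" "0 \<le> D"
  shows "continuous_on (eucl n) (squeeze n H)"
proof (rule continuous_on_coordinatewise_then_product)
  fix i
  have op: "open {y::nat\<Rightarrow>real. max_norm n y < 2}"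
    by (intro open_Collect_less continuous_intros continuous_on_max_norm)
  show "continuous_on (eucl n) (\<lambda>y. squeeze n H y i)"
    unfolding continuous_on_eq_continuous_within
  proof
    fix y assume y: "y \<in> eucl n"
    show "continuous (at y within eucl n) (\<lambda>y. squeeze n H y i)"
    proof (cases "max_norm n y < 2")
      case True
      let ?S = "eucl n \<inter> {y. max_norm n y < 2}"
      have "continuous_on ?S (\<lambda>y. shrink n (H (unshrink n y)))"
      proof (rule continuous_on_compose2[OF continuous_on_shrink[of UNIV]])
        show "continuous_on ?S (\<lambda>y. H (unshrink n y))"
          using assms(1) unshrink_in_eucl
          by (intro continuous_on_compose2[OF _ continuous_on_unshrink, of "eucl n" H]) (auto simp: near_homeo_def)
      qed simp
      then have "continuous_on ?S (\<lambda>y. shrink n (H (unshrink n y)) i)"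
        by (rule continuous_on_product_then_coordinatewise)
      then have "continuous_on ?S (\<lambda>y. squeeze n H y i)"
        by (rule continuous_on_eq) (simp add: squeeze_def)
      moreover have "at y within eucl n = at y within ?S"
        using True op by (intro at_within_nhd[of y "{y. max_norm n y < 2}"]) auto
      ultimately show ?thesis
        using True y by (simp add: continuous_on_eq_continuous_within)
    next
      case False
      have "((\<lambda>z. 2 * D * max 0 (2 - max_norm n z)) \<longlongrightarrow> 2 * D * max 0 (2 - max_norm n y)) (at y within eucl n)"
        by (intro tendsto_intros) (use continuous_on_max_norm[of "eucl n" n] y in \<open>auto simp: continuous_on_def\<close>)
      then have "((\<lambda>z. 2 * D * max 0 (2 - max_norm n z)) \<longlongrightarrow> 0) (at y within eucl n)" using False by simp
      then have "((\<lambda>z. squeeze n H z i - z i) \<longlongrightarrow> 0) (at y within eucl n)"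
      proof (rule Lim_null_comparison[rotated])
        show "\<forall>\<^sub>F z in at y within eucl n. norm (squeeze n H z i - z i) \<le> 2 * D * max 0 (2 - max_norm n z)"
          using squeeze_near[OF assms(1) _ assms(2)] by (auto simp: eventually_at_filter near_def)
      qed
      moreover have "((\<lambda>z. z i) \<longlongrightarrow> y i) (at y within eucl n)"
        using continuous_on_coord[of "eucl n" i] y by (auto simp: continuous_on_def)
      ultimately have "((\<lambda>z. squeeze n H z i - z i + z i) \<longlongrightarrow> 0 + y i) (at y within eucl n)"
        by (rule tendsto_add)
      then show ?thesis using False by (simp add: continuous_within squeeze_outside)
    qed
  qed
qed

lemma near_homeo_squeeze:
  assumes H: "near_homeo n {} r D H H'" and D: "0 \<le> D"
  shows "near_homeo n {} s (2 * D) (squeeze n H) (squeeze n H')"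
proof -
  note H' = near_homeo_sym[OF H]
  have inv: "H' (H x) = x" "H (H' x) = x" "H x \<in> eucl n" "H' x \<in> eucl n" if "x \<in> eucl n" for x
    using H that by (auto simp: near_homeo_def)
  have id: "squeeze n (\<lambda>x. x) y = y" for y
    by (rule squeeze_fixed) simp
  have le: "2 * D * max 0 (2 - max_norm n y) \<le> 2 * D" for y
    using mult_left_mono[of "max 0 (2 - max_norm n y)" 1 "2 * D"] D max_norm_ge_1[of n y] by simp
  have "squeeze n H' (squeeze n H y) = y" "squeeze n H (squeeze n H' y) = y" if "y \<in> eucl n" for y
    unfolding squeeze_comp[symmetric] using squeeze_cong[OF _ that, of _ "\<lambda>x. x"] inv by (simp_all add: id)
  moreover have "squeeze n H y \<in> eucl n" "squeeze n H' y \<in> eucl n" "near (2 * D) (squeeze n H y) y" "near (2 * D) (squeeze n H' y) y"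
    if "y \<in> eucl n" for y
    using squeeze_in_eucl[of n, OF inv(3) that] squeeze_in_eucl[of n, OF inv(4) that]
      near_mono[OF squeeze_near[OF H that D] le] near_mono[OF squeeze_near[OF H' that D] le] by auto
  ultimately show ?thesis
    unfolding near_homeo_def slab_empty using continuous_on_squeeze[OF H D] continuous_on_squeeze[OF H' D] by simp
qed

text \<open>Straightening in its relative form. Unrolling makes the map global and squeezing makes
  its support compact; since the squeeze leaves the unit box alone, agreement with \<open>h\<close>
  near the core survives.\<close>

proposition local_extension:
  assumes J: "J \<subseteq> {..<n}" and h: "near_homeo n J (6 + card J) \<delta> h h'" and \<delta>: "0 \<le> \<delta>" "3 ^ card J * \<delta> \<le> 1/4"
    and fx: "\<forall>x\<in>slab n J (6 + card J). \<forall>i\<in>{..<n} - J. \<bar>x i\<bar> \<ge> 1 \<longrightarrow> h x = x"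
  shows "\<exists>g g'. near_homeo n {} 0 (2 * (3 ^ card J * \<delta>)) g g' \<and>
    (\<forall>x\<in>eucl n. \<forall>i\<in>{..<n} - J. \<bar>x i\<bar> \<ge> 1 \<longrightarrow> g x = x) \<and>
    (\<forall>x\<in>eucl n. \<forall>i<n. \<bar>x i\<bar> \<ge> 2 \<longrightarrow> g x = x) \<and>
    (\<forall>x\<in>slab n J (1/2) \<inter> slab n ({..<n} - J) 1. g x = h x)"
proof -
  have "finite J" using J finite_subset by blast
  have disj: "({..<n} - J) \<inter> J = {}" by blast
  obtain H H' where H: "near_homeo n {} 0 (3 ^ card J * \<delta>) H H'"
    "\<And>x. x \<in> slab n J (1/2) \<Longrightarrow> H x = h x"
    "\<And>x i. x \<in> eucl n \<Longrightarrow> i \<in> {..<n} - J \<Longrightarrow> \<bar>x i\<bar> \<ge> 1 \<Longrightarrow> H x = x"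
    by (rule unroll_all[OF \<open>finite J\<close> J h \<delta> disj fx[rule_format]]) blast+
  have inv: "H' (H x) = x" "H x \<in> eucl n" if "x \<in> eucl n" for x
    using H(1) that by (auto simp: near_homeo_def)
  show ?thesis
  proof (intro exI conjI ballI allI impI)
    show "near_homeo n {} 0 (2 * (3 ^ card J * \<delta>)) (squeeze n H) (squeeze n H')"
      by (rule near_homeo_squeeze[OF H(1)]) (use \<delta> in simp)
    show "squeeze n H x = x" if x: "x \<in> eucl n" "i \<in> {..<n} - J" "\<bar>x i\<bar> \<ge> 1" for x i
    proof (cases "max_norm n x < 2")
      case True
      \<comment> \<open>Unshrinking never decreases a coordinate in absolute value, so it keeps
        \<open>x\<close> in the region fixed by \<open>H\<close>.\<close>
      have "2 - max_norm n x \<le> \<bar>x i\<bar>" using max_norm_ge_1[of n x] x(3) by linarith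
      then have "1 \<le> \<bar>unshrink n x i\<bar>" using True x(3) unfolding unshrink_def by (simp add: le_divide_eq)
      then show ?thesis using x by (intro squeeze_fixed H(3)[of _ i] unshrink_in_eucl) auto
    qed (simp add: squeeze_outside)
    show "squeeze n H x = x" if x: "x \<in> eucl n" "i < n" "\<bar>x i\<bar> \<ge> 2" for x i
      using coord_le_max_norm[OF x(1), of i] x(3) by (intro squeeze_outside) linarith
    show "squeeze n H x = h x" if x': "x \<in> slab n J (1/2) \<inter> slab n ({..<n} - J) 1" for x
    proof -
      have x: "x \<in> slab n J (1/2)" "x \<in> slab n ({..<n} - J) 1" using x' by auto
      have xE: "x \<in> eucl n" using x by (simp add: slab_def)
      have "max_norm n x \<le> 1" unfolding max_norm_le_iff using x by (force simp: slab_def)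
      then have 1: "max_norm n x = 1" using max_norm_ge_1[of n x] by linarith
      \<comment> \<open>\<open>squeeze_core\<close> also needs the image in the unit box. In
        transverse directions the displacement bound gives it. In the others, an image beyond 1
        would itself be fixed by \<open>H\<close>, so injectivity would make it equal to
        \<open>x\<close>.\<close>
      have "\<bar>H x i\<bar> \<le> 1" if "i < n" for i
      proof (cases "i \<in> J")
        case True
        have "\<bar>H x i - x i\<bar> \<le> 3 ^ card J * \<delta>" using H(1) xE by (auto simp: near_homeo_def near_def)
        moreover have "\<bar>x i\<bar> \<le> 1/2" using x True by (auto simp: slab_def)
        ultimately show ?thesis using \<delta> by linarith
      next
        case False
        show ?thesis
        proof (rule ccontr)
          assume *: "\<not> ?thesis"
          then have "H (H x) = H x" using H(3)[of "H x" i] inv xE False that by force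
          then have "H x = x" using inv xE by metis
          then show False using * x False that by (auto simp: slab_def)
        qed
      qed
      then have "max_norm n (H x) \<le> 1" by (simp add: max_norm_le_iff)
      then have 2: "max_norm n (H x) = 1" using max_norm_ge_1[of n "H x"] by linarith
      show ?thesis using squeeze_core[of n x H, OF 1 2] H(2)[OF x(1)] by simp
    qed
  qed
qed

section \<open>Embeddings and charts\<close>

text \<open>Urysohn functions for the countably many pairs of basic open sets, collected into one
  sequence, separate points: two distinct points lie in basic sets with disjoint closures.\<close>

lemma compact_Hausdorff_second_countable_embedding:
  assumes "compact_space X" "Hausdorff_space X" "second_countable X"
  obtains e :: "'a \<Rightarrow> nat \<Rightarrow> real" where "continuous_map X euclidean e" "inj_on e (topspace X)"
proof -
  obtain B where B: "countable B" "\<And>V. V \<in> B \<Longrightarrow> openin X V"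
    "\<And>U x. openin X U \<Longrightarrow> x \<in> U \<Longrightarrow> \<exists>V\<in>B. x \<in> V \<and> V \<subseteq> U"
    using assms(3) unfolding second_countable_def by metis
  have reg: "regular_space X" using assms compact_Hausdorff_imp_regular_space by blast
  have nor: "normal_space X" using assms compact_Hausdorff_or_regular_imp_normal_space by blast
  \<comment> \<open>For pairs whose closures meet, any continuous function is allowed, so a choice
    exists for every pair.\<close>
  define Q where "Q UV f \<longleftrightarrow> continuous_map X euclideanreal f \<and>
     (disjnt (X closure_of fst UV) (X closure_of snd UV) \<longrightarrow> f ` (X closure_of fst UV) \<subseteq> {0} \<and> f ` (X closure_of snd UV) \<subseteq> {1})" for UV f
  have "\<exists>f. Q UV f" for UV
  proof (cases "disjnt (X closure_of fst UV) (X closure_of snd UV)")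
    case True
    show ?thesis
      using Urysohn_lemma_alt[OF nor closedin_closure_of closedin_closure_of True, of 0 1] True unfolding Q_def by metis
  next
    case False
    then show ?thesis unfolding Q_def by (intro exI[of _ "\<lambda>_. 0"]) auto
  qed
  then obtain F where F: "\<And>UV. Q UV (F UV)" by metis
  define e where "e p k = F (from_nat_into (B \<times> B) k) p" for p k
  show ?thesis
  proof (rule that)
    have "continuous_map X (powertop_real UNIV) e"
      unfolding continuous_map_componentwise_UNIV using F by (auto simp: e_def Q_def)
    then show "continuous_map X euclidean e" by (simp add: euclidean_product_topology)
    show "inj_on e (topspace X)"
    proof (rule inj_onI, rule ccontr)
      fix x y assume xy: "x \<in> topspace X" "y \<in> topspace X" "e x = e y" "x \<noteq> y"
      have nb: "\<exists>V\<in>B. z \<in> V \<and> X closure_of V \<subseteq> W" if W: "openin X W" "z \<in> W" for z W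
      proof -
        obtain U C where UC: "openin X U" "closedin X C" "z \<in> U" "U \<subseteq> C" "C \<subseteq> W"
          using reg W unfolding neighbourhood_base_of_closedin[symmetric] neighbourhood_base_of by metis
        obtain V where "V \<in> B" "z \<in> V" "V \<subseteq> U" using B(3)[OF UC(1,3)] by blast
        moreover have "X closure_of V \<subseteq> C" using calculation UC by (intro closure_of_minimal) auto
        ultimately show ?thesis using UC by blast
      qed
      obtain U V where UV: "openin X U" "openin X V" "x \<in> U" "y \<in> V" "disjnt U V"
        using assms(2) xy unfolding Hausdorff_space_def by metis
      obtain U' where U': "U' \<in> B" "x \<in> U'" "X closure_of U' \<subseteq> U" using nb UV by blast
      obtain V' where V': "V' \<in> B" "y \<in> V'" "X closure_of V' \<subseteq> V" using nb UV by blast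
      have d: "disjnt (X closure_of U') (X closure_of V')" using U' V' UV unfolding disjnt_def by blast
      have "(U', V') \<in> B \<times> B" using U' V' by blast
      then obtain k where k: "from_nat_into (B \<times> B) k = (U', V')"
        using B(1) by (metis countable_SIGMA from_nat_into_surj)
      have "x \<in> X closure_of U'" "y \<in> X closure_of V'"
        using closure_of_subset[OF openin_subset[OF B(2)[OF U'(1)]]] closure_of_subset[OF openin_subset[OF B(2)[OF V'(1)]]]
          U'(2) V'(2) by auto
      then have "F (U', V') x = 0" "F (U', V') y = 1"
        using F[of "(U', V')"] d unfolding Q_def by auto
      then have "e x k \<noteq> e y k" by (simp add: e_def k)
      then show False using xy by simp
    qed
  qed
qed

text \<open>The product metric sums coordinate distances capped at 1 with weights
  \<open>(1/2)^k\<close>, and these weights add up to 2.\<close>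

lemma dist_le_of_near:
  fixes x y :: "nat \<Rightarrow> real"
  assumes "near \<delta> x y"
  shows "dist x y \<le> 2 * \<delta>"
proof -
  have d: "dist (x i) (y i) \<le> \<delta>" for i using assms by (auto simp: near_def dist_real_def)
  have "dist x y \<le> (\<Sum>k. (1/2)^k * \<delta>)"
    unfolding dist_fun_def
  proof (rule suminf_le)
    show "(1/2)^k * min (dist (x (from_nat k)) (y (from_nat k))) 1 \<le> (1/2)^k * \<delta>" for k
      using d[of "from_nat k"] by (intro mult_left_mono) auto
    show "summable (\<lambda>k. (1/2)^k * min (dist (x (from_nat k)) (y (from_nat k))) 1)"
      by (rule summable_comparison_test'[of "\<lambda>n. (1/2)^n"]) (auto simp: summable_geometric_iff)
    show "summable (\<lambda>k. (1/2)^k * \<delta>)" by (intro summable_mult2) (auto simp: summable_geometric_iff)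
  qed
  also have "\<dots> = 2 * \<delta>"
    using suminf_mult2[of "\<lambda>k. (1/2)^k" \<delta>, symmetric] by (simp add: summable_geometric_iff suminf_geometric)
  finally show ?thesis .
qed

text \<open>The manifold comes without a metric, so closeness is measured by \<open>dist\<close>
  after an injection into sequence space, which is an embedding by compactness.\<close>

locale embedded_compact =
  fixes X :: "'a topology" and e :: "'a \<Rightarrow> nat \<Rightarrow> real"
  assumes compact: "compact_space X" and Hausdorff: "Hausdorff_space X"
    and cont_e: "continuous_map X euclidean e" and inj_e: "inj_on e (topspace X)"
begin

lemma compact_image: "compactin X K \<Longrightarrow> compact (e ` K)"
  using image_compactin[OF _ cont_e] by simp

lemma closed_image: "closedin X C \<Longrightarrow> closed (e ` C)"
  using closedin_compact_space[OF compact] compact_image compact_imp_closed by blast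

lemma closedin_compact: "compactin X K \<Longrightarrow> closedin X K"
  using Hausdorff compactin_imp_closedin by blast

lemma Lebesgue:
  assumes K: "compactin X K" "K \<subseteq> \<Union>\<U>" and U: "\<And>U. U \<in> \<U> \<Longrightarrow> openin X U"
  obtains \<epsilon> where "\<epsilon> > 0"
    "\<And>p. p \<in> K \<Longrightarrow> \<exists>U\<in>\<U>. \<forall>q\<in>topspace X. dist (e p) (e q) < \<epsilon> \<longrightarrow> q \<in> U"
proof -
  \<comment> \<open>Images of closed sets are compact, so for open \<open>U\<close> this is an open
    set of the ambient space that cuts out \<open>U\<close>; the usual Lebesgue number argument
    applies there.\<close>
  define G where "G U = - e ` (topspace X - U)" for U
  have G: "e p \<in> G U \<longleftrightarrow> p \<in> U" if "p \<in> topspace X" "U \<in> \<U>" for p U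
    using that inj_e U openin_subset by (force simp: G_def inj_on_def)
  have Ksub: "K \<subseteq> topspace X" using K compactin_subset_topspace by blast
  have "e ` K \<subseteq> \<Union>(G ` \<U>)" using K Ksub G by fastforce
  moreover have "\<And>V. V \<in> G ` \<U> \<Longrightarrow> open V"
    unfolding G_def using closed_image[OF closedin_diff[OF closedin_topspace U]] by blast
  ultimately obtain \<epsilon> where \<epsilon>: "\<epsilon> > 0" "\<And>x. x \<in> e ` K \<Longrightarrow> \<exists>V \<in> G ` \<U>. ball x \<epsilon> \<subseteq> V"
    using Heine_Borel_lemma[OF compact_image[OF K(1)]] by metis
  show ?thesis
  proof (rule that[OF \<epsilon>(1)])
    fix p assume "p \<in> K"
    then obtain U where "U \<in> \<U>" "ball (e p) \<epsilon> \<subseteq> G U" using \<epsilon>(2) by blast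
    then show "\<exists>U\<in>\<U>. \<forall>q\<in>topspace X. dist (e p) (e q) < \<epsilon> \<longrightarrow> q \<in> U"
      using G by (intro bexI[of _ U]) (auto simp: subset_iff)
  qed
qed

lemma openin_dball: "openin X {q \<in> topspace X. dist (e p) (e q) < \<epsilon>}"
proof -
  have "openin X {q \<in> topspace X. e q \<in> ball (e p) \<epsilon>}"
    by (rule openin_continuous_map_preimage[OF cont_e]) simp
  then show ?thesis by simp
qed

end

section \<open>Euclidean boxes and charts defined on the whole Euclidean space\<close>

lemma Euclidean_space_eucl: "Euclidean_space n = top_of_set (eucl n)"
  by (simp add: Euclidean_space_def eucl_def euclidean_product_topology)

lemma compact_box: "compact (box n r)"
proof -
  have "compactin (product_topology (\<lambda>_. euclideanreal) UNIV) (PiE UNIV (\<lambda>i. if i < n then {-r..r} else {0}))"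
    unfolding compactin_PiE by (auto simp: compact_Icc)
  moreover have "PiE UNIV (\<lambda>i. if i < n then {-r..r} else {0}) = box n r"
  proof (rule Set.set_eqI)
    fix x :: "nat \<Rightarrow> real"
    have "x \<in> PiE UNIV (\<lambda>i. if i < n then {-r..r} else {0}) \<longleftrightarrow> (\<forall>i. x i \<in> (if i < n then {-r..r} else {0}))"
      unfolding PiE_UNIV_domain Pi_iff by blast
    also have "\<dots> \<longleftrightarrow> (\<forall>i. (i < n \<longrightarrow> \<bar>x i\<bar> \<le> r) \<and> (n \<le> i \<longrightarrow> x i = 0))"
    proof (rule all_cong1)
      fix i show "(x i \<in> (if i < n then {-r..r} else {0})) = ((i < n \<longrightarrow> \<bar>x i\<bar> \<le> r) \<and> (n \<le> i \<longrightarrow> x i = 0))"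
        by (cases "i < n") auto
    qed
    also have "\<dots> \<longleftrightarrow> x \<in> box n r" unfolding slab_def eucl_def by blast
    finally show "x \<in> PiE UNIV (\<lambda>i. if i < n then {-r..r} else {0}) \<longleftrightarrow> x \<in> box n r" .
  qed
  ultimately show ?thesis by (simp add: euclidean_product_topology)
qed

lemma box_subset: "slab n J r \<subseteq> eucl n"
  by (auto simp: slab_def)

text \<open>The domain is all of \<open>eucl n\<close> and not a ball, so precomposing with
  translations and dilations gives charts again, and supports can be measured by boxes.\<close>

definition chart :: "'a topology \<Rightarrow> nat \<Rightarrow> ((nat \<Rightarrow> real) \<Rightarrow> 'a) \<Rightarrow> bool" where
  "chart X n \<phi> \<longleftrightarrow> openin X (\<phi> ` eucl n) \<and>
     homeomorphic_map (top_of_set (eucl n)) (subtopology X (\<phi> ` eucl n)) \<phi>"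

lemma chartD:
  assumes "chart X n \<phi>"
  shows chart_open: "openin X (\<phi> ` eucl n)"
    and chart_inj: "inj_on \<phi> (eucl n)"
    and chart_cont: "continuous_map (top_of_set (eucl n)) X \<phi>"
    and chart_cont_inv: "continuous_map (subtopology X (\<phi> ` eucl n)) (top_of_set (eucl n)) (inv_into (eucl n) \<phi>)"
    and chart_open_map: "openin (top_of_set (eucl n)) V \<Longrightarrow> openin X (\<phi> ` V)"
proof -
  have o: "openin X (\<phi> ` eucl n)" and h: "homeomorphic_map (top_of_set (eucl n)) (subtopology X (\<phi> ` eucl n)) \<phi>"
    using assms by (auto simp: chart_def)
  show "openin X (\<phi> ` eucl n)" by fact
  show i: "inj_on \<phi> (eucl n)" using homeomorphic_imp_injective_map[OF h] by simp
  show "continuous_map (top_of_set (eucl n)) X \<phi>"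
    using homeomorphic_imp_continuous_map[OF h] continuous_map_in_subtopology by blast
  obtain g where g: "homeomorphic_maps (top_of_set (eucl n)) (subtopology X (\<phi> ` eucl n)) \<phi> g"
    using h homeomorphic_map_maps by blast
  have T: "topspace (subtopology X (\<phi> ` eucl n)) = \<phi> ` eucl n" using o openin_subset by force
  have "continuous_map (subtopology X (\<phi> ` eucl n)) (top_of_set (eucl n)) g"
    using g by (simp add: homeomorphic_maps_def)
  then show "continuous_map (subtopology X (\<phi> ` eucl n)) (top_of_set (eucl n)) (inv_into (eucl n) \<phi>)"
  proof (rule continuous_map_eq)
    fix p assume "p \<in> topspace (subtopology X (\<phi> ` eucl n))"
    then obtain x where "x \<in> eucl n" "p = \<phi> x" using T by blast
    then show "g p = inv_into (eucl n) \<phi> p" using g i by (simp add: homeomorphic_maps_def)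
  qed
  show "openin X (\<phi> ` V)" if "openin (top_of_set (eucl n)) V"
    using homeomorphic_imp_open_map[OF h] that o by (metis open_map_def openin_trans_full)
qed

lemma chart_in_topspace: "chart X n \<phi> \<Longrightarrow> x \<in> eucl n \<Longrightarrow> \<phi> x \<in> topspace X"
  using chart_open openin_subset by blast

lemma chart_compact: "chart X n \<phi> \<Longrightarrow> compact K \<Longrightarrow> K \<subseteq> eucl n \<Longrightarrow> compactin X (\<phi> ` K)"
  by (rule image_compactin[OF _ chart_cont]) (auto simp: compactin_subtopology)

lemma chart_comp:
  assumes "chart X n \<phi>" "continuous_on (eucl n) a" "continuous_on (eucl n) b"
    and "\<And>x. x \<in> eucl n \<Longrightarrow> a x \<in> eucl n \<and> b x \<in> eucl n \<and> a (b x) = x \<and> b (a x) = x"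
  shows "chart X n (\<lambda>x. \<phi> (a x))" "(\<lambda>x. \<phi> (a x)) ` eucl n = \<phi> ` eucl n"
proof -
  have im: "a ` eucl n = eucl n" using assms(4) by (metis image_eqI subsetI subset_antisym image_subsetI)
  show *: "(\<lambda>x. \<phi> (a x)) ` eucl n = \<phi> ` eucl n" using im by (metis image_image)
  have "homeomorphic_map (top_of_set (eucl n)) (top_of_set (eucl n)) a"
    unfolding homeomorphic_map_maps homeomorphic_maps_def
    using assms(2-4) by (intro exI[of _ b]) auto
  then have "homeomorphic_map (top_of_set (eucl n)) (subtopology X (\<phi> ` eucl n)) (\<phi> \<circ> a)"
    using assms(1) homeomorphic_map_compose by (auto simp: chart_def)
  then show "chart X n (\<lambda>x. \<phi> (a x))"
    using assms(1) unfolding chart_def * by (simp add: comp_def)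
qed

lemma chart_inv_into:
  assumes "chart X n \<phi>" "x \<in> eucl n"
  shows "inv_into (eucl n) \<phi> (\<phi> x) = x"
  using chart_inj[OF assms(1)] assms(2) by simp

text \<open>Uniform continuity on a slightly larger box. Capping the bound at 1 keeps the second
  point in that box, and the divisor 3 absorbs the factor 2 between \<open>near\<close> and
  \<open>dist\<close>.\<close>

lemma (in embedded_compact) chart_near_imp_dist:
  assumes \<phi>: "chart X n \<phi>" and \<epsilon>: "\<epsilon> > 0"
  obtains \<delta> where "\<delta> > 0" "\<And>x y. x \<in> box n r \<Longrightarrow> y \<in> eucl n \<Longrightarrow> near \<delta> y x \<Longrightarrow> dist (e (\<phi> y)) (e (\<phi> x)) < \<epsilon>"
proof -
  define K where "K = box n (r + 1)"
  have K: "compact K" "K \<subseteq> eucl n" by (simp_all add: K_def compact_box box_subset)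
  have "continuous_map (top_of_set (eucl n)) euclidean (e \<circ> \<phi>)"
    using chart_cont[OF \<phi>] cont_e continuous_map_compose by blast
  then have "continuous_on K (e \<circ> \<phi>)" using K(2) continuous_on_subset by auto
  then have "uniformly_continuous_on K (e \<circ> \<phi>)" using K compact_uniformly_continuous by blast
  then obtain d where d: "d > 0" "\<And>x y. x \<in> K \<Longrightarrow> y \<in> K \<Longrightarrow> dist y x < d \<Longrightarrow> dist (e (\<phi> y)) (e (\<phi> x)) < \<epsilon>"
    using \<epsilon> unfolding uniformly_continuous_on_def comp_def by metis
  show ?thesis
  proof (rule that[of "min 1 (d / 3)"])
    fix x y assume xy: "x \<in> box n r" "y \<in> eucl n" "near (min 1 (d / 3)) y x"
    have "dist y x < d" using dist_le_of_near[OF xy(3)] d(1) by linarith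
    moreover have "x \<in> K" using xy by (force simp: K_def slab_def)
    moreover have "\<bar>y i\<bar> \<le> r + 1" if "i < n" for i
    proof -
      have "\<bar>y i - x i\<bar> \<le> 1" "\<bar>x i\<bar> \<le> r" using xy that by (auto simp: near_def slab_def)
      then show ?thesis by linarith
    qed
    then have "y \<in> K" using xy(2) by (simp add: K_def slab_def)
    ultimately show "dist (e (\<phi> y)) (e (\<phi> x)) < \<epsilon>" using d(2) by blast
  qed (use d in auto)
qed

lemma openin_coord_box: "openin (top_of_set (eucl n)) {y \<in> eucl n. \<forall>i<n. \<bar>y i - x i\<bar> < \<delta> i}"
proof -
  have "open (\<Inter>i\<in>{..<n}. {y::nat\<Rightarrow>real. \<bar>y i - x i\<bar> < \<delta> i})"
    by (intro open_INT ballI open_Collect_less continuous_intros continuous_on_coord) auto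
  moreover have "{y \<in> eucl n. \<forall>i<n. \<bar>y i - x i\<bar> < \<delta> i} = eucl n \<inter> (\<Inter>i\<in>{..<n}. {y. \<bar>y i - x i\<bar> < \<delta> i})" by auto
  ultimately show ?thesis by (simp add: openin_open_Int)
qed

text \<open>A Lebesgue number for the images of coordinate boxes of radius \<delta>/2: two points in
  one such image have coordinates within \<delta>, and in particular the second point lies in the
  chart.\<close>

lemma (in embedded_compact) chart_dist_imp_near:
  assumes \<phi>: "chart X n \<phi>" and \<delta>: "\<delta> > 0"
  obtains \<epsilon> where "\<epsilon> > 0" "\<And>x p. x \<in> box n r \<Longrightarrow> p \<in> topspace X \<Longrightarrow> dist (e (\<phi> x)) (e p) < \<epsilon> \<Longrightarrow>
    p \<in> \<phi> ` eucl n \<and> near \<delta> (inv_into (eucl n) \<phi> p) x"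
proof -
  define V where "V x = {y \<in> eucl n. \<forall>i<n. \<bar>y i - x i\<bar> < \<delta> / 2}" for x
  define K where "K = box n r"
  have K: "compactin X (\<phi> ` K)"
    by (intro chart_compact[OF \<phi>]) (simp_all add: K_def compact_box box_subset)
  have cov: "\<phi> ` K \<subseteq> \<Union>((\<lambda>x. \<phi> ` V x) ` K)" using \<delta> by (force simp: V_def K_def slab_def)
  have op: "\<And>U. U \<in> (\<lambda>x. \<phi> ` V x) ` K \<Longrightarrow> openin X U"
    unfolding V_def using openin_coord_box[of n _ "\<lambda>_. \<delta> / 2"] chart_open_map[OF \<phi>] by blast
  obtain \<epsilon> where \<epsilon>: "\<epsilon> > 0"
    "\<And>p. p \<in> \<phi> ` K \<Longrightarrow> \<exists>U\<in>(\<lambda>x. \<phi> ` V x) ` K. \<forall>q\<in>topspace X. dist (e p) (e q) < \<epsilon> \<longrightarrow> q \<in> U"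
    using Lebesgue[OF K cov op] by metis
  show ?thesis
  proof (rule that[OF \<epsilon>(1)])
    fix x p assume x: "x \<in> box n r" "p \<in> topspace X" "dist (e (\<phi> x)) (e p) < \<epsilon>"
    then obtain z where z: "z \<in> K" "\<forall>q\<in>topspace X. dist (e (\<phi> x)) (e q) < \<epsilon> \<longrightarrow> q \<in> \<phi> ` V z"
      using \<epsilon>(2)[of "\<phi> x"] by (auto simp: K_def)
    have xE: "x \<in> eucl n" using x by (simp add: slab_def)
    obtain y where y: "y \<in> V z" "p = \<phi> y" using z x by blast
    obtain x' where x': "x' \<in> V z" "\<phi> x = \<phi> x'" using z(2) chart_in_topspace[OF \<phi> xE] \<epsilon>(1) by fastforce
    have "x' = x" using x' xE chart_inj[OF \<phi>] by (auto simp: V_def inj_on_def)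
    have "\<bar>y i - x i\<bar> \<le> \<delta>" for i
    proof (cases "i < n")
      case True
      then have "\<bar>y i - z i\<bar> < \<delta>/2" "\<bar>x i - z i\<bar> < \<delta>/2" using y x' \<open>x' = x\<close> by (auto simp: V_def)
      then show ?thesis by linarith
    next
      case False
      then show ?thesis using y xE \<delta> by (auto simp: V_def eucl_def)
    qed
    then have "near \<delta> y x" by (simp add: near_def)
    moreover have "y \<in> eucl n" using y by (simp add: V_def)
    ultimately show "p \<in> \<phi> ` eucl n \<and> near \<delta> (inv_into (eucl n) \<phi> p) x"
      using y chart_inv_into[OF \<phi>] by auto
  qed
qed

lemma chart_exists:
  assumes "closed_manifold X n" "p \<in> topspace X"
  obtains \<phi> where "chart X n \<phi>" "p = \<phi> (\<lambda>_. 0)"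
proof -
  obtain U V where UV: "openin X U" "p \<in> U" "openin (Euclidean_space n) V"
     "(subtopology X U) homeomorphic_space (subtopology (Euclidean_space n) V)"
    using assms unfolding closed_manifold_def by blast
  have V: "openin (top_of_set (eucl n)) V" "V \<subseteq> eucl n" using UV(3) openin_subset by (fastforce simp: Euclidean_space_eucl)+
  have U: "U \<subseteq> topspace X" using UV openin_subset by blast
  have sV: "subtopology (Euclidean_space n) V = top_of_set V"
    using V by (simp add: Euclidean_space_eucl subtopology_subtopology Int_absorb1)
  obtain f g where fg: "homeomorphic_maps (subtopology X U) (top_of_set V) f g"
    using UV(4) unfolding homeomorphic_space_def sV by blast
  define v where "v = f p"
  have v: "v \<in> V" "g v = p" using fg UV U unfolding homeomorphic_maps_def continuous_map_def v_def by auto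
  obtain O' where O': "open O'" "V = eucl n \<inter> O'" using V(1) by (metis openin_open)
  obtain d where d: "d > 0" "ball v d \<subseteq> O'" using O' v open_contains_ball by blast
  \<comment> \<open>Coordinates of \<open>shrink n x\<close> are bounded by 2, so \<open>q x\<close>
    is within d/3 of \<open>v\<close> in each coordinate and within 2d/3 in \<open>dist\<close>,
    hence inside the ball. Thus \<open>q\<close> maps \<open>eucl n\<close> onto an open box
    contained in \<open>V\<close>.\<close>
  define q where "q x = (\<lambda>i. v i + d/6 * shrink n x i)" for x
  define q' where "q' y = unshrink n (\<lambda>i. (y i - v i) * (6/d))" for y
  have vE: "v \<in> eucl n" using v V by blast
  have gam2: "\<bar>shrink n x i\<bar> \<le> 2" if "x \<in> eucl n" for x i
    using coord_le_max_norm[OF shrink_in_eucl[OF that], of i] max_norm_shrink_less[of n x] by linarith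
  have qE: "q x \<in> eucl n" if "x \<in> eucl n" for x
    using that vE shrink_in_eucl[OF that] by (auto simp: q_def eucl_def)
  have qV: "q x \<in> V" if "x \<in> eucl n" for x
  proof -
    have "near (d/3) (q x) v"
      unfolding near_def q_def using gam2[OF that] d by (auto simp: abs_mult)
    then have "dist (q x) v \<le> 2 * (d/3)" by (rule dist_le_of_near)
    then have "q x \<in> ball v d" using d by (simp add: dist_commute)
    then show ?thesis using O' d qE[OF that] by blast
  qed
  have qq: "q' (q x) = x" for x
    using d by (simp add: q_def q'_def)
  define W where "W = {y \<in> eucl n. max_norm n (\<lambda>i. (y i - v i) * (6/d)) < 2}"
  have qq': "q (q' y) = y" "q' y \<in> eucl n" if "y \<in> W" for y
  proof -
    have *: "max_norm n (\<lambda>i. (y i - v i) * (6/d)) < 2" and yE: "y \<in> eucl n" using that by (auto simp: W_def)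
    show "q (q' y) = y" unfolding q_def q'_def shrink_unshrink[OF *] using d by (intro ext) (simp add: field_simps)
    have "(\<lambda>i. (y i - v i) * (6/d)) \<in> eucl n" using vE yE by (auto simp: eucl_def)
    then show "q' y \<in> eucl n" unfolding q'_def by (rule unshrink_in_eucl)
  qed
  have qW: "q x \<in> W" if "x \<in> eucl n" for x
    using d max_norm_shrink_less[of n x] qE[OF that] by (simp add: W_def q_def)
  have im: "q ` eucl n = W" using qq' qW by (metis image_eqI image_subsetI subsetI subset_antisym)
  have cq: "continuous_on S q" for S
    unfolding q_def
    by (intro continuous_on_coordinatewise_then_product continuous_intros
        continuous_on_product_then_coordinatewise[OF continuous_on_shrink])
  have ca: "continuous_on S (\<lambda>y i. (y i - v i) * (6/d))" for S
    by (intro continuous_on_coordinatewise_then_product continuous_intros continuous_on_coord) (use d in auto)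
  have cq': "continuous_on W q'"
    unfolding q'_def by (rule continuous_on_compose2[OF continuous_on_unshrink[OF order_refl] ca]) (auto simp: W_def)
  have oW: "openin (top_of_set V) W"
  proof -
    have "open {y. max_norm n (\<lambda>i. (y i - v i) * (6/d)) < 2}"
      by (intro open_Collect_less continuous_on_compose2[OF continuous_on_max_norm ca]) auto
    moreover have "W = V \<inter> {y. max_norm n (\<lambda>i. (y i - v i) * (6/d)) < 2}"
    proof
      show "W \<subseteq> V \<inter> {y. max_norm n (\<lambda>i. (y i - v i) * (6/d)) < 2}"
      proof
        fix y assume y: "y \<in> W"
        then have "y \<in> V" using qV by (force simp flip: im)
        then show "y \<in> V \<inter> {y. max_norm n (\<lambda>i. (y i - v i) * (6/d)) < 2}" using y by (simp add: W_def)
      qed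
      show "V \<inter> {y. max_norm n (\<lambda>i. (y i - v i) * (6/d)) < 2} \<subseteq> W" using V unfolding W_def by blast
    qed
    ultimately show ?thesis by (simp add: openin_open_Int)
  qed
  have WV: "W \<subseteq> V" using oW openin_subset by fastforce
  have g: "continuous_map (top_of_set V) (subtopology X U) g" "continuous_map (subtopology X U) (top_of_set V) f"
    "\<And>y. y \<in> V \<Longrightarrow> f (g y) = y" "\<And>z. z \<in> U \<Longrightarrow> g (f z) = z" "\<And>y. y \<in> V \<Longrightarrow> g y \<in> U" "\<And>z. z \<in> U \<Longrightarrow> f z \<in> V"
    using fg U by (auto simp: homeomorphic_maps_def continuous_map_def)
  define \<phi> where "\<phi> x = g (q x)" for x
  have phi_eq: "\<phi> = g \<circ> q" by (simp add: fun_eq_iff \<phi>_def)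
  have phiE: "\<phi> ` eucl n = g ` W" using im by (auto simp: \<phi>_def)
  have gW: "openin X (g ` W)"
  proof -
    have "homeomorphic_map (top_of_set V) (subtopology X U) g"
      using fg homeomorphic_map_maps homeomorphic_maps_sym by blast
    then have "openin (subtopology X U) (g ` W)"
      using oW homeomorphic_imp_open_map open_map_def by blast
    then show ?thesis using UV(1) openin_trans_full by blast
  qed
  have "homeomorphic_maps (top_of_set (eucl n)) (subtopology X (\<phi> ` eucl n)) \<phi> (q' \<circ> f)"
    unfolding homeomorphic_maps_def
  proof (intro conjI ballI)
    have "continuous_map (top_of_set (eucl n)) (top_of_set V) q"
      using cq qV by (auto simp: image_subset_iff)
    then have "continuous_map (top_of_set (eucl n)) (subtopology X U) (g \<circ> q)"
      using g(1) continuous_map_compose by blast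
    then have "continuous_map (top_of_set (eucl n)) X (g \<circ> q)"
      by (rule continuous_map_into_fulltopology)
    then show "continuous_map (top_of_set (eucl n)) (subtopology X (\<phi> ` eucl n)) \<phi>"
      unfolding continuous_map_in_subtopology phi_eq by auto
    have sub: "g ` W \<subseteq> U" using WV g by blast
    have "continuous_map (subtopology X (g ` W)) (top_of_set V) f"
      using continuous_map_from_subtopology_mono[OF g(2) sub] .
    then have "continuous_map (subtopology X (g ` W)) (top_of_set W) f"
      using WV g(3) by (auto simp: continuous_map_in_subtopology)
    moreover have "continuous_map (top_of_set W) (top_of_set (eucl n)) q'"
      using cq' qq'(2) by (auto simp: image_subset_iff)
    ultimately show "continuous_map (subtopology X (\<phi> ` eucl n)) (top_of_set (eucl n)) (q' \<circ> f)"
      unfolding phiE using continuous_map_compose by blast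
    show "(q' \<circ> f) (\<phi> x) = x" if "x \<in> topspace (top_of_set (eucl n))" for x
      using that g(3) qV qq by (simp add: \<phi>_def)
    show "\<phi> ((q' \<circ> f) z) = z" if z: "z \<in> topspace (subtopology X (\<phi> ` eucl n))" for z
    proof -
      obtain w where "w \<in> W" "z = g w" using z phiE by auto
      then show ?thesis using WV g(3) qq' by (auto simp: \<phi>_def)
    qed
  qed
  then have "chart X n \<phi>"
    unfolding chart_def using gW phiE homeomorphic_map_maps by metis
  moreover have "p = \<phi> (\<lambda>_. 0)"
    using v by (simp add: \<phi>_def q_def shrink_def)
  ultimately show ?thesis by (rule that)
qed

section \<open>Transport of homeomorphisms through charts\<close>

abbreviation hinv :: "('a \<Rightarrow> 'a) \<Rightarrow> 'a \<Rightarrow> 'a" where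
  "hinv f \<equiv> inv_into UNIV f"

lemma HomeoI:
  assumes "continuous_map X X f" "continuous_map X X g"
    and "\<And>x. f (g x) = x" "\<And>x. g (f x) = x" "\<And>x. x \<notin> topspace X \<Longrightarrow> f x = x"
  shows "f \<in> Homeo X"
  unfolding Homeo_def homeomorphic_map_maps homeomorphic_maps_def using assms by auto

text \<open>Being the identity off the carrier makes each element a bijection of the whole type, so
  \<open>hinv\<close> is a two-sided inverse everywhere.\<close>

lemma HomeoD:
  assumes "f \<in> Homeo X"
  shows Homeo_bij: "bij f" and Homeo_cont: "continuous_map X X f" and Homeo_cont_inv: "continuous_map X X (hinv f)"
    and Homeo_outside: "x \<notin> topspace X \<Longrightarrow> f x = x"
    and Homeo_topspace: "f x \<in> topspace X \<longleftrightarrow> x \<in> topspace X"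
proof -
  have h: "homeomorphic_map X X f" and o: "\<And>x. x \<notin> topspace X \<Longrightarrow> f x = x"
    using assms by (auto simp: Homeo_def)
  then show "x \<notin> topspace X \<Longrightarrow> f x = x" by blast
  have im: "f ` topspace X = topspace X" using h homeomorphic_imp_surjective_map by blast
  then show t: "f x \<in> topspace X \<longleftrightarrow> x \<in> topspace X" for x using o by (metis imageI)
  have "inj_on f (topspace X)" using h homeomorphic_imp_injective_map by blast
  then show b: "bij f"
    unfolding bij_def inj_def surj_def using o t im by (metis imageE inj_onD)
  show "continuous_map X X f" using h homeomorphic_imp_continuous_map by blast
  obtain g where g: "homeomorphic_maps X X f g" using h homeomorphic_map_maps by blast
  have "continuous_map X X g" using g by (simp add: homeomorphic_maps_def)
  then show "continuous_map X X (hinv f)"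
  proof (rule continuous_map_eq)
    fix x assume "x \<in> topspace X"
    then have "f (g x) = x" using g by (simp add: homeomorphic_maps_def)
    then show "g x = hinv f x" using b by (metis bij_inv_eq_iff)
  qed
qed

lemma Homeo_inv_f [simp]: "f \<in> Homeo X \<Longrightarrow> hinv f (f x) = x" "f \<in> Homeo X \<Longrightarrow> f (hinv f x) = x"
  using Homeo_bij by (metis bij_inv_eq_iff)+

lemma Homeo_id: "id \<in> Homeo X"
  by (rule HomeoI[of _ _ id]) auto

lemma Homeo_comp: "f \<in> Homeo X \<Longrightarrow> g \<in> Homeo X \<Longrightarrow> f \<circ> g \<in> Homeo X"
  by (rule HomeoI[of _ _ "hinv g \<circ> hinv f"])
    (auto intro: continuous_map_compose Homeo_cont Homeo_cont_inv simp: Homeo_outside)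

lemma Homeo_inv: "f \<in> Homeo X \<Longrightarrow> hinv f \<in> Homeo X"
  by (rule HomeoI[of _ _ f]) (auto intro: Homeo_cont Homeo_cont_inv, metis Homeo_inv_f(1) Homeo_outside)

section \<open>Supported homeomorphisms of Euclidean space and their transport\<close>

definition supp_homeo :: "nat \<Rightarrow> (nat \<Rightarrow> real) set \<Rightarrow> ((nat \<Rightarrow> real) \<Rightarrow> (nat \<Rightarrow> real)) \<Rightarrow> ((nat \<Rightarrow> real) \<Rightarrow> (nat \<Rightarrow> real)) \<Rightarrow> bool" where
  "supp_homeo n K g g' \<longleftrightarrow> continuous_on (eucl n) g \<and> continuous_on (eucl n) g' \<and>
     (\<forall>x\<in>eucl n. g x \<in> eucl n \<and> g' x \<in> eucl n \<and> g' (g x) = x \<and> g (g' x) = x \<and> (x \<notin> K \<longrightarrow> g x = x \<and> g' x = x))"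

lemma supp_homeo_sym: "supp_homeo n K g g' \<Longrightarrow> supp_homeo n K g' g"
  by (auto simp: supp_homeo_def)

lemma supp_homeo_of_near:
  assumes "near_homeo n {} r D g g'" "\<And>x. x \<in> eucl n \<Longrightarrow> x \<notin> K \<Longrightarrow> g x = x"
  shows "supp_homeo n K g g'"
  using assms unfolding near_homeo_def supp_homeo_def slab_empty by metis

definition transport :: "nat \<Rightarrow> ((nat \<Rightarrow> real) \<Rightarrow> 'a) \<Rightarrow> ((nat \<Rightarrow> real) \<Rightarrow> (nat \<Rightarrow> real)) \<Rightarrow> 'a \<Rightarrow> 'a" where
  "transport n \<phi> g p = (if p \<in> \<phi> ` eucl n then \<phi> (g (inv_into (eucl n) \<phi> p)) else p)"

lemma transport_chart: "chart X n \<phi> \<Longrightarrow> x \<in> eucl n \<Longrightarrow> transport n \<phi> g (\<phi> x) = \<phi> (g x)"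
  by (simp add: transport_def chart_inv_into)

lemma transport_outside: "p \<notin> \<phi> ` eucl n \<Longrightarrow> transport n \<phi> g p = p"
  by (simp add: transport_def)

lemma transport_comp:
  assumes "chart X n \<phi>" "\<And>x. x \<in> eucl n \<Longrightarrow> h x \<in> eucl n"
  shows "transport n \<phi> (\<lambda>x. g (h x)) p = transport n \<phi> g (transport n \<phi> h p)"
  using assms by (cases "p \<in> \<phi> ` eucl n") (auto simp: transport_chart transport_outside)

lemma transport_id:
  assumes "chart X n \<phi>" "\<And>x. x \<in> eucl n \<Longrightarrow> g x = x"
  shows "transport n \<phi> g p = p"
  using assms by (cases "p \<in> \<phi> ` eucl n") (auto simp: transport_chart transport_outside)

lemma transport_cong:
  assumes "chart X n \<phi>" "\<And>x. x \<in> eucl n \<Longrightarrow> g x = h x"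
  shows "transport n \<phi> g p = transport n \<phi> h p"
  using assms by (cases "p \<in> \<phi> ` eucl n") (auto simp: transport_chart transport_outside)

lemma transport_supp:
  assumes "chart X n \<phi>" "\<And>x. x \<in> eucl n \<Longrightarrow> x \<notin> K \<Longrightarrow> g x = x" "p \<notin> \<phi> ` (K \<inter> eucl n)"
  shows "transport n \<phi> g p = p"
proof (cases "p \<in> \<phi> ` eucl n")
  case True
  then obtain x where x: "x \<in> eucl n" "p = \<phi> x" by blast
  then have "x \<notin> K" using assms(3) by blast
  then show ?thesis using x assms(2) by (simp add: transport_chart[OF assms(1)])
qed (simp add: transport_outside)

context embedded_compact
begin

text \<open>The parameter space \<open>Y\<close> lets the same gluing serve isotopies; a one-point
  \<open>Y\<close> gives single maps. The chart image and the complement of the compact support form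
  the open cover on which the two formulas are pasted.\<close>

lemma transport_continuous:
  assumes \<phi>: "chart X n \<phi>" and K: "compact K" "K \<subseteq> eucl n"
    and G: "continuous_map (prod_topology Y (top_of_set (eucl n))) (top_of_set (eucl n)) (\<lambda>z. G (fst z) (snd z))"
    and fx: "\<And>t x. t \<in> topspace Y \<Longrightarrow> x \<in> eucl n \<Longrightarrow> x \<notin> K \<Longrightarrow> G t x = x"
  shows "continuous_map (prod_topology Y X) X (\<lambda>z. transport n \<phi> (G (fst z)) (snd z))"
proof (rule pasting_lemma[where I = "UNIV :: bool set" and
      T = "\<lambda>b. if b then topspace Y \<times> \<phi> ` eucl n else topspace Y \<times> (topspace X - \<phi> ` K)" and
      f = "\<lambda>b z. if b then \<phi> (G (fst z) (inv_into (eucl n) \<phi> (snd z))) else snd z"])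
  have cl: "closedin X (\<phi> ` K)" using chart_compact[OF \<phi> K] closedin_compact by blast
  show "openin (prod_topology Y X) (if b then topspace Y \<times> \<phi> ` eucl n else topspace Y \<times> (topspace X - \<phi> ` K))" for b
    using chart_open[OF \<phi>] cl by (auto simp: openin_prod_Times_iff)
  have *: "continuous_map (prod_topology Y (subtopology X (\<phi> ` eucl n))) X (\<lambda>z. \<phi> (G (fst z) (inv_into (eucl n) \<phi> (snd z))))"
  proof -
    have "continuous_map (prod_topology Y (subtopology X (\<phi> ` eucl n))) (prod_topology Y (top_of_set (eucl n)))
       (\<lambda>z. (fst z, inv_into (eucl n) \<phi> (snd z)))"
      unfolding continuous_map_pairwise comp_def fst_conv snd_conv
      using continuous_map_compose[OF continuous_map_snd chart_cont_inv[OF \<phi>], of Y] continuous_map_fst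
      by (auto simp: comp_def)
    from continuous_map_compose[OF continuous_map_compose[OF this G] chart_cont[OF \<phi>]]
    show ?thesis by (simp add: comp_def)
  qed
  show "continuous_map (subtopology (prod_topology Y X) (if b then topspace Y \<times> \<phi> ` eucl n else topspace Y \<times> (topspace X - \<phi> ` K))) X
      (\<lambda>z. if b then \<phi> (G (fst z) (inv_into (eucl n) \<phi> (snd z))) else snd z)" for b
  proof (cases b)
    case True
    have "subtopology (prod_topology Y X) (topspace Y \<times> \<phi> ` eucl n) = prod_topology Y (subtopology X (\<phi> ` eucl n))"
      by (simp flip: prod_topology_subtopology add: subtopology_Times)
    then show ?thesis using * True by simp
  next
    case False
    then show ?thesis by (auto intro: continuous_map_from_subtopology continuous_map_snd)
  qed
  show "(if b then \<phi> (G (fst z) (inv_into (eucl n) \<phi> (snd z))) else snd z) =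
     (if b' then \<phi> (G (fst z) (inv_into (eucl n) \<phi> (snd z))) else snd z)"
    if "z \<in> topspace (prod_topology Y X) \<inter> (if b then topspace Y \<times> \<phi> ` eucl n else topspace Y \<times> (topspace X - \<phi> ` K))
        \<inter> (if b' then topspace Y \<times> \<phi> ` eucl n else topspace Y \<times> (topspace X - \<phi> ` K))" for b b' z
  proof -
    have "\<phi> (G (fst z) (inv_into (eucl n) \<phi> (snd z))) = snd z"
      if t: "fst z \<in> topspace Y" "snd z \<in> \<phi> ` eucl n" "snd z \<notin> \<phi> ` K"
    proof -
      obtain x where x: "x \<in> eucl n" "snd z = \<phi> x" using t(2) by blast
      then have "x \<notin> K" using t(3) by auto
      then show ?thesis using x fx[OF t(1)] by (simp add: chart_inv_into[OF \<phi>])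
    qed
    then show ?thesis using that by (auto split: if_splits)
  qed
  show "\<exists>b. b \<in> UNIV \<and> z \<in> (if b then topspace Y \<times> \<phi> ` eucl n else topspace Y \<times> (topspace X - \<phi> ` K)) \<and>
     transport n \<phi> (G (fst z)) (snd z) = (if b then \<phi> (G (fst z) (inv_into (eucl n) \<phi> (snd z))) else snd z)"
    if z: "z \<in> topspace (prod_topology Y X)" for z
  proof (cases "snd z \<in> \<phi> ` eucl n")
    case True
    then show ?thesis using z by (intro exI[of _ True]) (auto simp: transport_def mem_Times_iff)
  next
    case False
    then show ?thesis using z K by (intro exI[of _ False]) (auto simp: transport_def mem_Times_iff)
  qed
qed

lemma transport_continuous1:
  assumes \<phi>: "chart X n \<phi>" and K: "compact K" "K \<subseteq> eucl n" and g: "supp_homeo n K g g'"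
  shows "continuous_map X X (transport n \<phi> g)"
proof -
  have 1: "continuous_map (prod_topology (top_of_set {0::real}) X) X (\<lambda>z. transport n \<phi> ((\<lambda>t. g) (fst z)) (snd z))"
  proof (rule transport_continuous[OF \<phi> K])
    have "continuous_map (top_of_set (eucl n)) (top_of_set (eucl n)) g"
      using g by (auto simp: supp_homeo_def)
    from continuous_map_compose[OF continuous_map_snd this, of "top_of_set {0::real}"]
    show "continuous_map (prod_topology (top_of_set {0::real}) (top_of_set (eucl n))) (top_of_set (eucl n)) (\<lambda>z. g (snd z))"
      by (simp add: comp_def)
  qed (use g in \<open>auto simp: supp_homeo_def\<close>)
  have 2: "continuous_map X (prod_topology (top_of_set {0::real}) X) (\<lambda>p. (0, p))"
    by (simp add: continuous_map_pairwise comp_def)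
  from continuous_map_compose[OF 2 1] show ?thesis by (simp add: comp_def)
qed

lemma transport_Homeo:
  assumes \<phi>: "chart X n \<phi>" and K: "compact K" "K \<subseteq> eucl n" and g: "supp_homeo n K g g'"
  shows "transport n \<phi> g \<in> Homeo X" and "hinv (transport n \<phi> g) = transport n \<phi> g'"
proof -
  have E: "g x \<in> eucl n" "g' x \<in> eucl n" "g' (g x) = x" "g (g' x) = x" if "x \<in> eucl n" for x
    using g that by (auto simp: supp_homeo_def)
  have 1: "transport n \<phi> g (transport n \<phi> g' p) = p" "transport n \<phi> g' (transport n \<phi> g p) = p" for p
    using E by (auto simp: transport_comp[OF \<phi>, symmetric] intro!: transport_id[OF \<phi>])
  show "transport n \<phi> g \<in> Homeo X"
    by (rule HomeoI[OF transport_continuous1[OF \<phi> K g] transport_continuous1[OF \<phi> K supp_homeo_sym[OF g]] 1])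
      (use chart_in_topspace[OF \<phi>] in \<open>auto intro: transport_outside\<close>)
  show "hinv (transport n \<phi> g) = transport n \<phi> g'" using 1 by (intro inv_equality) auto
qed

lemma coordinate_expression:
  assumes \<phi>: "chart X n \<phi>" and K: "K \<subseteq> eucl n" and f: "f \<in> Homeo X" "\<And>p. p \<notin> \<phi> ` K \<Longrightarrow> f p = p"
  obtains g g' where "supp_homeo n K g g'" "f = transport n \<phi> g"
proof -
  define \<psi> where "\<psi> = inv_into (eucl n) \<phi>"
  have cr: "\<exists>g. continuous_on (eucl n) g \<and> (\<forall>x\<in>eucl n. g x \<in> eucl n \<and> \<phi> (g x) = f (\<phi> x) \<and> (x \<notin> K \<longrightarrow> g x = x))"
    if f: "f \<in> Homeo X" "\<And>p. p \<notin> \<phi> ` K \<Longrightarrow> f p = p" for f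
  proof -
    \<comment> \<open>A point leaving the chart would land where \<open>f\<close> is the identity,
      and would then be fixed itself by injectivity.\<close>
    have im: "f p \<in> \<phi> ` eucl n" if "p \<in> \<phi> ` eucl n" for p
    proof (rule ccontr)
      assume *: "f p \<notin> \<phi> ` eucl n"
      then have "f (f p) = f p" using f(2) K by blast
      then have "f p = p" using Homeo_inv_f[OF f(1)] by metis
      then show False using * that by simp
    qed
    have "continuous_map (top_of_set (eucl n)) X (f \<circ> \<phi>)"
      using continuous_map_compose[OF chart_cont[OF \<phi>] Homeo_cont[OF f(1)]] .
    then have "continuous_map (top_of_set (eucl n)) (subtopology X (\<phi> ` eucl n)) (f \<circ> \<phi>)"
      using im by (auto simp: continuous_map_in_subtopology)
    from continuous_map_compose[OF this chart_cont_inv[OF \<phi>]]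
    have c: "continuous_on (eucl n) (\<lambda>x. \<psi> (f (\<phi> x)))" by (simp add: comp_def \<psi>_def)
    have "\<psi> (f (\<phi> x)) \<in> eucl n" "\<phi> (\<psi> (f (\<phi> x))) = f (\<phi> x)" if "x \<in> eucl n" for x
      using im[of "\<phi> x"] that by (auto simp: \<psi>_def inv_into_into f_inv_into_f)
    moreover have "\<psi> (f (\<phi> x)) = x" if "x \<in> eucl n" "x \<notin> K" for x
    proof -
      have "\<phi> x \<notin> \<phi> ` K" using that K inj_on_image_mem_iff[OF chart_inj[OF \<phi>], of x K] by blast
      then show ?thesis using f(2) that chart_inv_into[OF \<phi>] by (simp add: \<psi>_def)
    qed
    ultimately show ?thesis using c by blast
  qed
  obtain g where g: "continuous_on (eucl n) g" "\<And>x. x\<in>eucl n \<Longrightarrow> g x \<in> eucl n \<and> \<phi> (g x) = f (\<phi> x) \<and> (x \<notin> K \<longrightarrow> g x = x)"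
    using cr[OF f] by blast
  have "hinv f p = p" if "p \<notin> \<phi> ` K" for p using f(2)[OF that] Homeo_inv_f[OF f(1)] by metis
  then obtain g' where g': "continuous_on (eucl n) g'"
    "\<And>x. x\<in>eucl n \<Longrightarrow> g' x \<in> eucl n \<and> \<phi> (g' x) = hinv f (\<phi> x) \<and> (x \<notin> K \<longrightarrow> g' x = x)"
    using cr[OF Homeo_inv[OF f(1)]] by blast
  have "g (g' x) = x" "g' (g x) = x" if "x \<in> eucl n" for x
  proof -
    have "\<phi> (g (g' x)) = \<phi> x" "\<phi> (g' (g x)) = \<phi> x" using g g' that Homeo_inv_f[OF f(1)] by simp_all
    moreover have "g (g' x) \<in> eucl n" "g' (g x) \<in> eucl n" using g(2) g'(2) that by blast+
    ultimately show "g (g' x) = x" "g' (g x) = x"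
      using inj_on_eq_iff[OF chart_inj[OF \<phi>] _ that] by blast+
  qed
  then have "supp_homeo n K g g'" using g g' by (simp add: supp_homeo_def)
  moreover have "f p = transport n \<phi> g p" for p
    using g f(2)[of p] K by (cases "p \<in> \<phi> ` eucl n") (auto simp: transport_chart[OF \<phi>] transport_outside)
  ultimately show ?thesis using that by blast
qed

end

section \<open>Splitting off a handle\<close>

lemma compact_near_subset:
  assumes "compact K" "K \<subseteq> V" "openin (top_of_set (eucl n)) V"
  obtains \<eta> where "\<eta> > 0" "\<And>x y. x \<in> K \<Longrightarrow> y \<in> eucl n \<Longrightarrow> near \<eta> y x \<Longrightarrow> y \<in> V"
proof -
  obtain U where U: "open U" "V = eucl n \<inter> U" using assms(3) by (auto simp: openin_open)
  obtain \<epsilon> where \<epsilon>: "\<epsilon> > 0" "(\<Union>x\<in>K. ball x \<epsilon>) \<subseteq> U"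
    using compact_subset_open_imp_ball_epsilon_subset[OF assms(1) U(1)] assms(2) U by blast
  show ?thesis
  proof (rule that[of "\<epsilon> / 3"])
    fix x y assume *: "x \<in> K" "y \<in> eucl n" "near (\<epsilon> / 3) y x"
    have "dist x y < \<epsilon>" using dist_le_of_near[OF *(3)] \<epsilon>(1) by (simp add: dist_commute)
    then have "y \<in> U" using *(1) \<epsilon>(2) by (meson UN_subset_iff mem_ball subsetD)
    then show "y \<in> V" using * U by simp
  qed (use \<epsilon> in simp)
qed

lemma closed_eucl: "closed (eucl n)"
proof -
  have "eucl n = (\<Inter>i\<in>{n..}. {x. x i = 0})" by (auto simp: eucl_def)
  moreover have "closed (\<Inter>i\<in>{n..}. {x::nat\<Rightarrow>real. x i = 0})"
    by (intro closed_INT ballI closed_Collect_eq continuous_on_coord continuous_intros)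
  ultimately show ?thesis by simp
qed

lemma closed_slab: "closed (slab n J r)"
proof -
  have "slab n J r = eucl n \<inter> (\<Inter>j\<in>J. {x. \<bar>x j\<bar> \<le> r})" by (auto simp: slab_def)
  moreover have "closed (\<Inter>j\<in>J. {x::nat\<Rightarrow>real. \<bar>x j\<bar> \<le> r})"
    by (intro closed_INT ballI closed_Collect_le continuous_intros continuous_on_coord)
  ultimately show ?thesis using closed_eucl by (simp add: closed_Int)
qed

context embedded_compact
begin

section \<open>Splitting near-identity homeomorphisms relative to neighbourhoods\<close>

definition near_id :: "real \<Rightarrow> ('a \<Rightarrow> 'a) \<Rightarrow> bool" where
  "near_id \<delta> h \<longleftrightarrow> (\<forall>p\<in>topspace X. dist (e (h p)) (e p) < \<delta>)"

text \<open>One peeling step: \<open>g\<close> goes into \<open>F\<close>, and the remainder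
  \<open>k\<close> stays close enough to the identity, as measured by \<epsilon>, to enter the next
  step.\<close>

definition splits :: "('a \<Rightarrow> 'a) set \<Rightarrow> 'a set \<Rightarrow> 'a set \<Rightarrow> real \<Rightarrow> real \<Rightarrow> bool" where
  "splits F N N' \<delta> \<epsilon> \<longleftrightarrow> (\<forall>h\<in>Homeo X. (\<forall>p\<in>N. h p = p) \<and> near_id \<delta> h \<longrightarrow>
     (\<exists>g\<in>F. \<exists>k\<in>Homeo X. h = g \<circ> k \<and> (\<forall>p\<in>N'. k p = p) \<and> near_id \<epsilon> k))"

text \<open>The neighbourhood \<open>N'\<close> has to be chosen before \<open>\<epsilon>\<close> for this relation to be transitive.\<close>

definition fragments :: "('a \<Rightarrow> 'a) set \<Rightarrow> 'a set \<Rightarrow> 'a set \<Rightarrow> bool" where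
  "fragments F C D \<longleftrightarrow> (\<forall>N. openin X N \<and> C \<subseteq> N \<longrightarrow>
     (\<exists>N'. openin X N' \<and> D \<subseteq> N' \<and> (\<forall>\<epsilon>>0. \<exists>\<delta>>0. splits F N N' \<delta> \<epsilon>)))"

lemma fragD:
  "fragments F C D \<Longrightarrow> openin X N \<Longrightarrow> C \<subseteq> N \<Longrightarrow>
     \<exists>N'. openin X N' \<and> D \<subseteq> N' \<and> (\<forall>\<epsilon>>0. \<exists>\<delta>>0. splits F N N' \<delta> \<epsilon>)"
  by (simp add: fragments_def)

lemma fragments_mono: "fragments F C D \<Longrightarrow> C \<subseteq> C' \<Longrightarrow> D' \<subseteq> D \<Longrightarrow> fragments F C' D'"
  unfolding fragments_def by (meson order_trans)

lemma fragments_refl: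
  assumes "id \<in> F" "D \<subseteq> C"
  shows "fragments F C D"
proof -
  have "splits F N N \<epsilon> \<epsilon>" for N \<epsilon>
    unfolding splits_def
  proof (intro ballI impI)
    fix h assume "h \<in> Homeo X" "(\<forall>p\<in>N. h p = p) \<and> near_id \<epsilon> h"
    then show "\<exists>g\<in>F. \<exists>k\<in>Homeo X. h = g \<circ> k \<and> (\<forall>p\<in>N. k p = p) \<and> near_id \<epsilon> k"
      by (intro bexI[of _ id] bexI[of _ h] assms(1)) auto
  qed
  then show ?thesis unfolding fragments_def using assms(2) by (meson order_trans)
qed

text \<open>Both neighbourhoods are fixed first, and then the tolerances run backwards, from
  \<epsilon> through \<open>\<delta>2\<close> to \<delta>.\<close>

lemma fragments_trans:
  assumes F: "\<And>f g. f \<in> F \<Longrightarrow> g \<in> F \<Longrightarrow> f \<circ> g \<in> F" and 1: "fragments F C D" and 2: "fragments F D E"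
  shows "fragments F C E"
  unfolding fragments_def
proof (intro allI impI, elim conjE)
  fix N assume N: "openin X N" "C \<subseteq> N"
  obtain N' where N': "openin X N'" "D \<subseteq> N'" "\<forall>\<epsilon>>0. \<exists>\<delta>>0. splits F N N' \<delta> \<epsilon>"
    using fragD[OF 1 N] by blast
  obtain M where M: "openin X M" "E \<subseteq> M" "\<forall>\<epsilon>>0. \<exists>\<delta>>0. splits F N' M \<delta> \<epsilon>"
    using fragD[OF 2 N'(1,2)] by blast
  have "\<exists>\<delta>>0. splits F N M \<delta> \<epsilon>" if \<epsilon>: "\<epsilon> > 0" for \<epsilon>
  proof -
    obtain \<delta>2 where \<delta>2: "\<delta>2 > 0" "splits F N' M \<delta>2 \<epsilon>" using M(3) \<epsilon> by blast
    obtain \<delta> where \<delta>: "\<delta> > 0" "splits F N N' \<delta> \<delta>2" using N'(3) \<delta>2(1) by blast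
    have "splits F N M \<delta> \<epsilon>"
      unfolding splits_def
    proof (intro ballI impI)
      fix h assume h: "h \<in> Homeo X" "(\<forall>p\<in>N. h p = p) \<and> near_id \<delta> h"
      obtain g k where g: "g \<in> F" "k \<in> Homeo X" "h = g \<circ> k" "\<forall>p\<in>N'. k p = p" "near_id \<delta>2 k"
        using \<delta>(2) h unfolding splits_def by blast
      obtain g' k' where g': "g' \<in> F" "k' \<in> Homeo X" "k = g' \<circ> k'" "\<forall>p\<in>M. k' p = p" "near_id \<epsilon> k'"
        using \<delta>2(2) g unfolding splits_def by blast
      have "h = (g \<circ> g') \<circ> k'" using g(3) g'(3) by (simp add: comp_assoc)
      then show "\<exists>g\<in>F. \<exists>k\<in>Homeo X. h = g \<circ> k \<and> (\<forall>p\<in>M. k p = p) \<and> near_id \<epsilon> k"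
        using F[OF g(1) g'(1)] g' by blast
    qed
    then show ?thesis using \<delta>(1) by blast
  qed
  then show "\<exists>N'. openin X N' \<and> E \<subseteq> N' \<and> (\<forall>\<epsilon>>0. \<exists>\<delta>>0. splits F N N' \<delta> \<epsilon>)"
    using M by blast
qed

text \<open>Along the handle \<open>f\<close> is the identity on the shell between 1 and \<theta>,
  so its coordinate expression can be cut off at 1 and continued by the identity over the whole
  slab. The shell has thickness at least \<delta>, so no point can jump across it.\<close>

lemma chart_expression_near_homeo:
  assumes \<phi>: "chart X n \<phi>" and J: "J \<subseteq> {..<n}" and \<theta>: "0 \<le> \<delta>" "1 + \<delta> \<le> \<theta>" and f: "f \<in> Homeo X"
    and fx: "\<forall>x\<in>slab n J R \<inter> slab n ({..<n} - J) \<theta>. \<forall>i\<in>{..<n} - J. \<bar>x i\<bar> \<ge> 1 \<longrightarrow> f (\<phi> x) = \<phi> x"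
    and nr: "\<forall>x\<in>slab n J R \<inter> slab n ({..<n} - J) 1. \<forall>g\<in>{f, hinv f}.
        g (\<phi> x) \<in> \<phi> ` eucl n \<and> near \<delta> (inv_into (eucl n) \<phi> (g (\<phi> x))) x"
  shows "\<exists>h h'. near_homeo n J R \<delta> h h' \<and>
    (\<forall>x\<in>slab n J R. \<forall>i\<in>{..<n} - J. \<bar>x i\<bar> \<ge> 1 \<longrightarrow> h x = x) \<and>
    (\<forall>x\<in>slab n J R \<inter> slab n ({..<n} - J) 1. \<phi> (h x) = f (\<phi> x))"
proof -
  define \<psi> where "\<psi> = inv_into (eucl n) \<phi>"
  define I where "I = {..<n} - J"
  define D where "D = slab n J R"
  define ex where "ex g x = (if \<forall>i\<in>I. \<bar>x i\<bar> \<le> 1 then \<psi> (g (\<phi> x)) else x)" for g x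
  define ok where "ok g \<longleftrightarrow> g \<in> Homeo X \<and>
     (\<forall>x i. x \<in> D \<longrightarrow> x \<in> slab n I \<theta> \<longrightarrow> i \<in> I \<longrightarrow> \<bar>x i\<bar> \<ge> 1 \<longrightarrow> g (\<phi> x) = \<phi> x) \<and>
     (\<forall>x. x \<in> D \<longrightarrow> x \<in> slab n I 1 \<longrightarrow> g (\<phi> x) \<in> \<phi> ` eucl n \<and> near \<delta> (\<psi> (g (\<phi> x))) x)" for g
  have DE: "x \<in> eucl n" if "x \<in> D" for x using that by (simp add: D_def slab_def)
  have psi: "\<psi> (\<phi> x) = x" if "x \<in> eucl n" for x using chart_inv_into[OF \<phi> that] by (simp add: \<psi>_def)
  have slabI: "x \<in> slab n I r \<longleftrightarrow> (\<forall>i\<in>I. \<bar>x i\<bar> \<le> r)" if "x \<in> D" for x r using DE[OF that] by (auto simp: slab_def)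
  have ok1: "ok f" unfolding ok_def using f fx nr by (auto simp: D_def I_def \<psi>_def)
  have ok2: "ok (hinv f)"
    unfolding ok_def
  proof (intro conjI allI impI)
    show "hinv f (\<phi> x) = \<phi> x" if "x \<in> D" "x \<in> slab n I \<theta>" "i \<in> I" "1 \<le> \<bar>x i\<bar>" for x i
    proof -
      have "f (\<phi> x) = \<phi> x" using fx that unfolding D_def I_def by blast
      then show ?thesis using Homeo_inv_f(1)[OF f, of "\<phi> x"] by simp
    qed
  qed (use f nr in \<open>auto simp: D_def I_def \<psi>_def Homeo_inv\<close>)
  have fixd: "ex g x = x" if "ok g" "x \<in> D" "i \<in> I" "\<bar>x i\<bar> \<ge> 1" for g x i
  proof (cases "\<forall>i\<in>I. \<bar>x i\<bar> \<le> 1")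
    case True
    then have "x \<in> slab n I \<theta>" using slabI[OF that(2)] \<theta> by force
    then have "g (\<phi> x) = \<phi> x" using that by (auto simp: ok_def)
    then show ?thesis using True psi[OF DE[OF that(2)]] by (simp add: ex_def)
  qed (auto simp: ex_def)
  have prp: "ex g x \<in> eucl n \<and> near \<delta> (ex g x) x" if "ok g" "x \<in> D" for g x
    using that \<theta> DE[OF that(2)] slabI[OF that(2)] by (auto simp: ex_def ok_def \<psi>_def inv_into_into)
  have phi_ex: "\<phi> (ex g x) = g (\<phi> x)" if "ok g" "x \<in> D" "x \<in> slab n I 1" for g x
    using that slabI[OF that(2)] by (auto simp: ex_def ok_def \<psi>_def f_inv_into_f)
  have cont: "continuous_on D (ex g)" if g: "ok g" for g
  proof -
    define D1 where "D1 = D \<inter> slab n I 1"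
    define D2 where "D2 = D \<inter> (\<Union>i\<in>I. {x. 1 \<le> \<bar>x i\<bar>})"
    have "continuous_map (top_of_set D1) X (g \<circ> \<phi>)"
    proof -
      have "continuous_map (top_of_set D1) X \<phi>"
        by (rule continuous_map_from_subtopology_mono[OF chart_cont[OF \<phi>]]) (auto simp: D1_def DE)
      then show ?thesis using g continuous_map_compose Homeo_cont unfolding ok_def by blast
    qed
    then have "continuous_map (top_of_set D1) (subtopology X (\<phi> ` eucl n)) (g \<circ> \<phi>)"
      using g by (auto simp: continuous_map_in_subtopology D1_def ok_def)
    from continuous_map_compose[OF this chart_cont_inv[OF \<phi>]]
    have c1: "continuous_on D1 (\<lambda>x. \<psi> (g (\<phi> x)))" by (simp add: comp_def \<psi>_def)
    have c1': "continuous_on D1 (ex g)"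
      by (rule continuous_on_eq[OF c1]) (use slabI in \<open>auto simp: D1_def ex_def\<close>)
    have c2: "continuous_on D2 (ex g)"
      by (rule continuous_on_eq[OF continuous_on_id]) (use fixd[OF g] in \<open>auto simp: D2_def\<close>)
    have "closed D1" unfolding D1_def D_def by (intro closed_Int closed_slab)
    moreover have "closed D2" unfolding D2_def D_def
      by (intro closed_Int closed_slab closed_UN ballI closed_Collect_le continuous_intros continuous_on_coord)
        (simp add: I_def)
    moreover have "D1 \<union> D2 = D" using slabI by (force simp: D1_def D2_def)
    ultimately show ?thesis using continuous_on_closed_Un[OF _ _ c1' c2] by simp
  qed
  have inv: "ex (hinv g) (ex g x) = x" if g: "ok g" "ok (hinv g)" and x: "x \<in> D" "ex g x \<in> D" for g x
  proof (cases "\<exists>i\<in>I. \<bar>x i\<bar> \<ge> 1")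
    case True
    then show ?thesis using fixd[OF g(1) x(1)] fixd[OF g(2) x(1)] by auto
  next
    case False
    define y where "y = ex g x"
    have x1: "x \<in> slab n I 1" using False slabI[OF x(1)] by force
    have phiy: "\<phi> y = g (\<phi> x)" using phi_ex[OF g(1) x(1) x1] by (simp add: y_def)
    have gH: "g \<in> Homeo X" using g by (simp add: ok_def)
    \<comment> \<open>An image with \<open>\<bar>y i\<bar> \<ge> 1\<close> would lie in the shell,
      because \<delta> is too small to pass \<theta>. There \<open>hinv g\<close> is the identity,
      so \<open>x\<close> would equal \<open>y\<close>, against the case assumption.\<close>
    have "\<bar>y i\<bar> < 1" if i: "i \<in> I" for i
    proof (rule ccontr)
      assume *: "\<not> \<bar>y i\<bar> < 1"
      have "\<bar>y k\<bar> \<le> \<theta>" if "k \<in> I" for k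
      proof -
        have "\<bar>y k - x k\<bar> \<le> \<delta>" using prp[OF g(1) x(1)] by (auto simp: y_def near_def)
        moreover have "\<bar>x k\<bar> \<le> 1" using x1 that by (auto simp: slab_def)
        ultimately show ?thesis using \<theta> by linarith
      qed
      then have "y \<in> slab n I \<theta>" using slabI x(2) y_def by blast
      then have "hinv g (\<phi> y) = \<phi> y" using g(2) x(2) i * unfolding ok_def y_def by force
      then have "\<phi> x = \<phi> y" using phiy Homeo_inv_f[OF gH] by metis
      then have "x = y" using psi DE[OF x(1)] DE[OF x(2)] y_def by metis
      then show False using False * i by force
    qed
    then have "ex (hinv g) y = \<psi> (hinv g (\<phi> y))" unfolding ex_def by force
    then show ?thesis using phiy Homeo_inv_f[OF gH] psi[OF DE[OF x(1)]] by (simp add: y_def)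
  qed
  have hh: "hinv (hinv f) = f" using Homeo_bij[OF f] inv_inv_eq by blast
  show ?thesis
  proof (rule exI[of _ "ex f"], rule exI[of _ "ex (hinv f)"], intro conjI)
    show "near_homeo n J R \<delta> (ex f) (ex (hinv f))"
      unfolding near_homeo_def D_def[symmetric]
      using cont[OF ok1] cont[OF ok2] prp[OF ok1] prp[OF ok2] inv[OF ok1 ok2] inv[OF ok2] ok1 by (simp add: hh)
  qed (use fixd[OF ok1] phi_ex[OF ok1] in \<open>auto simp: D_def I_def\<close>)
qed

lemma transport_chart_comp:
  assumes \<phi>: "chart X n \<phi>" and ab: "\<And>x. x \<in> eucl n \<Longrightarrow> a x \<in> eucl n \<and> b x \<in> eucl n \<and> a (b x) = x \<and> b (a x) = x"
    and \<phi>': "chart X n (\<lambda>x. \<phi> (a x))" and g: "\<And>x. x \<in> eucl n \<Longrightarrow> g x \<in> eucl n"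
  shows "transport n (\<lambda>x. \<phi> (a x)) g = transport n \<phi> (\<lambda>x. a (g (b x)))"
proof
  fix p
  have im: "(\<lambda>x. \<phi> (a x)) ` eucl n = \<phi> ` eucl n"
  proof
    show "\<phi> ` eucl n \<subseteq> (\<lambda>x. \<phi> (a x)) ` eucl n"
    proof
      fix q assume "q \<in> \<phi> ` eucl n"
      then obtain x where "x \<in> eucl n" "q = \<phi> x" by blast
      then show "q \<in> (\<lambda>x. \<phi> (a x)) ` eucl n" using ab by (intro image_eqI[of _ _ "b x"]) auto
    qed
  qed (use ab in auto)
  show "transport n (\<lambda>x. \<phi> (a x)) g p = transport n \<phi> (\<lambda>x. a (g (b x))) p"
  proof (cases "p \<in> \<phi> ` eucl n")
    case True
    then obtain x where x: "x \<in> eucl n" "p = \<phi> (a x)" using im by auto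
    then show ?thesis using transport_chart[OF \<phi>' x(1), of g] transport_chart[OF \<phi>, of "a x"] ab by simp
  next
    case False
    then show ?thesis using im by (simp add: transport_outside)
  qed
qed

lemma near_id_hinv_comp:
  assumes G: "G \<in> Homeo X" "near_id \<epsilon> G" and h: "h \<in> Homeo X" "near_id \<delta> h"
  shows "near_id (\<epsilon> + \<delta>) (hinv G \<circ> h)"
  unfolding near_id_def
proof
  fix p assume p: "p \<in> topspace X"
  define q where "q = hinv G (h p)"
  have "q \<in> topspace X" using p Homeo_topspace[OF h(1)] Homeo_topspace[OF Homeo_inv[OF G(1)]] by (simp add: q_def)
  moreover have "G q = h p" using G(1) by (simp add: q_def)
  ultimately have "dist (e (h p)) (e q) < \<epsilon>" using G(2) unfolding near_id_def by metis
  moreover have "dist (e (h p)) (e p) < \<delta>" using h p by (simp add: near_id_def)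
  ultimately have "dist (e q) (e p) < \<epsilon> + \<delta>" using dist_triangle3[of "e q" "e p" "e (h p)"] by linarith
  then show "dist (e ((hinv G \<circ> h) p)) (e p) < \<epsilon> + \<delta>" by (simp add: q_def)
qed

lemma near_id_hinv: "h \<in> Homeo X \<Longrightarrow> near_id \<delta> h \<Longrightarrow> near_id \<delta> (hinv h)"
  unfolding near_id_def using Homeo_topspace[OF Homeo_inv] by (metis Homeo_inv_f(2) dist_commute)

text \<open>\<open>local_extension\<close> in the chart provides \<open>G\<close>, and the remainder
  is the inverse of \<open>G\<close> followed after \<open>h\<close>. It is the identity on the
  image of \<open>V\<close>, where \<open>G\<close> agrees with \<open>h\<close>, and on the part of
  \<open>N\<close> off the support of \<open>G\<close>, where neither map moves a point.\<close>

lemma handle_splits: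
  assumes \<phi>: "chart X n \<phi>" and J: "J \<subseteq> {..<n}" and \<theta>: "1 < \<theta>"
    and N: "\<And>x i. x \<in> slab n J (6 + card J) \<Longrightarrow> x \<in> slab n ({..<n} - J) \<theta> \<Longrightarrow> i \<in> {..<n} - J \<Longrightarrow> \<bar>x i\<bar> \<ge> 1 \<Longrightarrow> \<phi> x \<in> N"
    and F: "\<And>g g'. supp_homeo n (box n 2 \<inter> slab n ({..<n} - J) 1) g g' \<Longrightarrow> transport n \<phi> g \<in> F"
    and \<epsilon>: "\<epsilon> > 0"
  shows "\<exists>\<delta>>0. splits F N ((N - \<phi> ` (box n 2 \<inter> slab n ({..<n} - J) 1)) \<union>
    \<phi> ` (slab n J (1/2) \<inter> slab n ({..<n} - J) \<theta>)) \<delta> \<epsilon>"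
proof -
  define I where "I = {..<n} - J"
  define R where "R = real (6 + card J)"
  define B where "B = box n 2 \<inter> slab n I 1"
  define V where "V = slab n J (1/2) \<inter> slab n I \<theta>"
  define \<psi> where "\<psi> = inv_into (eucl n) \<phi>"
  have BE: "B \<subseteq> eucl n" by (auto simp: B_def slab_def)
  have Bc: "compact B" unfolding B_def by (intro compact_Int_closed compact_box closed_slab)
  obtain \<delta>1 where \<delta>1: "\<delta>1 > 0" "\<And>x y. x \<in> box n 2 \<Longrightarrow> y \<in> eucl n \<Longrightarrow> near \<delta>1 y x \<Longrightarrow> dist (e (\<phi> y)) (e (\<phi> x)) < \<epsilon> / 2"
    using chart_near_imp_dist[OF \<phi>, of "\<epsilon> / 2" 2] \<epsilon> by auto
  \<comment> \<open>Three demands at once: the thickness of the shell, the bound 1/4 of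
    \<open>local_extension\<close>, and displacement at most \<open>\<delta>1\<close>, which makes
    \<open>G\<close> move points by less than \<epsilon>/2.\<close>
  define \<delta>c where "\<delta>c = min (\<theta> - 1) (min (1/4) (\<delta>1 / 2) / 3 ^ card J)"
  have \<delta>c0: "\<delta>c > 0" using \<theta> \<delta>1(1) by (simp add: \<delta>c_def)
  have "\<delta>c \<le> min (1/4) (\<delta>1 / 2) / 3 ^ card J" unfolding \<delta>c_def by simp
  then have "3 ^ card J * \<delta>c \<le> min (1/4) (\<delta>1 / 2)" by (simp add: le_divide_eq mult.commute)
  then have \<delta>c: "1 + \<delta>c \<le> \<theta>" "3 ^ card J * \<delta>c \<le> 1/4" "2 * (3 ^ card J * \<delta>c) \<le> \<delta>1"
    by (auto simp: \<delta>c_def)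
  obtain \<delta>2 where \<delta>2: "\<delta>2 > 0" "\<And>x p. x \<in> box n (R + 1) \<Longrightarrow> p \<in> topspace X \<Longrightarrow> dist (e (\<phi> x)) (e p) < \<delta>2 \<Longrightarrow>
    p \<in> \<phi> ` eucl n \<and> near \<delta>c (\<psi> p) x"
    unfolding \<psi>_def using chart_dist_imp_near[OF \<phi> \<delta>c0, of "R + 1"] by blast
  define \<delta> where "\<delta> = min \<delta>2 (\<epsilon> / 2)"
  have "splits F N ((N - \<phi> ` B) \<union> \<phi> ` V) \<delta> \<epsilon>"
    unfolding splits_def
  proof (intro ballI impI, elim conjE)
    fix h assume h: "h \<in> Homeo X" "\<forall>p\<in>N. h p = p" "near_id \<delta> h"
    have nr: "g (\<phi> x) \<in> \<phi> ` eucl n \<and> near \<delta>c (inv_into (eucl n) \<phi> (g (\<phi> x))) x"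
      if x': "x \<in> slab n J R \<inter> slab n ({..<n} - J) 1" and g: "g \<in> {h, hinv h}" for x g
    proof -
      have x: "x \<in> slab n J R" "x \<in> slab n ({..<n} - J) 1" using x' by auto
      have xE: "x \<in> eucl n" using x by (simp add: slab_def)
      have gg: "near_id \<delta> g" "g \<in> Homeo X" using g h near_id_hinv Homeo_inv by auto
      have "dist (e (\<phi> x)) (e (g (\<phi> x))) < \<delta>2" "g (\<phi> x) \<in> topspace X"
        using chart_in_topspace[OF \<phi> xE] Homeo_topspace[OF gg(2)] gg(1) by (auto simp: near_id_def \<delta>_def dist_commute)
      moreover have "\<bar>x i\<bar> \<le> R + 1" if "i < n" for i
        using x that by (cases "i \<in> J") (force simp: slab_def R_def)+
      then have "x \<in> box n (R + 1)" using xE by (simp add: slab_def)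
      ultimately show ?thesis using \<delta>2(2) unfolding \<psi>_def by blast
    qed
    have fx: "h (\<phi> x) = \<phi> x" if "x \<in> slab n J R \<inter> slab n ({..<n} - J) \<theta>" "i \<in> {..<n} - J" "\<bar>x i\<bar> \<ge> 1" for x i
      using h(2) N[of x i] that by (simp add: R_def)
    have fx': "\<forall>x\<in>slab n J R \<inter> slab n ({..<n} - J) \<theta>. \<forall>i\<in>{..<n} - J. \<bar>x i\<bar> \<ge> 1 \<longrightarrow> h (\<phi> x) = \<phi> x"
      and nr': "\<forall>x\<in>slab n J R \<inter> slab n ({..<n} - J) 1. \<forall>g\<in>{h, hinv h}.
        g (\<phi> x) \<in> \<phi> ` eucl n \<and> near \<delta>c (inv_into (eucl n) \<phi> (g (\<phi> x))) x"
      using fx nr by blast+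
    obtain h0 h0' where h0: "near_homeo n J R \<delta>c h0 h0'"
      "\<forall>x\<in>slab n J R. \<forall>i\<in>{..<n} - J. \<bar>x i\<bar> \<ge> 1 \<longrightarrow> h0 x = x"
      "\<forall>x\<in>slab n J R \<inter> slab n ({..<n} - J) 1. \<phi> (h0 x) = h (\<phi> x)"
      using chart_expression_near_homeo[OF \<phi> J less_imp_le[OF \<delta>c0] \<delta>c(1) h(1) fx' nr'] by blast
    obtain g g' where g: "near_homeo n {} 0 (2 * (3 ^ card J * \<delta>c)) g g'"
      "\<forall>x\<in>eucl n. \<forall>i\<in>{..<n} - J. \<bar>x i\<bar> \<ge> 1 \<longrightarrow> g x = x"
      "\<forall>x\<in>eucl n. \<forall>i<n. \<bar>x i\<bar> \<ge> 2 \<longrightarrow> g x = x"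
      "\<forall>x\<in>slab n J (1/2) \<inter> slab n ({..<n} - J) 1. g x = h0 x"
      using local_extension[OF J h0(1)[unfolded R_def] less_imp_le[OF \<delta>c0] \<delta>c(2) h0(2)[unfolded R_def]] by blast
    have gB: "supp_homeo n B g g'"
    proof (rule supp_homeo_of_near[OF g(1)])
      fix x assume x: "x \<in> eucl n" "x \<notin> B"
      then have "(\<exists>i<n. \<bar>x i\<bar> \<ge> 2) \<or> (\<exists>i\<in>I. \<bar>x i\<bar> \<ge> 1)" by (auto simp: B_def slab_def) (smt (verit))+
      then show "g x = x" using g(2,3) x(1) I_def by blast
    qed
    define G where "G = transport n \<phi> g"
    note GH = transport_Homeo[OF \<phi> Bc BE gB, folded G_def]
    have GF: "G \<in> F" unfolding G_def using gB by (intro F[of g g']) (simp add: B_def I_def)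
    have Gx: "G (\<phi> x) = \<phi> (g x)" if "x \<in> eucl n" for x using transport_chart[OF \<phi> that] by (simp add: G_def)
    have Gout: "G p = p" if "p \<notin> \<phi> ` B" for p
      unfolding G_def using transport_supp[OF \<phi>, of B g p] gB that BE by (auto simp: supp_homeo_def Int_absorb2)
    have Gn: "near_id (\<epsilon> / 2) G"
      unfolding near_id_def
    proof
      fix p assume p: "p \<in> topspace X"
      show "dist (e (G p)) (e p) < \<epsilon> / 2"
      proof (cases "p \<in> \<phi> ` B")
        case True
        then obtain x where x: "x \<in> B" "p = \<phi> x" by blast
        have xE: "x \<in> eucl n" using x BE by blast
        have "near \<delta>1 (g x) x" "g x \<in> eucl n"
          using g(1) xE near_mono[OF _ \<delta>c(3)] by (auto simp: near_homeo_def)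
        then show ?thesis using \<delta>1(2)[of x "g x"] x by (simp add: B_def Gx[OF xE])
      qed (use Gout \<epsilon> in simp)
    qed
    define k where "k = hinv G \<circ> h"
    have "near_id (\<epsilon> / 2 + \<epsilon> / 2) k" unfolding k_def
    proof (rule near_id_hinv_comp[OF GH(1) Gn h(1)])
      show "near_id (\<epsilon> / 2) h" using h(3) by (auto simp: near_id_def \<delta>_def)
    qed
    then have kn: "near_id \<epsilon> k" by simp
    have kH: "k \<in> Homeo X" unfolding k_def by (intro Homeo_comp Homeo_inv GH(1) h(1))
    have hGk: "h = G \<circ> k" using GH(1) by (auto simp: k_def)
    have Gk: "k p = p" if "h p = G p" for p
      using that GH(1) by (simp add: k_def)
    have "k p = p" if p: "p \<in> (N - \<phi> ` B) \<union> \<phi> ` V" for p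
      using p
    proof
      assume "p \<in> N - \<phi> ` B"
      then show ?thesis using h(2) Gout by (intro Gk) auto
    next
      assume "p \<in> \<phi> ` V"
      then obtain x where x: "x \<in> V" "p = \<phi> x" by blast
      have xJ: "x \<in> slab n J (1/2)" "x \<in> slab n I \<theta>" "x \<in> slab n J R" "x \<in> eucl n"
        using x by (force simp: V_def slab_def R_def)+
      show ?thesis
      proof (cases "x \<in> slab n I 1")
        case True
        then show ?thesis
          using g(4) h0(3) xJ x by (intro Gk) (simp add: I_def Gx)
      next
        case False
        then obtain i where i: "i \<in> I" "\<bar>x i\<bar> \<ge> 1" using xJ by (force simp: slab_def)
        then have "h p = p" using fx xJ x by (auto simp: I_def)
        moreover have "g x = x" using g(2) i xJ by (auto simp: I_def)
        ultimately show ?thesis using x xJ by (intro Gk) (simp add: Gx)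
      qed
    qed
    then show "\<exists>g\<in>F. \<exists>k\<in>Homeo X. h = g \<circ> k \<and> (\<forall>p\<in>(N - \<phi> ` B) \<union> \<phi> ` V. k p = p) \<and> near_id \<epsilon> k"
      using GF kH hGk kn by blast
  qed
  moreover have "\<delta> > 0" using \<delta>2(1) \<epsilon> by (simp add: \<delta>_def)
  ultimately show ?thesis unfolding B_def V_def I_def by blast
qed

end

lemma supp_homeo_conj:
  assumes g: "supp_homeo n K g g'" and cA: "continuous_on (eucl n) A" "continuous_on (eucl n) A'"
    and AE: "\<And>x. x \<in> eucl n \<Longrightarrow> A x \<in> eucl n \<and> A' x \<in> eucl n \<and> A (A' x) = x \<and> A' (A x) = x"
    and supp: "\<And>x. x \<in> eucl n \<Longrightarrow> A' x \<in> K \<Longrightarrow> x \<in> L"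
  shows "supp_homeo n L (\<lambda>x. A (g (A' x))) (\<lambda>x. A (g' (A' x)))"
  unfolding supp_homeo_def
proof (intro conjI ballI impI)
  have cg: "continuous_on (eucl n) (\<lambda>x. A (f (A' x)))"
    if "continuous_on (eucl n) f" "\<And>x. x \<in> eucl n \<Longrightarrow> f x \<in> eucl n" for f
    by (intro continuous_on_compose2[OF cA(1)] continuous_on_compose2[OF that(1) cA(2)]) (use AE that in auto)
  show "continuous_on (eucl n) (\<lambda>x. A (g (A' x)))" "continuous_on (eucl n) (\<lambda>x. A (g' (A' x)))"
    using g by (intro cg; simp add: supp_homeo_def)+
  fix x assume x: "x \<in> eucl n"
  have "A' x \<in> eucl n" using AE x by blast
  note g1 = g[unfolded supp_homeo_def, THEN conjunct2, THEN conjunct2, rule_format, OF this]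
  show "A (g (A' x)) \<in> eucl n" "A (g' (A' x)) \<in> eucl n" using AE g1 by blast+
  show "A (g' (A' (A (g (A' x))))) = x" "A (g (A' (A (g' (A' x))))) = x" using AE g1 x by simp_all
  assume "x \<notin> L"
  then have "A' x \<notin> K" using supp x by blast
  then show "A (g (A' x)) = x" "A (g' (A' x)) = x" using AE g1 x by simp_all
qed

context embedded_compact
begin

lemma splits_mono: "splits F N N' \<delta> \<epsilon> \<Longrightarrow> M \<subseteq> N' \<Longrightarrow> splits F N M \<delta> \<epsilon>"
  unfolding splits_def by (meson subsetD)

lemma openin_chart_preimage: "chart X n \<phi> \<Longrightarrow> openin X U \<Longrightarrow> openin (top_of_set (eucl n)) {x \<in> eucl n. \<phi> x \<in> U}"
  using openin_continuous_map_preimage[OF chart_cont] by simp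

text \<open>The cell is the core of a handle with transverse directions \<open>J\<close>.
  Coordinates are rescaled to fit \<open>handle_splits\<close>: by \<open>a < 1\<close> along the
  cell, so that its collar between \<open>a\<close> and 1, which lies in \<open>N\<close>, becomes
  the shell between 1 and \<open>1/a\<close>; and by a small \<open>c\<close> across it, so that a
  slab of radius \<open>6 + card J\<close> becomes thin.\<close>

lemma fragments_handle:
  assumes \<phi>: "chart X n \<phi>" and J: "J \<subseteq> {..<n}" and C: "closedin X C"
    and bd: "\<And>x i. x \<in> slab n J 0 \<Longrightarrow> x \<in> slab n ({..<n} - J) 1 \<Longrightarrow> i \<in> {..<n} - J \<Longrightarrow> \<bar>x i\<bar> = 1 \<Longrightarrow> \<phi> x \<in> C"
    and int: "\<And>x. x \<in> slab n J 0 \<Longrightarrow> (\<forall>i\<in>{..<n} - J. \<bar>x i\<bar> < 1) \<Longrightarrow> \<phi> x \<notin> C"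
    and F: "\<And>g g'. supp_homeo n (box n 1) g g' \<Longrightarrow> transport n \<phi> g \<in> F"
  shows "fragments F C (C \<union> \<phi> ` (slab n J 0 \<inter> slab n ({..<n} - J) 1))"
  unfolding fragments_def
proof (intro allI impI, elim conjE)
  fix N assume N: "openin X N" "C \<subseteq> N"
  define I where "I = {..<n} - J"
  have IJ: "i \<in> I \<or> i \<in> J \<or> n \<le> i" for i by (auto simp: I_def)
  have disj: "i \<notin> J" if "i \<in> I" for i using that by (simp add: I_def)
  \<comment> \<open>The boundary of the cell; it lies in \<open>C\<close>, and a neighbourhood of it
    of size \<open>\<eta>1\<close> lies in \<open>N\<close>.\<close>
  define K1 where "K1 = box n 1 \<inter> (slab n J 0 \<inter> (\<Union>i\<in>I. {x. 1 \<le> \<bar>x i\<bar>}))"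
  have "closed (\<Union>i\<in>I. {x::nat\<Rightarrow>real. 1 \<le> \<bar>x i\<bar>})"
    by (intro closed_UN ballI closed_Collect_le continuous_intros continuous_on_coord) (simp add: I_def)
  then have K1: "compact K1" unfolding K1_def by (intro compact_Int_closed compact_box closed_Int closed_slab)
  have K1N: "K1 \<subseteq> {x \<in> eucl n. \<phi> x \<in> N}"
  proof
    fix x assume x: "x \<in> K1"
    then obtain i where i: "i \<in> I" "1 \<le> \<bar>x i\<bar>" by (auto simp: K1_def)
    have xs: "x \<in> box n 1" "i < n" using x i by (auto simp: K1_def I_def)
    then have "\<bar>x i\<bar> \<le> 1" "x \<in> eucl n" by (auto simp: slab_def)
    then have "\<bar>x i\<bar> = 1" "x \<in> eucl n" using i by auto
    moreover have "x \<in> slab n J 0" "x \<in> slab n ({..<n} - J) 1" using x by (auto simp: K1_def slab_def)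
    ultimately show "x \<in> {x \<in> eucl n. \<phi> x \<in> N}" using bd[of x i] i N by (auto simp: I_def)
  qed
  obtain \<eta>1 where \<eta>1: "\<eta>1 > 0" "\<And>x y. x \<in> K1 \<Longrightarrow> y \<in> eucl n \<Longrightarrow> near \<eta>1 y x \<Longrightarrow> y \<in> {x \<in> eucl n. \<phi> x \<in> N}"
    using compact_near_subset[OF K1 K1N openin_chart_preimage[OF \<phi> N(1)]] by blast
  define \<eta> where "\<eta> = min \<eta>1 (1/2)"
  define a where "a = 1 - \<eta>"
  have a: "0 < a" "a < 1" "1 - a \<le> \<eta>1" using \<eta>1(1) by (auto simp: a_def \<eta>_def)
  \<comment> \<open>The cell cut back to radius \<open>a\<close> misses \<open>C\<close>, and so
    does a neighbourhood of size \<open>\<eta>2\<close>. The support of the split-off factor will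
    lie there, so removing it from \<open>N\<close> does not uncover \<open>C\<close>.\<close>
  define K2 where "K2 = box n 1 \<inter> (slab n J 0 \<inter> slab n I a)"
  have K2: "compact K2" unfolding K2_def by (intro compact_Int_closed compact_box closed_Int closed_slab)
  have "openin X (topspace X - C)" using C by blast
  note V2 = openin_chart_preimage[OF \<phi> this]
  have K2C: "K2 \<subseteq> {x \<in> eucl n. \<phi> x \<in> topspace X - C}"
  proof
    fix x assume x: "x \<in> K2"
    then have "\<bar>x i\<bar> < 1" if "i \<in> {..<n} - J" for i
      using that a(2) unfolding K2_def slab_def I_def by (smt (verit) IntD2 mem_Collect_eq)
    then have "\<phi> x \<notin> C" using x by (intro int) (auto simp: K2_def)
    moreover have "x \<in> eucl n" using x by (simp add: K2_def slab_def)
    ultimately show "x \<in> {x \<in> eucl n. \<phi> x \<in> topspace X - C}" using chart_in_topspace[OF \<phi>] by blast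
  qed
  obtain \<eta>2 where \<eta>2: "\<eta>2 > 0" "\<And>x y. x \<in> K2 \<Longrightarrow> y \<in> eucl n \<Longrightarrow> near \<eta>2 y x \<Longrightarrow> y \<in> {x \<in> eucl n. \<phi> x \<in> topspace X - C}"
    using compact_near_subset[OF K2 K2C V2] by blast
  define b where "b = min 1 (min \<eta>1 \<eta>2)"
  define c where "c = b / real (6 + card J)"
  have b: "0 < b" "b \<le> 1" "b \<le> \<eta>1" "b \<le> \<eta>2" using \<eta>1(1) \<eta>2(1) by (auto simp: b_def)
  have c: "0 < c" "real (6 + card J) * c = b" using b by (auto simp: c_def)
  have "2 * c \<le> real (6 + card J) * c" using c(1) by (intro mult_right_mono) auto
  then have c2: "2 * c \<le> b" "2 * c \<le> 1" unfolding c(2) using b by linarith+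
  define A where "A x = (\<lambda>i. if i \<in> J then c * x i else a * x i)" for x :: "nat \<Rightarrow> real"
  define A' where "A' x = (\<lambda>i. if i \<in> J then x i / c else x i / a)" for x :: "nat \<Rightarrow> real"
  have AE: "A x \<in> eucl n \<and> A' x \<in> eucl n \<and> A (A' x) = x \<and> A' (A x) = x" if "x \<in> eucl n" for x
    using that a c by (auto simp: A_def A'_def eucl_def)
  have cA: "continuous_on S A" "continuous_on S A'" for S
  proof -
    have "continuous_on S (\<lambda>x. A x i)" "continuous_on S (\<lambda>x. A' x i)" for i
      unfolding A_def A'_def using a c by (cases "i \<in> J"; auto intro!: continuous_intros continuous_on_coord)+
    then show "continuous_on S A" "continuous_on S A'" by (auto intro: continuous_on_coordinatewise_then_product)
  qed
  define \<theta> where "\<theta> = 1 / a"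
  have \<theta>: "1 < \<theta>" "a * \<theta> = 1" using a by (auto simp: \<theta>_def)
  define \<phi>' where "\<phi>' x = \<phi> (A x)" for x
  have \<phi>': "chart X n \<phi>'" unfolding \<phi>'_def using chart_comp(1)[OF \<phi> cA AE] .
  define B where "B = box n 2 \<inter> slab n ({..<n} - J) 1"
  have BE: "B \<subseteq> eucl n" by (auto simp: B_def slab_def)
  have Bc: "compact B" unfolding B_def by (intro compact_Int_closed compact_box closed_slab)
  have N1: "\<phi>' x \<in> N" if x: "x \<in> slab n J (6 + card J)" "x \<in> slab n ({..<n} - J) \<theta>" "i \<in> {..<n} - J" "\<bar>x i\<bar> \<ge> 1" for x i
  proof -
    have xE: "x \<in> eucl n" using x by (simp add: slab_def)
    \<comment> \<open>The point of \<open>K1\<close> next to \<open>A x\<close>: transverse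
      coordinates are dropped and coordinate \<open>i\<close> is pushed out to absolute value
      1.\<close>
    define z where "z = (\<lambda>k. if k \<in> J then 0 else if k = i then sgn (x i) else A x k)"
    have bI: "\<bar>A x k\<bar> \<le> 1" if "k \<in> I" for k
    proof -
      have "a * \<bar>x k\<bar> \<le> a * \<theta>" using that x a by (intro mult_left_mono) (auto simp: I_def slab_def)
      then have "a * \<bar>x k\<bar> \<le> 1" by (simp only: \<theta>(2))
      then show ?thesis using that a(1) by (simp add: A_def disj abs_mult)
    qed
    have bJ: "\<bar>A x k\<bar> \<le> b" if "k \<in> J" for k
    proof -
      have "c * \<bar>x k\<bar> \<le> c * real (6 + card J)" using that x c by (intro mult_left_mono) (auto simp: slab_def)
      also have "\<dots> = b" using c(2) by (simp only: mult.commute)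
      finally show ?thesis using that c(1) by (simp add: A_def abs_mult)
    qed
    have i: "i \<in> I" "i \<notin> J" "i < n" using x by (auto simp: I_def)
    have sg: "\<bar>sgn (x i)\<bar> = 1" using x(4) by (auto simp: sgn_if)
    have "z \<in> eucl n" using xE AE[OF xE] i J by (auto simp: z_def eucl_def)
    moreover have "\<bar>z k\<bar> \<le> 1" if "k < n" for k using bI[of k] IJ[of k] sg that by (auto simp: z_def)
    moreover have "1 \<le> \<bar>z i\<bar>" using sg i by (simp add: z_def)
    ultimately have "z \<in> K1" using i unfolding K1_def slab_def by (auto simp: z_def)
    moreover have "near \<eta>1 (A x) z"
      unfolding near_def
    proof
      fix k
      consider "k \<in> J" | "k = i" | "k \<notin> J" "k \<noteq> i" by blast
      then show "\<bar>A x k - z k\<bar> \<le> \<eta>1"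
      proof cases
        case 1
        then show ?thesis using bJ[OF 1] b by (simp add: z_def)
      next
        case 2
        have "A x i = sgn (x i) * (a * \<bar>x i\<bar>)" using i by (simp add: A_def sgn_if)
        then have "A x i - z i = sgn (x i) * (a * \<bar>x i\<bar> - 1)" using i by (simp add: z_def algebra_simps)
        then have "\<bar>A x i - z i\<bar> = \<bar>a * \<bar>x i\<bar> - 1\<bar>" using sg by (simp add: abs_mult)
        moreover have "a * \<bar>x i\<bar> \<le> 1" using bI[OF i(1)] i a by (simp add: A_def abs_mult)
        moreover have "a * 1 \<le> a * \<bar>x i\<bar>" using x(4) a by (intro mult_left_mono) auto
        ultimately have "\<bar>A x i - z i\<bar> \<le> \<eta>1" using a(3) by linarith
        then show ?thesis using 2 by simp
      next
        case 3
        then show ?thesis using \<eta>1(1) by (simp add: z_def)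
      qed
    qed
    ultimately show ?thesis using \<eta>1(2)[of z "A x"] AE[OF xE] by (simp add: \<phi>'_def)
  qed
  have F': "transport n \<phi>' g \<in> F" if g: "supp_homeo n (box n 2 \<inter> slab n ({..<n} - J) 1) g g'" for g g'
  proof -
    have supp: "x \<in> box n 1" if x: "x \<in> eucl n" "A' x \<in> B" for x
    proof -
      have "\<bar>x i\<bar> \<le> 1" if "i < n" for i
      proof (cases "i \<in> J")
        case True
        have "\<bar>A' x i\<bar> \<le> 2" using x that by (simp add: B_def slab_def)
        then have "\<bar>x i\<bar> \<le> 2 * c" using True c(1) by (simp add: A'_def divide_le_eq)
        then show ?thesis using c2 by linarith
      next
        case False
        have "\<bar>A' x i\<bar> \<le> 1" using x that False by (simp add: B_def slab_def)
        then have "\<bar>x i\<bar> \<le> a" using False a(1) by (simp add: A'_def divide_le_eq)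
        then show ?thesis using a by linarith
      qed
      then show ?thesis using x by (simp add: slab_def)
    qed
    have gE: "g x \<in> eucl n" if "x \<in> eucl n" for x
      using g that by (auto simp: supp_homeo_def)
    have "supp_homeo n (box n 1) (\<lambda>x. A (g (A' x))) (\<lambda>x. A (g' (A' x)))"
      by (rule supp_homeo_conj[OF g cA AE]) (use supp in \<open>auto simp: B_def\<close>)
    then have "transport n \<phi> (\<lambda>x. A (g (A' x))) \<in> F" by (rule F)
    moreover have "transport n \<phi>' g = transport n \<phi> (\<lambda>x. A (g (A' x)))"
      using transport_chart_comp[OF \<phi> AE \<phi>'[unfolded \<phi>'_def] gE] unfolding \<phi>'_def .
    ultimately show ?thesis by simp
  qed
  define V where "V = {x \<in> eucl n. \<forall>i<n. \<bar>x i - 0\<bar> < (if i \<in> J then 1/2 else \<theta>)}"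
  \<comment> \<open>The open set \<open>V\<close> is where the remainder is known to be trivial. It
    covers the interior of the cell, while the boundary is already in \<open>C\<close>.\<close>
  define N' where "N' = (N - \<phi>' ` B) \<union> \<phi>' ` V"
  have "openin X (\<phi>' ` V)" unfolding V_def
    by (rule chart_open_map[OF \<phi>' openin_coord_box])
  moreover have "closedin X (\<phi>' ` B)" using chart_compact[OF \<phi>' Bc BE] closedin_compact by blast
  ultimately have oN': "openin X N'" unfolding N'_def using N(1) by blast
  have "p \<notin> \<phi>' ` B" if p: "p \<in> C" for p
  proof
    assume "p \<in> \<phi>' ` B"
    then obtain x where x: "x \<in> B" "p = \<phi> (A x)" by (auto simp: \<phi>'_def)
    have xE: "x \<in> eucl n" using x BE by blast
    define z where "z = (\<lambda>k. if k \<in> J then 0 else A x k)"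
    have bI: "\<bar>A x k\<bar> \<le> a" if "k \<in> I" for k
    proof -
      have "a * \<bar>x k\<bar> \<le> a * 1" using that x a by (intro mult_left_mono) (auto simp: I_def B_def slab_def)
      then have "a * \<bar>x k\<bar> \<le> a" by (simp only: mult_1_right)
      then show ?thesis using that a(1) by (simp add: A_def disj abs_mult)
    qed
    have bJ: "\<bar>A x k\<bar> \<le> \<eta>2" if "k \<in> J" for k
    proof -
      have "c * \<bar>x k\<bar> \<le> c * 2" using that x c J by (intro mult_left_mono) (auto simp: B_def slab_def)
      also have "\<dots> \<le> \<eta>2" using c2 b by linarith
      finally show ?thesis using that c(1) by (simp add: A_def abs_mult)
    qed
    have "z \<in> eucl n" using xE AE[OF xE] by (auto simp: z_def eucl_def)
    moreover have "\<bar>z k\<bar> \<le> 1" if "k < n" for k using bI[of k] IJ[of k] a that by (auto simp: z_def)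
    moreover have "\<bar>z k\<bar> \<le> a" if "k \<in> I" for k using bI[OF that] that by (simp add: z_def disj)
    ultimately have "z \<in> K2" unfolding K2_def slab_def by (auto simp: z_def)
    moreover have "near \<eta>2 (A x) z" unfolding near_def using bJ \<eta>2(1) by (auto simp: z_def)
    ultimately show False using \<eta>2(2)[of z "A x"] AE[OF xE] x p by simp
  qed
  then have CN': "C \<subseteq> N'" using N by (auto simp: N'_def)
  have "\<phi> x \<in> N'" if x: "x \<in> slab n J 0 \<inter> slab n ({..<n} - J) 1" for x
  proof (cases "\<exists>i\<in>{..<n} - J. \<bar>x i\<bar> = 1")
    case True
    then have "\<phi> x \<in> C" using bd x by blast
    then show ?thesis using CN' by blast
  next
    case False
    have xE: "x \<in> eucl n" using x by (auto simp: slab_def)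
    have "\<bar>A' x i\<bar> < (if i \<in> J then 1/2 else \<theta>)" if "i < n" for i
    proof (cases "i \<in> J")
      case True
      then show ?thesis using x by (auto simp: A'_def slab_def)
    next
      case False
      then have i: "i \<in> {..<n} - J" using that by blast
      then have "\<bar>x i\<bar> \<noteq> 1" using \<open>\<not> (\<exists>i\<in>{..<n} - J. \<bar>x i\<bar> = 1)\<close> by blast
      moreover have "\<bar>x i\<bar> \<le> 1" using x i by (simp add: slab_def)
      ultimately have "\<bar>x i\<bar> < 1" by linarith
      then show ?thesis using False a by (simp add: A'_def \<theta>_def divide_strict_right_mono)
    qed
    then have "A' x \<in> V" using AE[OF xE] by (simp add: V_def)
    moreover have "\<phi> x = \<phi>' (A' x)" using AE[OF xE] by (simp add: \<phi>'_def)
    ultimately show ?thesis by (auto simp: N'_def)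
  qed
  then have "C \<union> \<phi> ` (slab n J 0 \<inter> slab n ({..<n} - J) 1) \<subseteq> N'" using CN' by blast
  moreover have "\<exists>\<delta>>0. splits F N N' \<delta> \<epsilon>" if "\<epsilon> > 0" for \<epsilon>
  proof -
    have "\<exists>\<delta>>0. splits F N ((N - \<phi>' ` (box n 2 \<inter> slab n ({..<n} - J) 1)) \<union> \<phi>' ` (slab n J (1/2) \<inter> slab n ({..<n} - J) \<theta>)) \<delta> \<epsilon>"
      by (rule handle_splits[OF \<phi>' J \<theta>(1) N1 F' \<open>\<epsilon> > 0\<close>])
    moreover have "V \<subseteq> slab n J (1/2) \<inter> slab n ({..<n} - J) \<theta>" using J by (fastforce simp: V_def slab_def)
    then have "N' \<subseteq> (N - \<phi>' ` (box n 2 \<inter> slab n ({..<n} - J) 1)) \<union> \<phi>' ` (slab n J (1/2) \<inter> slab n ({..<n} - J) \<theta>)"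
      unfolding N'_def B_def by blast
    ultimately show ?thesis using splits_mono by blast
  qed
  ultimately show "\<exists>N'. openin X N' \<and> C \<union> \<phi> ` (slab n J 0 \<inter> slab n ({..<n} - J) 1) \<subseteq> N' \<and> (\<forall>\<epsilon>>0. \<exists>\<delta>>0. splits F N N' \<delta> \<epsilon>)"
    using oN' by blast
qed

end

section \<open>Cubical grids and fragmentation\<close>

text \<open>Cells of the cubical grid of mesh 2, indexed by their centres: odd entries of \<open>w\<close> are the
  directions of the cell, even entries the constant coordinates.\<close>

definition cell :: "nat \<Rightarrow> (nat \<Rightarrow> int) \<Rightarrow> (nat \<Rightarrow> real) set" where
  "cell n w = {x \<in> eucl n. \<forall>i<n. if even (w i) then x i = of_int (w i) else \<bar>x i - of_int (w i)\<bar> \<le> 1}"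

definition cell_interior :: "nat \<Rightarrow> (nat \<Rightarrow> int) \<Rightarrow> (nat \<Rightarrow> real) set" where
  "cell_interior n w = {x \<in> cell n w. \<forall>i<n. odd (w i) \<longrightarrow> \<bar>x i - of_int (w i)\<bar> < 1}"

definition cell_dim :: "nat \<Rightarrow> (nat \<Rightarrow> int) \<Rightarrow> nat" where
  "cell_dim n w = card {i. i < n \<and> odd (w i)}"

definition grid :: "nat \<Rightarrow> nat \<Rightarrow> (nat \<Rightarrow> int) set" where
  "grid n m = {w. (\<forall>i<n. \<bar>w i\<bar> \<le> 2 * int m) \<and> (\<forall>i\<ge>n. w i = 0)}"

lemma finite_grid: "finite (grid n m)"
proof (rule finite_subset)
  show "grid n m \<subseteq> {w. \<forall>i. (i \<in> {..<n} \<longrightarrow> w i \<in> {-2 * int m..2 * int m}) \<and> (i \<notin> {..<n} \<longrightarrow> w i = 0)}"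
    by (auto simp: grid_def abs_le_iff minus_le_iff)
qed (rule finite_set_of_finite_funs; simp)

lemma cell_subset_eucl: "cell n w \<subseteq> eucl n"
  by (auto simp: cell_def)

text \<open>In a constant coordinate \<open>y\<close> and \<open>x\<close> agree. In a direction of
  the cell, the open interval of radius 1 about an odd integer contains no even integer and meets no
  closed unit interval about another odd centre, so \<open>w'\<close> has the same entry as
  \<open>w\<close>.\<close>

lemma cell_dichotomy:
  assumes "x \<in> cell_interior n w" "x \<in> cell n w'"
  shows "cell n w \<subseteq> cell n w'"
proof
  fix y assume y: "y \<in> cell n w"
  have "if even (w' i) then y i = of_int (w' i) else \<bar>y i - of_int (w' i)\<bar> \<le> 1" if i: "i < n" for i
  proof (cases "even (w i)")
    case True
    then have "y i = x i" using y assms(1) i by (simp add: cell_def cell_interior_def)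
    then show ?thesis using assms(2) i by (simp add: cell_def)
  next
    case False
    have x: "\<bar>x i - of_int (w i)\<bar> < 1" using assms(1) i False by (simp add: cell_interior_def)
    have "w' i = w i"
    proof (cases "even (w' i)")
      case True
      then have "x i = of_int (w' i)" using assms(2) i by (simp add: cell_def)
      then show ?thesis using x by linarith
    next
      case odd: False
      then have "\<bar>x i - of_int (w' i)\<bar> \<le> 1" using assms(2) i by (simp add: cell_def)
      then have "\<bar>w i - w' i\<bar> < 2" using x by linarith
      then show ?thesis using False odd by presburger
    qed
    then show ?thesis using y i by (simp add: cell_def)
  qed
  then show "y \<in> cell n w'" using y by (simp add: cell_def)
qed

text \<open>Replacing one odd entry by the even neighbour that \<open>x\<close> touches gives a face
  of smaller dimension. It stays in the grid because an odd entry lies strictly within the even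
  bound \<open>2 m\<close>.\<close>

lemma cell_boundary:
  assumes w: "w \<in> grid n m" and x: "x \<in> cell n w" and i: "i < n" "odd (w i)" "\<bar>x i - of_int (w i)\<bar> = 1"
  obtains w' where "w' \<in> grid n m" "cell_dim n w' < cell_dim n w" "x \<in> cell n w'"
proof -
  define d :: int where "d = (if x i > of_int (w i) then 1 else -1)"
  have xi: "x i = of_int (w i + d)" using i(3) by (auto simp: d_def abs_if split: if_splits)
  define w' where "w' = w(i := w i + d)"
  have "\<bar>w i\<bar> \<le> 2 * int m" using w i by (simp add: grid_def)
  moreover have "\<bar>w i\<bar> \<noteq> 2 * int m" using i(2) by presburger
  ultimately have "\<bar>w i + d\<bar> \<le> 2 * int m" by (auto simp: d_def)
  then have "w' \<in> grid n m" using w i by (auto simp: grid_def w'_def)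
  moreover have "{k. k < n \<and> odd (w' k)} \<subset> {k. k < n \<and> odd (w k)}"
    using i by (auto simp: w'_def d_def split: if_splits)
  then have "cell_dim n w' < cell_dim n w" unfolding cell_dim_def by (intro psubset_card_mono) auto
  moreover have "x \<in> cell n w'"
    using x xi i by (auto simp: cell_def w'_def d_def)
  ultimately show ?thesis by (rule that)
qed

lemma cell_subset_slab: "w \<in> grid n m \<Longrightarrow> cell n w \<subseteq> box n (2 * real m)"
proof
  fix x assume w: "w \<in> grid n m" and x: "x \<in> cell n w"
  have "\<bar>x i\<bar> \<le> 2 * real m" if i: "i < n" for i
  proof (cases "even (w i)")
    case True
    have "\<bar>w i\<bar> \<le> 2 * int m" using w i by (simp add: grid_def)
    then have "\<bar>of_int (w i)\<bar> \<le> 2 * real m" by linarith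
    then show ?thesis using x i True by (simp add: cell_def)
  next
    case False
    have "\<bar>w i\<bar> \<le> 2 * int m" using w i by (simp add: grid_def)
    then have "\<bar>w i\<bar> \<le> 2 * int m - 1" using False by presburger
    then have "\<bar>of_int (w i)\<bar> \<le> 2 * real m - 1" by linarith
    then show ?thesis using x i False by (auto simp: cell_def dest!: spec[of _ i])
  qed
  then show "x \<in> box n (2 * real m)" using x by (simp add: cell_def slab_def)
qed

lemma slab_covered_by_cells:
  assumes "x \<in> box n (2 * real m)"
  obtains w where "w \<in> grid n m" "x \<in> cell n w"
proof -
  \<comment> \<open>At the far end \<open>x i = 2 m\<close> the general formula would give
    \<open>2 m + 1\<close>, outside the grid, so the constant entry \<open>2 m\<close> is used
    there.\<close>
  define w where "w i = (if i < n then if x i = 2 * real m then 2 * int m else 2 * \<lfloor>x i / 2\<rfloor> + 1 else 0)" for i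
  have b: "-(2 * real m) \<le> x i" "x i \<le> 2 * real m" if "i < n" for i using assms that by (auto simp: slab_def abs_le_iff minus_le_iff)
  have "\<bar>w i\<bar> \<le> 2 * int m" if i: "i < n" for i
  proof (cases "x i = 2 * real m")
    case False
    have f: "of_int \<lfloor>x i / 2\<rfloor> \<le> x i / 2" "x i / 2 < of_int \<lfloor>x i / 2\<rfloor> + 1" by linarith+
    have "real_of_int \<lfloor>x i / 2\<rfloor> < real m" using f b[OF i] False by linarith
    then have "\<lfloor>x i / 2\<rfloor> < int m" by linarith
    moreover have "- real m < real_of_int \<lfloor>x i / 2\<rfloor> + 1" using f b[OF i] by linarith
    then have "- int m \<le> \<lfloor>x i / 2\<rfloor>" by linarith
    ultimately show ?thesis using i False by (simp add: w_def)
  qed (simp add: w_def)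
  then have "w \<in> grid n m" by (simp add: grid_def w_def)
  moreover have "if even (w i) then x i = of_int (w i) else \<bar>x i - of_int (w i)\<bar> \<le> 1" if i: "i < n" for i
  proof (cases "x i = 2 * real m")
    case False
    have f: "of_int \<lfloor>x i / 2\<rfloor> \<le> x i / 2" "x i / 2 < of_int \<lfloor>x i / 2\<rfloor> + 1" by linarith+
    then show ?thesis using i False by (simp add: w_def) linarith
  qed (use i in \<open>simp add: w_def\<close>)
  then have "x \<in> cell n w" using assms by (simp add: cell_def slab_def)
  ultimately show ?thesis by (rule that)
qed

lemma compact_cell: "compact (cell n w)"
proof -
  define r where "r = (\<Sum>i<n. \<bar>real_of_int (w i)\<bar>) + 1"
  have 1: "\<bar>real_of_int (w i)\<bar> + 1 \<le> r" if "i < n" for i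
    unfolding r_def using that by (intro add_right_mono member_le_sum[where f = "\<lambda>i. \<bar>real_of_int (w i)\<bar>"]) auto
  have eq: "cell n w = box n r \<inter> (\<Inter>i\<in>{..<n}. if even (w i) then {x. x i = of_int (w i)} else {x. \<bar>x i - of_int (w i)\<bar> \<le> 1})"
  proof
    show "cell n w \<subseteq> box n r \<inter> (\<Inter>i\<in>{..<n}. if even (w i) then {x. x i = of_int (w i)} else {x. \<bar>x i - of_int (w i)\<bar> \<le> 1})"
    proof
      fix x assume x: "x \<in> cell n w"
      have "\<bar>x i\<bar> \<le> r" if "i < n" for i
      proof -
        have "\<bar>x i - of_int (w i)\<bar> \<le> 1" using x that by (cases "even (w i)") (auto simp: cell_def)
        then show ?thesis using 1[OF that] by linarith
      qed
      then show "x \<in> box n r \<inter> (\<Inter>i\<in>{..<n}. if even (w i) then {x. x i = of_int (w i)} else {x. \<bar>x i - of_int (w i)\<bar> \<le> 1})"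
        using x by (auto simp: cell_def slab_def)
    qed
  qed (auto simp: cell_def slab_def split: if_splits)
  have "closed (\<Inter>i\<in>{..<n}. if even (w i) then {x::nat\<Rightarrow>real. x i = of_int (w i)} else {x. \<bar>x i - of_int (w i)\<bar> \<le> 1})"
    by (intro closed_INT ballI) (auto intro!: closed_Collect_le closed_Collect_eq continuous_intros continuous_on_coord)
  then show ?thesis unfolding eq by (rule compact_Int_closed[OF compact_box])
qed

context embedded_compact
begin

text \<open>Translating the centre of the cell to the origin gives the situation of
  \<open>fragments_handle\<close>, the even entries being the transverse directions; the unit
  support box stays within radius \<open>2 m + 1\<close>.\<close>

lemma fragments_cell:
  assumes \<phi>: "chart X n \<phi>" and C: "closedin X C" and w: "w \<in> grid n m"
    and bd: "\<And>x i. x \<in> cell n w \<Longrightarrow> i < n \<Longrightarrow> odd (w i) \<Longrightarrow> \<bar>x i - of_int (w i)\<bar> = 1 \<Longrightarrow> \<phi> x \<in> C"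
    and int: "\<And>x. x \<in> cell_interior n w \<Longrightarrow> \<phi> x \<notin> C"
    and F: "\<And>g g'. supp_homeo n (box n (2 * real m + 1)) g g' \<Longrightarrow> transport n \<phi> g \<in> F"
  shows "fragments F C (C \<union> \<phi> ` cell n w)"
proof -
  define v where "v i = real_of_int (w i)" for i
  define A where "A x = (\<lambda>i. x i + v i)" for x :: "nat \<Rightarrow> real"
  define A' where "A' x = (\<lambda>i. x i - v i)" for x :: "nat \<Rightarrow> real"
  have v0: "v i = 0" if "n \<le> i" for i using w that by (simp add: v_def grid_def)
  have vm: "\<bar>v i\<bar> \<le> 2 * real m" if "i < n" for i
  proof -
    have "\<bar>w i\<bar> \<le> 2 * int m" using w that by (simp add: grid_def)
    then show ?thesis unfolding v_def by linarith
  qed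
  have AE: "A x \<in> eucl n \<and> A' x \<in> eucl n \<and> A (A' x) = x \<and> A' (A x) = x" if "x \<in> eucl n" for x
    using that v0 by (auto simp: A_def A'_def eucl_def)
  have cA: "continuous_on S A" "continuous_on S A'" for S
    unfolding A_def A'_def
    by (intro continuous_on_coordinatewise_then_product continuous_intros continuous_on_coord)+
  define J where "J = {i. i < n \<and> even (w i)}"
  have J: "J \<subseteq> {..<n}" by (auto simp: J_def)
  define \<phi>' where "\<phi>' x = \<phi> (A x)" for x
  have \<phi>': "chart X n \<phi>'" unfolding \<phi>'_def using chart_comp(1)[OF \<phi> cA AE] .
  have cellA: "A x \<in> cell n w \<longleftrightarrow> x \<in> slab n J 0 \<and> x \<in> slab n ({..<n} - J) 1" if "x \<in> eucl n" for x
    using AE[OF that] that by (auto simp: cell_def slab_def A_def J_def v_def)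
  have im: "\<phi>' ` (slab n J 0 \<inter> slab n ({..<n} - J) 1) = \<phi> ` cell n w"
  proof
    show "\<phi>' ` (slab n J 0 \<inter> slab n ({..<n} - J) 1) \<subseteq> \<phi> ` cell n w"
    proof
      fix p assume "p \<in> \<phi>' ` (slab n J 0 \<inter> slab n ({..<n} - J) 1)"
      then obtain x where x: "x \<in> slab n J 0" "x \<in> slab n ({..<n} - J) 1" "p = \<phi> (A x)" by (auto simp: \<phi>'_def)
      then have "A x \<in> cell n w" using cellA[of x] by (simp add: slab_def)
      then show "p \<in> \<phi> ` cell n w" using x by blast
    qed
    show "\<phi> ` cell n w \<subseteq> \<phi>' ` (slab n J 0 \<inter> slab n ({..<n} - J) 1)"
    proof
      fix p assume "p \<in> \<phi> ` cell n w"
      then obtain y where y: "y \<in> cell n w" "p = \<phi> y" by blast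
      then have "y \<in> eucl n" using cell_subset_eucl by blast
      then have "A' y \<in> slab n J 0 \<inter> slab n ({..<n} - J) 1" "p = \<phi>' (A' y)"
        using y cellA[of "A' y"] AE[of y] by (auto simp: \<phi>'_def)
      then show "p \<in> \<phi>' ` (slab n J 0 \<inter> slab n ({..<n} - J) 1)" by blast
    qed
  qed
  have "fragments F C (C \<union> \<phi>' ` (slab n J 0 \<inter> slab n ({..<n} - J) 1))"
  proof (rule fragments_handle[OF \<phi>' J C])
    show "\<phi>' x \<in> C" if "x \<in> slab n J 0" "x \<in> slab n ({..<n} - J) 1" "i \<in> {..<n} - J" "\<bar>x i\<bar> = 1" for x i
      unfolding \<phi>'_def using that cellA[of x] by (intro bd[of _ i]) (auto simp: slab_def J_def A_def v_def)
    show "\<phi>' x \<notin> C" if "x \<in> slab n J 0" "\<forall>i\<in>{..<n} - J. \<bar>x i\<bar> < 1" for x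
    proof -
      have "x \<in> eucl n" "x \<in> slab n ({..<n} - J) 1" using that by (force simp: slab_def)+
      then have "A x \<in> cell_interior n w"
        using that cellA[of x] by (auto simp: cell_interior_def J_def A_def v_def)
      then show ?thesis unfolding \<phi>'_def by (rule int)
    qed
    show "transport n \<phi>' g \<in> F" if g: "supp_homeo n (box n 1) g g'" for g g'
    proof -
      have gE: "g x \<in> eucl n" if "x \<in> eucl n" for x
        using g that by (auto simp: supp_homeo_def)
      have supp: "x \<in> box n (2 * real m + 1)" if x: "x \<in> eucl n" "A' x \<in> box n 1" for x
      proof -
        have "\<bar>x i\<bar> \<le> 2 * real m + 1" if "i < n" for i
        proof -
          have "\<bar>x i - v i\<bar> \<le> 1" using x that by (simp add: slab_def A'_def)
          then show ?thesis using vm[OF that] by linarith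
        qed
        then show ?thesis using x by (simp add: slab_def)
      qed
      have "supp_homeo n (box n (2 * real m + 1)) (\<lambda>x. A (g (A' x))) (\<lambda>x. A (g' (A' x)))"
        by (rule supp_homeo_conj[OF g cA AE supp])
      then have "transport n \<phi> (\<lambda>x. A (g (A' x))) \<in> F" by (rule F)
      moreover have "transport n \<phi>' g = transport n \<phi> (\<lambda>x. A (g (A' x)))"
        using transport_chart_comp[OF \<phi> AE \<phi>'[unfolded \<phi>'_def] gE] unfolding \<phi>'_def .
      ultimately show ?thesis by simp
    qed
  qed
  then show ?thesis unfolding im .
qed

text \<open>Cells are added by increasing dimension, so the boundary of each is already covered. A
  cell that is covered itself is skipped; otherwise \<open>cell_dichotomy\<close> keeps its interior
  off the cells added so far, and \<open>cells\<close> keeps it off \<open>C\<close>.\<close>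

lemma fragments_grid:
  assumes \<phi>: "chart X n \<phi>" and C: "closedin X C"
    and cells: "\<And>w. w \<in> grid n m \<Longrightarrow> \<phi> ` cell n w \<subseteq> C \<or> \<phi> ` cell_interior n w \<inter> C = {}"
    and F: "\<And>g g'. supp_homeo n (box n (2 * real m + 1)) g g' \<Longrightarrow> transport n \<phi> g \<in> F"
    and Fid: "id \<in> F" and Fcomp: "\<And>f g. f \<in> F \<Longrightarrow> g \<in> F \<Longrightarrow> f \<circ> g \<in> F"
  shows "fragments F C (C \<union> \<phi> ` box n (2 * real m))"
proof -
  define U where "U S = C \<union> (\<Union>w\<in>S. \<phi> ` cell n w)" for S
  have cl: "closedin X (U S)" if "S \<subseteq> grid n m" for S
  proof -
    have "finite S" using that finite_grid finite_subset by blast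
    moreover have "closedin X (\<phi> ` cell n w)" for w
      using chart_compact[OF \<phi> compact_cell cell_subset_eucl] closedin_compact by blast
    ultimately show ?thesis unfolding U_def using C by (intro closedin_Un closedin_Union) auto
  qed
  have add: "fragments F (U S) (U (insert w S))"
    if S: "S \<subseteq> grid n m" "w \<in> grid n m" "\<And>w'. w' \<in> grid n m \<Longrightarrow> cell_dim n w' < cell_dim n w \<Longrightarrow> w' \<in> S" for S w
  proof (cases "\<phi> ` cell n w \<subseteq> U S")
    case True
    then show ?thesis by (intro fragments_refl Fid) (auto simp: U_def)
  next
    case False
    have "fragments F (U S) (U S \<union> \<phi> ` cell n w)"
    proof (rule fragments_cell[OF \<phi> cl[OF S(1)] S(2) _ _ F])
      show "\<phi> x \<in> U S" if b: "x \<in> cell n w" "i < n" "odd (w i)" "\<bar>x i - of_int (w i)\<bar> = 1" for x i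
      proof -
        obtain w' where w': "w' \<in> grid n m" "cell_dim n w' < cell_dim n w" "x \<in> cell n w'"
          by (rule cell_boundary[OF S(2) b])
        then have "w' \<in> S" using S(3) by blast
        then show ?thesis using w'(3) unfolding U_def by blast
      qed
      show "\<phi> x \<notin> U S" if x: "x \<in> cell_interior n w" for x
      proof
        assume "\<phi> x \<in> U S"
        then consider "\<phi> x \<in> C" | w' where "w' \<in> S" "\<phi> x \<in> \<phi> ` cell n w'" unfolding U_def by blast
        then show False
        proof cases
          case 1
          then show False using cells[OF S(2)] x False unfolding U_def by blast
        next
          case 2
          have "x \<in> eucl n" using x by (simp add: cell_interior_def cell_def)
          then have "x \<in> cell n w'"
            using 2(2) inj_on_image_mem_iff[OF chart_inj[OF \<phi>] _ cell_subset_eucl] by blast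
          then have "cell n w \<subseteq> cell n w'" using cell_dichotomy x by blast
          then show False using False 2(1) unfolding U_def by blast
        qed
      qed
    qed
    moreover have "U S \<union> \<phi> ` cell n w = U (insert w S)" by (auto simp: U_def)
    ultimately show ?thesis by simp
  qed
  have lvl: "fragments F (U {w \<in> grid n m. cell_dim n w < k}) (U ({w \<in> grid n m. cell_dim n w < k} \<union> T))"
    if "finite T" "T \<subseteq> {w \<in> grid n m. cell_dim n w = k}" for k T
    using that
  proof (induction T)
    case empty
    then show ?case by (simp add: fragments_refl Fid)
  next
    case (insert w T)
    let ?S = "{w \<in> grid n m. cell_dim n w < k} \<union> T"
    have 1: "fragments F (U ?S) (U (insert w ?S))"
      using insert.prems by (intro add) auto
    have 2: "fragments F (U {w \<in> grid n m. cell_dim n w < k}) (U ?S)" using insert by simp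
    from fragments_trans[OF Fcomp 2 1] show ?case by simp
  qed
  have "fragments F C (U {w \<in> grid n m. cell_dim n w < k})" for k
  proof (induction k)
    case 0
    then show ?case by (simp add: U_def fragments_refl Fid)
  next
    case (Suc k)
    have "{w \<in> grid n m. cell_dim n w < Suc k} = {w \<in> grid n m. cell_dim n w < k} \<union> {w \<in> grid n m. cell_dim n w = k}"
      by auto
    moreover have "finite {w \<in> grid n m. cell_dim n w = k}" using finite_grid by simp
    ultimately show ?case using fragments_trans[OF Fcomp Suc lvl] by simp
  qed
  from this[of "Suc n"] have "fragments F C (U {w \<in> grid n m. cell_dim n w < Suc n})" .
  moreover have "cell_dim n w \<le> n" for w
  proof -
    have "card {i. i < n \<and> odd (w i)} \<le> card {..<n}" by (intro card_mono) auto
    then show ?thesis by (simp add: cell_dim_def)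
  qed
  then have "{w \<in> grid n m. cell_dim n w < Suc n} = grid n m" by (auto simp: less_Suc_eq_le)
  moreover have "\<phi> ` box n (2 * real m) \<subseteq> U (grid n m)"
  proof
    fix p assume "p \<in> \<phi> ` box n (2 * real m)"
    then obtain x where x: "x \<in> box n (2 * real m)" "p = \<phi> x" by blast
    obtain w where "w \<in> grid n m" "x \<in> cell n w" by (rule slab_covered_by_cells[OF x(1)])
    then show "p \<in> U (grid n m)" using x(2) unfolding U_def by blast
  qed
  ultimately have "fragments F C (U (grid n m))" "C \<union> \<phi> ` box n (2 * real m) \<subseteq> U (grid n m)"
    by (simp_all add: U_def)
  then show ?thesis using fragments_mono by blast
qed

text \<open>An arbitrary closed \<open>C\<close> may cut through cells. The grid is made so fine
  that every cell meeting \<open>C\<close> lies in \<open>N\<close>; these cells are added to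
  \<open>C\<close>, and the enlarged set \<open>C1\<close> is still inside \<open>N\<close> and
  satisfies the hypothesis of \<open>fragments_grid\<close>.\<close>

lemma fragments_box:
  assumes \<psi>: "chart X n \<psi>" and C: "closedin X C"
    and F: "\<And>g g'. supp_homeo n (box n 1) g g' \<Longrightarrow> transport n \<psi> g \<in> F"
    and Fid: "id \<in> F" and Fcomp: "\<And>f g. f \<in> F \<Longrightarrow> g \<in> F \<Longrightarrow> f \<circ> g \<in> F"
  shows "fragments F C (C \<union> \<psi> ` box n (1/3))"
  unfolding fragments_def
proof (intro allI impI, elim conjE)
  fix N assume N: "openin X N" "C \<subseteq> N"
  define K where "K = box n (1/3) \<inter> {x \<in> eucl n. \<psi> x \<in> C}"
  have "closedin (top_of_set (eucl n)) {x \<in> eucl n. \<psi> x \<in> C}"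
    using closedin_continuous_map_preimage[OF chart_cont[OF \<psi>] C] by simp
  then have "closed {x \<in> eucl n. \<psi> x \<in> C}" using closed_eucl closedin_closed_trans by blast
  then have K: "compact K" unfolding K_def by (rule compact_Int_closed[OF compact_box])
  have KN: "K \<subseteq> {x \<in> eucl n. \<psi> x \<in> N}" using N by (auto simp: K_def)
  obtain \<eta> where \<eta>: "\<eta> > 0" "\<And>x y. x \<in> K \<Longrightarrow> y \<in> eucl n \<Longrightarrow> near \<eta> y x \<Longrightarrow> y \<in> {x \<in> eucl n. \<psi> x \<in> N}"
    using compact_near_subset[OF K KN openin_chart_preimage[OF \<psi> N(1)]] by blast
  obtain m where m: "1 / (3 * \<eta>) < real m" using reals_Archimedean2 by blast
  have m0: "0 < real m" using m \<eta>(1) by (smt (verit) zero_le_divide_1_iff)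
  then have m1: "1 \<le> real m" by simp
  \<comment> \<open>This scale takes radius 1/3 to \<open>2 m\<close>, and brings supports of radius
    \<open>2 m + 1\<close> back into the unit box because \<open>1 \<le> m\<close>. Cells then have
    side \<open>2 / s\<close>.\<close>
  define s where "s = 6 * real m"
  have s: "0 < s" "6 \<le> s" using m1 by (auto simp: s_def)
  have s\<eta>: "2 / s \<le> \<eta>"
  proof -
    have "1 < real m * (3 * \<eta>)" using m \<eta>(1) by (simp add: divide_less_eq)
    then show ?thesis using s by (simp add: s_def divide_le_eq algebra_simps)
  qed
  define A where "A x = (\<lambda>i. x i / s)" for x :: "nat \<Rightarrow> real"
  define A' where "A' x = (\<lambda>i. x i * s)" for x :: "nat \<Rightarrow> real"
  have AE: "A x \<in> eucl n \<and> A' x \<in> eucl n \<and> A (A' x) = x \<and> A' (A x) = x" if "x \<in> eucl n" for x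
    using that s by (auto simp: A_def A'_def eucl_def)
  have cA: "continuous_on S A" "continuous_on S A'" for S
    unfolding A_def A'_def using s
    by (intro continuous_on_coordinatewise_then_product continuous_intros continuous_on_coord; simp)+
  define \<phi> where "\<phi> x = \<psi> (A x)" for x
  have \<phi>: "chart X n \<phi>" unfolding \<phi>_def using chart_comp(1)[OF \<psi> cA AE] .
  have F': "transport n \<phi> g \<in> F" if g: "supp_homeo n (box n (2 * real m + 1)) g g'" for g g'
  proof -
    have supp: "x \<in> box n 1" if x: "x \<in> eucl n" "A' x \<in> box n (2 * real m + 1)" for x
    proof -
      have "\<bar>x i\<bar> \<le> 1" if "i < n" for i
      proof -
        have "\<bar>x i * s\<bar> \<le> 2 * real m + 1" using x that by (simp add: slab_def A'_def)
        moreover have "\<bar>x i * s\<bar> = \<bar>x i\<bar> * s" using s(1) by (simp add: abs_mult)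
        ultimately have "\<bar>x i\<bar> * s \<le> 1 * s" using m1 unfolding s_def by linarith
        then show ?thesis using s(1) by (rule mult_right_le_imp_le)
      qed
      then show ?thesis using x by (simp add: slab_def)
    qed
    have gE: "g x \<in> eucl n" if "x \<in> eucl n" for x
      using g that by (auto simp: supp_homeo_def)
    have "supp_homeo n (box n 1) (\<lambda>x. A (g (A' x))) (\<lambda>x. A (g' (A' x)))"
      by (rule supp_homeo_conj[OF g cA AE supp])
    then have "transport n \<psi> (\<lambda>x. A (g (A' x))) \<in> F" by (rule F)
    moreover have "transport n \<phi> g = transport n \<psi> (\<lambda>x. A (g (A' x)))"
      using transport_chart_comp[OF \<psi> AE \<phi>[unfolded \<phi>_def] gE] unfolding \<phi>_def .
    ultimately show ?thesis by simp
  qed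
  define W where "W = {w \<in> grid n m. \<phi> ` cell n w \<inter> C \<noteq> {}}"
  define C1 where "C1 = C \<union> (\<Union>w\<in>W. \<phi> ` cell n w)"
  have slabs: "A x \<in> box n (1/3) \<longleftrightarrow> x \<in> box n (2 * real m)" if "x \<in> eucl n" for x
    using that AE[OF that] m0 by (auto simp: slab_def A_def s_def divide_le_eq)
  have "\<phi> x \<in> N" if w: "w \<in> W" "x \<in> cell n w" for w x
  proof -
    obtain y where y: "y \<in> cell n w" "\<phi> y \<in> C" using w by (auto simp: W_def)
    have E: "x \<in> eucl n" "y \<in> eucl n" using w y cell_subset_eucl by blast+
    have "y \<in> box n (2 * real m)" using cell_subset_slab w y by (auto simp: W_def)
    then have yK: "A y \<in> K" using slabs[OF E(2)] y AE[OF E(2)] by (simp add: K_def \<phi>_def)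
    have "\<bar>A x i - A y i\<bar> \<le> \<eta>" for i
    proof (cases "i < n")
      case True
      have "\<bar>x i - of_int (w i)\<bar> \<le> 1" "\<bar>y i - of_int (w i)\<bar> \<le> 1"
        using w y True by (cases "even (w i)"; auto simp: cell_def)+
      then have "\<bar>x i - y i\<bar> \<le> 2" by linarith
      moreover have "A x i - A y i = (x i - y i) / s" by (simp add: A_def diff_divide_distrib)
      ultimately have "\<bar>A x i - A y i\<bar> \<le> 2 / s" using s by (simp add: divide_right_mono)
      then show ?thesis using s\<eta> by linarith
    next
      case False
      then show ?thesis using E \<eta>(1) by (simp add: A_def eucl_def)
    qed
    then have "near \<eta> (A x) (A y)" by (simp add: near_def)
    then show ?thesis using \<eta>(2)[OF yK] AE[OF E(1)] by (simp add: \<phi>_def)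
  qed
  then have C1N: "C1 \<subseteq> N" using N by (auto simp: C1_def)
  have "finite W" using finite_grid by (simp add: W_def)
  moreover have "closedin X (\<phi> ` cell n w)" for w
    using chart_compact[OF \<phi> compact_cell cell_subset_eucl] closedin_compact by blast
  ultimately have C1: "closedin X C1" unfolding C1_def using C by (intro closedin_Un closedin_Union) auto
  have cells: "\<phi> ` cell n w \<subseteq> C1 \<or> \<phi> ` cell_interior n w \<inter> C1 = {}" if w: "w \<in> grid n m" for w
  proof (rule disjCI)
    assume "\<phi> ` cell_interior n w \<inter> C1 \<noteq> {}"
    then obtain x where x: "x \<in> cell_interior n w" "\<phi> x \<in> C1" by blast
    then have xw: "x \<in> cell n w" "x \<in> eucl n" by (auto simp: cell_interior_def cell_def)
    from x(2) consider "\<phi> x \<in> C" | w' where "w' \<in> W" "\<phi> x \<in> \<phi> ` cell n w'" unfolding C1_def by blast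
    then show "\<phi> ` cell n w \<subseteq> C1"
    proof cases
      case 1
      then have "w \<in> W" using w xw by (auto simp: W_def)
      then show ?thesis by (auto simp: C1_def)
    next
      case 2
      have "x \<in> cell n w'"
        using 2(2) inj_on_image_mem_iff[OF chart_inj[OF \<phi>] xw(2) cell_subset_eucl] by blast
      then have "cell n w \<subseteq> cell n w'" using cell_dichotomy x by blast
      then show ?thesis using 2(1) unfolding C1_def by blast
    qed
  qed
  have "fragments F C1 (C1 \<union> \<phi> ` box n (2 * real m))"
    by (rule fragments_grid[OF \<phi> C1 cells F' Fid Fcomp])
  from fragD[OF this N(1) C1N] obtain N' where N': "openin X N'" "C1 \<union> \<phi> ` box n (2 * real m) \<subseteq> N'" "\<forall>\<epsilon>>0. \<exists>\<delta>>0. splits F N N' \<delta> \<epsilon>"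
    by blast
  have "\<psi> ` box n (1/3) \<subseteq> \<phi> ` box n (2 * real m)"
  proof
    fix p assume "p \<in> \<psi> ` box n (1/3)"
    then obtain x where x: "x \<in> box n (1/3)" "p = \<psi> x" by blast
    then have "x \<in> eucl n" by (simp add: slab_def)
    then show "p \<in> \<phi> ` box n (2 * real m)"
      using AE[of x] slabs[of "A' x"] x by (intro image_eqI[of _ _ "A' x"]) (auto simp: \<phi>_def)
  qed
  then have "C \<union> \<psi> ` box n (1/3) \<subseteq> N'" using N'(2) unfolding C1_def by blast
  then show "\<exists>N'. openin X N' \<and> C \<union> \<psi> ` box n (1/3) \<subseteq> N' \<and> (\<forall>\<epsilon>>0. \<exists>\<delta>>0. splits F N N' \<delta> \<epsilon>)"
    using N' by blast
qed

text \<open>Peeling starts from the empty set, relative to which every homeomorphism qualifies, and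
  ends with a remainder that fixes all of \<open>X\<close>.\<close>

proposition fragmentation:
  assumes "finite \<Phi>" and \<Phi>: "\<And>\<phi>. \<phi> \<in> \<Phi> \<Longrightarrow> chart X n \<phi>" "topspace X = (\<Union>\<phi>\<in>\<Phi>. \<phi> ` box n (1/3))"
    and F: "\<And>\<phi> g g'. \<phi> \<in> \<Phi> \<Longrightarrow> supp_homeo n (box n 1) g g' \<Longrightarrow> transport n \<phi> g \<in> F"
    and Fid: "id \<in> F" and Fcomp: "\<And>f g. f \<in> F \<Longrightarrow> g \<in> F \<Longrightarrow> f \<circ> g \<in> F"
  shows "\<exists>\<delta>>0. \<forall>h\<in>Homeo X. near_id \<delta> h \<longrightarrow> h \<in> F"
proof -
  have "fragments F {} (\<Union>\<phi>\<in>\<Psi>. \<phi> ` box n (1/3)) \<and> closedin X (\<Union>\<phi>\<in>\<Psi>. \<phi> ` box n (1/3))"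
    if "finite \<Psi>" "\<Psi> \<subseteq> \<Phi>" for \<Psi>
    using that
  proof (induction \<Psi>)
    case empty
    then show ?case by (simp add: fragments_refl Fid)
  next
    case (insert \<phi> \<Psi>)
    let ?C = "\<Union>\<phi>\<in>\<Psi>. \<phi> ` box n (1/3)"
    have \<phi>: "chart X n \<phi>" "\<phi> \<in> \<Phi>" using insert \<Phi> by auto
    have IH: "fragments F {} ?C" "closedin X ?C" using insert by auto
    have cl: "closedin X (\<phi> ` box n (1/3))"
      using chart_compact[OF \<phi>(1) compact_box box_subset] closedin_compact by blast
    have fr: "fragments F ?C (?C \<union> \<phi> ` box n (1/3))"
      by (rule fragments_box[OF \<phi>(1) IH(2) F[OF \<phi>(2)] Fid Fcomp])
    have eq: "(\<Union>\<phi>\<in>insert \<phi> \<Psi>. \<phi> ` box n (1/3)) = ?C \<union> \<phi> ` box n (1/3)" by auto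
    show ?case unfolding eq using fragments_trans[OF Fcomp IH(1) fr] closedin_Un[OF IH(2) cl] by blast
  qed
  then have "fragments F {} (topspace X)" using assms(1) \<Phi>(2) by auto
  then obtain N' where N': "topspace X \<subseteq> N'" "\<forall>\<epsilon>>0. \<exists>\<delta>>0. splits F {} N' \<delta> \<epsilon>"
    using fragD[of F "{}" "topspace X" "{}"] by auto
  then obtain \<delta> where \<delta>: "\<delta> > 0" "splits F {} N' \<delta> 1" by (meson zero_less_one)
  have "h \<in> F" if h: "h \<in> Homeo X" "near_id \<delta> h" for h
  proof -
    obtain g k where g: "g \<in> F" "k \<in> Homeo X" "h = g \<circ> k" "\<forall>p\<in>N'. k p = p"
      using \<delta>(2) h unfolding splits_def by blast
    have "k p = p" for p using g(2,4) N'(1) Homeo_outside by (cases "p \<in> topspace X") auto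
    then have "h = g" using g(3) by (simp add: fun_eq_iff)
    then show ?thesis using g(1) by simp
  qed
  then show ?thesis using \<delta>(1) by blast
qed

end

section \<open>Swindles in a chart\<close>

lemma notin_slab: "i < n \<Longrightarrow> r < \<bar>x i\<bar> \<Longrightarrow> x \<notin> box n r"
  by (force simp: slab_def not_le)

lemma supp_homeo_preserves: "supp_homeo n K g g' \<Longrightarrow> x \<in> eucl n \<Longrightarrow> x \<in> K \<Longrightarrow> g x \<in> K"
  unfolding supp_homeo_def by metis

lemma supp_homeoD:
  assumes "supp_homeo n K g g'" "x \<in> eucl n"
  shows "g x \<in> eucl n" "g' x \<in> eucl n" "g' (g x) = x" "g (g' x) = x" "x \<notin> K \<Longrightarrow> g x = x" "x \<notin> K \<Longrightarrow> g' x = x"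
  using assms by (auto simp: supp_homeo_def)

lemma supp_homeo_id: "supp_homeo n K (\<lambda>x. x) (\<lambda>x. x)"
  by (simp add: supp_homeo_def)

lemma supp_homeo_near:
  assumes g: "supp_homeo n (box n r) g g'" and x: "x \<in> eucl n" and r: "0 \<le> r"
  shows "near (2 * r) (g x) x"
proof (cases "x \<in> box n r")
  case True
  then have "g x \<in> box n r" using supp_homeo_preserves[OF g x] by blast
  then have "\<bar>g x i - x i\<bar> \<le> 2 * r" for i
    using True r by (cases "i < n") (force simp: slab_def eucl_def)+
  then show ?thesis by (simp add: near_def)
qed (use supp_homeoD[OF g x] r in simp)

text \<open>Blocks of width \<open>4 r\<close> centred at the multiples of \<open>4 r\<close> leave
  a margin \<open>r\<close> beside every support. Neighbouring formulas are therefore the identity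
  on the collars, each block is mapped to itself, and the inverse is glued from the
  inverses.\<close>

lemma near_homeo_glue_blocks:
  assumes j: "j < n" and r: "0 < r" and K: "\<And>k. supp_homeo n (box n r) (K k) (K' k)"
  shows "near_homeo n {} s (2 * r) (glue_blocks j (4 * r) (-2 * r) K) (glue_blocks j (4 * r) (-2 * r) K')"
proof -
  have half: "continuous_on (eucl n) (glue_blocks j (4 * r) (-2 * r) K) \<and>
      (\<forall>x\<in>eucl n. glue_blocks j (4 * r) (-2 * r) K x \<in> eucl n \<and> near (2 * r) (glue_blocks j (4 * r) (-2 * r) K x) x \<and>
         glue_blocks j (4 * r) (-2 * r) K' (glue_blocks j (4 * r) (-2 * r) K x) = x)"
    if all: "\<forall>k. supp_homeo n (box n r) (K k) (K' k)" for K K'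
  proof (intro conjI ballI)
    have K: "supp_homeo n (box n r) (K k) (K' k)" for k using all by blast
    have Ed: "on_coord j (\<lambda>t. t + a) y \<in> eucl n" if "y \<in> eucl n" for y a by (rule on_coord_in_eucl[OF j that])
    have off: "K k y = y" if "y \<in> eucl n" "\<bar>y j\<bar> > r" for k y
      using supp_homeoD(5)[OF K that(1) notin_slab[where x = y, OF j that(2)]] .
    show "continuous_on (eucl n) (glue_blocks j (4 * r) (-2 * r) K)"
    proof (rule continuous_on_glue_blocks[where \<eta> = "r / 2"])
      show "K m y = on_coord j (\<lambda>t. t - 4 * r) (K (m - 1) (on_coord j (\<lambda>t. t + 4 * r) y))"
        if "y \<in> eucl n" "- 2 * r - r / 2 \<le> y j" "y j \<le> - 2 * r" for m y
      proof -
        have "K m y = y" using that r by (intro off) auto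
        moreover have "K (m - 1) (on_coord j (\<lambda>t. t + 4 * r) y) = on_coord j (\<lambda>t. t + 4 * r) y"
          using that r by (intro off Ed) (auto simp: on_coord_def)
        ultimately show ?thesis by (simp add: on_coord_on_coord on_coord_id)
      qed
      show "continuous_on {y \<in> eucl n. - 2 * r - r / 2 \<le> y j \<and> y j \<le> - 2 * r + 4 * r} (K m)" for m
        using K[of m] by (auto simp: supp_homeo_def intro: continuous_on_subset)
    qed (use r Ed in auto)
    fix x assume x: "x \<in> eucl n"
    have Kn: "near (2 * r) (K m y) y" if "y \<in> eucl n" for m y
      using supp_homeo_near[OF K that] r by simp
    show "near (2 * r) (glue_blocks j (4 * r) (-2 * r) K x) x"
      by (rule glue_blocks_near[where D = "eucl n"]) (use r Kn Ed x in auto)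
    define m where "m = \<lfloor>(x j - (-2 * r)) / (4 * r)\<rfloor>"
    define y where "y = on_coord j (\<lambda>t. t - 4 * r * of_int m) x"
    have yE: "y \<in> eucl n" unfolding y_def by (rule on_coord_in_eucl[OF j x])
    have gx: "glue_blocks j (4 * r) (-2 * r) K x = on_coord j (\<lambda>t. t + 4 * r * of_int m) (K m y)"
      by (simp add: glue_blocks_def Let_def m_def y_def)
    then show "glue_blocks j (4 * r) (-2 * r) K x \<in> eucl n"
      using supp_homeoD(1)[OF K yE] on_coord_in_eucl[OF j] by simp
    have p: "0 < 4 * r" using r by simp
    have "of_int m \<le> (x j - (-2 * r)) / (4 * r)" "(x j - (-2 * r)) / (4 * r) < of_int m + 1"
      unfolding m_def by linarith+
    then have "4 * r * of_int m \<le> x j - (-2 * r)" "x j - (-2 * r) < 4 * r * of_int m + 4 * r"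
      unfolding pos_le_divide_eq[OF p] pos_divide_less_eq[OF p] by (simp_all add: algebra_simps)
    then have yj: "-2 * r \<le> y j" "y j < 2 * r" by (auto simp: y_def on_coord_def)
    have "-2 * r \<le> K m y j \<and> K m y j < 2 * r"
    proof (cases "y \<in> box n r")
      case True
      then have "\<bar>K m y j\<bar> \<le> r" using supp_homeo_preserves[OF K yE] j by (auto simp: slab_def)
      then show ?thesis using r by linarith
    qed (use supp_homeoD(5)[OF K yE] yj in simp)
    then have "\<lfloor>(on_coord j (\<lambda>t. t + 4 * r * of_int m) (K m y) j - (-2 * r)) / (4 * r)\<rfloor> = m"
      using p by (intro floor_unique) (auto simp: on_coord_def pos_le_divide_eq pos_divide_less_eq algebra_simps)
    then show "glue_blocks j (4 * r) (-2 * r) K' (glue_blocks j (4 * r) (-2 * r) K x) = x"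
      unfolding gx using supp_homeoD(3)[OF K yE] by (simp add: glue_blocks_def Let_def on_coord_on_coord on_coord_id y_def)
  qed
  show ?thesis
    unfolding near_homeo_def slab_empty
    using half[of K K'] half[of K' K] K supp_homeo_sym[OF K] by blast
qed

lemma glue_blocks_in_block:
  assumes "0 < p" "c + p * of_int m \<le> x j" "x j < c + p + p * of_int m"
  shows "glue_blocks j p c K x = on_coord j (\<lambda>t. t + p * of_int m) (K m (on_coord j (\<lambda>t. t - p * of_int m) x))"
proof -
  have "\<lfloor>(x j - c) / p\<rfloor> = m"
    using assms by (intro floor_unique) (auto simp: field_simps)
  then show ?thesis by (simp add: glue_blocks_def)
qed

lemma in_some_block:
  assumes "0 < (p::real)"
  obtains m :: int where "c + p * of_int m \<le> t" "t < c + p + p * of_int m"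
proof -
  have "of_int \<lfloor>(t - c) / p\<rfloor> \<le> (t - c) / p" "(t - c) / p < of_int \<lfloor>(t - c) / p\<rfloor> + 1" by linarith+
  then have "p * of_int \<lfloor>(t - c) / p\<rfloor> \<le> t - c" "t - c < p * of_int \<lfloor>(t - c) / p\<rfloor> + p"
    unfolding pos_le_divide_eq[OF assms] pos_divide_less_eq[OF assms] by (simp_all add: algebra_simps)
  then show ?thesis by (intro that[of "\<lfloor>(t - c) / p\<rfloor>"]) linarith+
qed

lemma near_homeo_shift: "j < n \<Longrightarrow> near_homeo n {} s \<bar>a\<bar> (on_coord j (\<lambda>t. t + a)) (on_coord j (\<lambda>t. t - a))"
  unfolding near_homeo_def slab_empty
  by (auto intro!: on_coord_in_eucl continuous_on_on_coord[OF continuous_on_id continuous_on_shift(1), unfolded id_def]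
      continuous_on_on_coord[OF continuous_on_id continuous_on_shift(2), unfolded id_def] simp: on_coord_on_coord on_coord_id)
    (auto simp: near_def on_coord_def)

lemma supp_homeo_squeeze:
  assumes "near_homeo n {} s D H H'" "0 \<le> D"
  shows "supp_homeo n (box n 2) (squeeze n H) (squeeze n H')"
proof (rule supp_homeo_of_near[OF near_homeo_squeeze[OF assms, of s]])
  fix x assume x: "x \<in> eucl n" "x \<notin> box n 2"
  then obtain i where "i < n" "\<bar>x i\<bar> > 2" by (auto simp: slab_def)
  then have "\<not> max_norm n x < 2" using coord_le_max_norm[OF x(1), of i] by linarith
  then show "squeeze n H x = x" by (rule squeeze_outside)
qed

text \<open>A map supported in the unit box commutes with the contraction, which fixes that box
  pointwise. Squeezing the infinite products thus leaves the encoded maps unchanged.\<close>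

lemma squeeze_supp:
  assumes b: "supp_homeo n (box n 1) b b'" and y: "y \<in> eucl n"
  shows "squeeze n b y = b y"
proof (cases "y \<in> box n 1")
  case True
  then have "b y \<in> box n 1" using supp_homeo_preserves[OF b y] by blast
  then have "max_norm n y \<le> 1" "max_norm n (b y) \<le> 1" using True by (auto simp: max_norm_le_iff slab_def)
  then have "max_norm n y = 1" "max_norm n (b y) = 1" using max_norm_ge_1 by (auto intro: antisym)
  then show ?thesis by (rule squeeze_core)
next
  case False
  have "squeeze n b y = y"
  proof (cases "max_norm n y < 2")
    case True
    obtain i where i: "i < n" "\<bar>y i\<bar> > 1" using False y by (auto simp: slab_def)
    have "2 - max_norm n y < \<bar>y i\<bar>" using max_norm_ge_1[of n y] i by linarith
    then have "\<bar>unshrink n y i\<bar> > 1" using True by (simp add: unshrink_def less_divide_eq)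
    then have "unshrink n y \<notin> box n 1" by (rule notin_slab[where x = "unshrink n y", OF i(1)])
    then show ?thesis using supp_homeoD(5)[OF b unshrink_in_eucl[OF y]] by (intro squeeze_fixed)
  qed (rule squeeze_outside)
  then show ?thesis using supp_homeoD(5)[OF b y False] by simp
qed

text \<open>The swindle: \<open>c\<close> is the infinite product of the translates \<open>T\<^sup>k b T\<^sup>-\<^sup>k\<close> with \<open>k \<ge> 0\<close>.\<close>

lemma swindle:
  assumes j: "j < n" and b: "supp_homeo n (box n 1) b b'"
  shows "\<exists>c c'. near_homeo n {} 0 2 c c' \<and>
    (\<forall>y\<in>eucl n. c (on_coord j (\<lambda>t. t + 4) (c' (on_coord j (\<lambda>t. t - 4) y))) = b y)"
proof -
  define T where "T = on_coord j (\<lambda>t. t + 4)"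
  define T' where "T' = on_coord j (\<lambda>t. t - 4)"
  define K where "K k = (if k \<ge> (0::int) then b else (\<lambda>x. x))" for k
  define K' where "K' k = (if k \<ge> (0::int) then b' else (\<lambda>x. x))" for k
  define c where "c = glue_blocks j 4 (-2) K"
  define c' where "c' = glue_blocks j 4 (-2) K'"
  have "supp_homeo n (box n 1) (K k) (K' k)" for k
    using b supp_homeo_id by (auto simp: K_def K'_def)
  from near_homeo_glue_blocks[OF j _ this, of 0] have cc: "near_homeo n {} 0 2 c c'" by (simp add: c_def c'_def)
  have E: "T y \<in> eucl n" "T' y \<in> eucl n" "T (T' y) = y" "T' (T y) = y" "c y \<in> eucl n" "c' y \<in> eucl n" "c (c' y) = y"
    if "y \<in> eucl n" for y
    using that on_coord_in_eucl[OF j that] cc by (auto simp: T_def T'_def on_coord_on_coord on_coord_id near_homeo_def)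
  have off: "b y = y" if "y \<in> eucl n" "\<bar>y j\<bar> > 1" for y
    using supp_homeoD(5)[OF b that(1) notin_slab[where x = y, OF j that(2)]] .
  \<comment> \<open>Taking the factor of block 0 out of the product leaves its translate. Left of
    block 0 nothing moves; in block 0 the factor is \<open>b\<close>; to the right the additional
    \<open>b\<close> meets a point outside its support.\<close>
  have main: "c y = b (T (c (T' y)))" if y: "y \<in> eucl n" for y
  proof -
    obtain m where m: "-2 + 4 * of_int m \<le> y j" "y j < -2 + 4 + 4 * of_int m" by (rule in_some_block[of 4 "-2" "y j"]) auto
    have "T' y j = y j - 4" by (simp add: T'_def on_coord_def)
    then have cT: "c (T' y) = on_coord j (\<lambda>t. t + 4 * of_int (m - 1)) (K (m - 1) (on_coord j (\<lambda>t. t - 4 * of_int (m - 1)) (T' y)))"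
      unfolding c_def using m by (intro glue_blocks_in_block) auto
    have cy: "c y = on_coord j (\<lambda>t. t + 4 * of_int m) (K m (on_coord j (\<lambda>t. t - 4 * of_int m) y))"
      unfolding c_def using m by (intro glue_blocks_in_block) auto
    define z where "z = on_coord j (\<lambda>t. t - 4 * of_int m) y"
    have "on_coord j (\<lambda>t. t - 4 * of_int (m - 1)) (T' y) = z" by (simp add: T'_def z_def on_coord_on_coord algebra_simps)
    then have TcT: "T (c (T' y)) = on_coord j (\<lambda>t. t + 4 * of_int m) (K (m - 1) z)"
      unfolding cT by (simp add: T_def on_coord_on_coord algebra_simps)
    have zE: "z \<in> eucl n" unfolding z_def by (rule on_coord_in_eucl[OF j y])
    have yz: "on_coord j (\<lambda>t. t + 4 * of_int m) z = y" by (simp add: z_def on_coord_on_coord on_coord_id)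
    consider "m < 0" | "m = 0" | "0 < m" by linarith
    then show ?thesis
    proof cases
      case 1
      then have "real_of_int m \<le> -1" by linarith
      then have "\<bar>y j\<bar> > 1" using m by linarith
      then show ?thesis using TcT cy 1 off[OF y] yz by (simp add: K_def flip: z_def)
    next
      case 2
      then show ?thesis using TcT cy yz by (simp add: K_def on_coord_id flip: z_def)
    next
      case 3
      have cyE: "c y \<in> eucl n" using E y by blast
      have "\<bar>c y j\<bar> > 1"
      proof -
        have zj: "-2 \<le> z j" "z j < 2" using m by (auto simp: z_def on_coord_def)
        have "-2 \<le> b z j"
        proof (cases "z \<in> box n 1")
          case True
          then have "\<bar>b z j\<bar> \<le> 1" using supp_homeo_preserves[OF b zE] j by (auto simp: slab_def)
          then show ?thesis by linarith
        qed (use supp_homeoD(5)[OF b zE] zj in simp)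
        moreover have "c y j = b z j + 4 * of_int m" using 3 cy[folded z_def] by (simp add: K_def on_coord_apply)
        moreover have "1 \<le> real_of_int m" using 3 by linarith
        ultimately show ?thesis by linarith
      qed
      moreover have "T (c (T' y)) = c y" using TcT cy 3 by (simp add: K_def flip: z_def)
      ultimately show ?thesis using off[OF cyE] by simp
    qed
  qed
  have "c (T (c' (T' y))) = b y" if y: "y \<in> eucl n" for y
  proof -
    have z: "T (c' (T' y)) \<in> eucl n" using E(1)[OF E(6)[OF E(2)[OF y]]] .
    have "c (T (c' (T' y))) = b (T (c (T' (T (c' (T' y))))))" by (rule main[OF z])
    also have "\<dots> = b y" using E y by simp
    finally show ?thesis .
  qed
  then have "\<forall>y\<in>eucl n. c (T (c' (T' y))) = b y" by blast
  with cc show ?thesis unfolding T_def T'_def by (intro exI conjI)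
qed

lemma squeeze_o: "squeeze n (H \<circ> G) = squeeze n H \<circ> squeeze n G"
proof
  show "squeeze n (H \<circ> G) y = (squeeze n H \<circ> squeeze n G) y" for y
    using squeeze_comp[of n H G y] by (simp add: comp_def)
qed

lemma squeeze_funpow: "squeeze n (H ^^ m) = squeeze n H ^^ m"
proof (induction m)
  case 0
  have "squeeze n id = id" by (rule ext) (simp add: squeeze_fixed)
  then show ?case by (simp add: id_def)
next
  case (Suc m)
  then show ?case unfolding funpow.simps squeeze_o by simp
qed

lemma on_coord_shift_funpow: "(on_coord j (\<lambda>t. t + a) ^^ m) = on_coord j (\<lambda>t. t + a * of_nat m)"
proof (induction m)
  case 0
  show ?case by (intro ext) (simp add: on_coord_def)
next
  case (Suc m)
  show ?case unfolding funpow.simps Suc comp_def on_coord_on_coord by (simp add: algebra_simps)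
qed

text \<open>By \<open>swindle\<close>, \<open>b m\<close> is a commutator of \<open>c m\<close> with
  a map \<open>f\<close> independent of \<open>m\<close>. The outer product \<open>G\<close> stores
  \<open>c m\<close> in block \<open>m\<close>, of width 8 since the supports have radius 2, and
  shifting back by \<open>m\<close> blocks brings it to the origin along with the other factors.
  These are invisible to the commutator with \<open>f\<close>, as box 2 supports \<open>f\<close>
  and is preserved by \<open>c m\<close>.\<close>

proposition commutator_words:
  assumes n: "0 < n" and b: "\<And>m::nat. supp_homeo n (box n 1) (b m) (b' m)"
  shows "\<exists>C C' e e' f f'. supp_homeo n (box n 2) C C' \<and> supp_homeo n (box n 2) e e' \<and>
    supp_homeo n (box n 2) f f' \<and>
    (\<forall>m. \<forall>y\<in>eucl n. b m y = (e' ^^ m) (C ((e ^^ m) (f ((e' ^^ m) (C' ((e ^^ m) (f' y))))))))"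
proof -
  define T where "T = on_coord 0 (\<lambda>t. t + 4)"
  define T' where "T' = on_coord 0 (\<lambda>t. t - 4)"
  have "\<exists>c c'. near_homeo n {} 0 2 c c' \<and> (\<forall>y\<in>eucl n. c (T (c' (T' y))) = b m y)" for m
    using swindle[OF n b[of m]] unfolding T_def T'_def .
  then obtain ct ct' where ct: "\<And>m. near_homeo n {} 0 2 (ct m) (ct' m)"
    "\<And>m y. y \<in> eucl n \<Longrightarrow> ct m (T (ct' m (T' y))) = b m y" by metis
  have TT: "near_homeo n {} 0 4 T T'" using near_homeo_shift[OF n, of 0 4] by (simp add: T_def T'_def)
  define c c' f f' where "c m = squeeze n (ct m)" and "c' m = squeeze n (ct' m)" and "f = squeeze n T" and "f' = squeeze n T'" for m
  have cm: "supp_homeo n (box n 2) (c m) (c' m)" for m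
    unfolding c_def c'_def by (rule supp_homeo_squeeze[OF ct(1)]) simp
  have ff: "supp_homeo n (box n 2) f f'"
    unfolding f_def f'_def by (rule supp_homeo_squeeze[OF TT]) simp
  have bc: "c m (f (c' m (f' y))) = b m y" if y: "y \<in> eucl n" for m y
  proof -
    have "c m (f (c' m (f' y))) = squeeze n (ct m \<circ> T \<circ> ct' m \<circ> T') y"
      by (simp add: c_def c'_def f_def f'_def squeeze_o)
    also have "\<dots> = squeeze n (b m) y" using ct(2) by (intro squeeze_cong y) simp
    also have "\<dots> = b m y" by (rule squeeze_supp[OF b y])
    finally show ?thesis .
  qed
  define K K' where "K k = (if k \<ge> (0::int) then c (nat k) else (\<lambda>x. x))"
    and "K' k = (if k \<ge> (0::int) then c' (nat k) else (\<lambda>x. x))" for k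
  define G G' where "G = glue_blocks 0 8 (-4) K" and "G' = glue_blocks 0 8 (-4) K'"
  have "supp_homeo n (box n 2) (K k) (K' k)" for k
    using cm supp_homeo_id by (auto simp: K_def K'_def)
  from near_homeo_glue_blocks[OF n _ this, of 0] have GG: "near_homeo n {} 0 4 G G'" by (simp add: G_def G'_def)
  define e e' where "e = on_coord 0 (\<lambda>t. t + 8)" and "e' = on_coord 0 (\<lambda>t. t - 8)"
  have ee: "near_homeo n {} 0 8 e e'" using near_homeo_shift[OF n, of 0 8] by (simp add: e_def e'_def)
  have em: "(e ^^ m) = on_coord 0 (\<lambda>t. t + 8 * of_nat m)" "(e' ^^ m) = on_coord 0 (\<lambda>t. t - 8 * of_nat m)" for m
    using on_coord_shift_funpow[where j = 0 and a = 8 and m = m] on_coord_shift_funpow[where j = 0 and a = "-8" and m = m] by (simp_all add: e_def e'_def)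
  define x x' where "x m y = (e' ^^ m) (G ((e ^^ m) y))" and "x' m y = (e' ^^ m) (G' ((e ^^ m) y))" for m y
  have xE: "x m y \<in> eucl n" "x' m y \<in> eucl n" "x m (x' m y) = y" if "y \<in> eucl n" for m y
  proof -
    have "(e ^^ m) y \<in> eucl n" "(e' ^^ m) y \<in> eucl n" if "y \<in> eucl n" for y m
      unfolding em using on_coord_in_eucl[OF n that] by blast+
    moreover have "G y \<in> eucl n" "G' y \<in> eucl n" "G (G' y) = y" if "y \<in> eucl n" for y
      using GG that by (auto simp: near_homeo_def)
    moreover have "(e ^^ m) ((e' ^^ m) y) = y" "(e' ^^ m) ((e ^^ m) y) = y" for y m unfolding em by (simp_all add: on_coord_on_coord on_coord_id)
    ultimately show "x m y \<in> eucl n" "x' m y \<in> eucl n" "x m (x' m y) = y"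
      using that by (simp_all add: x_def x'_def)
  qed
  have x_c: "x m y = c m y" "x' m y = c' m y" if y: "y \<in> box n 2" for m y
  proof -
    have "\<bar>y 0\<bar> \<le> 2" using y n by (simp add: slab_def)
    then have yb: "-4 + 8 * of_int (int m) \<le> (e ^^ m) y 0" "(e ^^ m) y 0 < -4 + 8 + 8 * of_int (int m)"
      by (auto simp: em on_coord_def)
    have id: "on_coord 0 (\<lambda>t. t - 8 * real m) ((e ^^ m) y) = y" by (simp add: em on_coord_on_coord on_coord_id)
    have "(e' ^^ m) (on_coord 0 (\<lambda>t. t + 8 * real m) z) = z" for z by (simp add: em on_coord_on_coord on_coord_id)
    then show "x m y = c m y" "x' m y = c' m y"
      using glue_blocks_in_block[where j = 0 and x = "(e ^^ m) y" and p = 8 and c = "-4" and m = "int m", OF _ yb] id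
      by (simp_all add: x_def x'_def G_def G'_def K_def K'_def)
  qed
  \<comment> \<open>Outside box 2 the map \<open>x m\<close> may differ from \<open>c m\<close>, but
    there \<open>f\<close> is the identity and \<open>x m\<close> meets its own inverse.\<close>
  have bx: "x m (f (x' m (f' y))) = b m y" if y: "y \<in> eucl n" for m y
  proof (cases "y \<in> box n 2")
    case True
    note cp = supp_homeo_preserves[OF supp_homeo_sym[OF cm]]
    have 1: "f' y \<in> box n 2" by (rule supp_homeo_preserves[OF supp_homeo_sym[OF ff] y True])
    have 2: "c' m (f' y) \<in> box n 2" by (rule cp[OF _ 1]) (use 1 box_subset in blast)
    have 3: "f (c' m (f' y)) \<in> box n 2" by (rule supp_homeo_preserves[OF ff _ 2]) (use 2 box_subset in blast)
    show ?thesis using bc[OF y] x_c 1 3 by simp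
  next
    case False
    have "f' y = y" using supp_homeoD(6)[OF ff y False] .
    moreover have "x' m y \<notin> box n 2"
    proof
      assume *: "x' m y \<in> box n 2"
      then have "c m (x' m y) \<in> box n 2" by (intro supp_homeo_preserves[OF cm] xE y)
      then show False using x_c(1)[OF *, of m] xE(3)[OF y, of m] False by simp
    qed
    then have "f (x' m y) = x' m y" by (intro supp_homeoD(5)[OF ff] xE y)
    moreover have "b m y = y"
    proof (rule supp_homeoD(5)[OF b y])
      show "y \<notin> box n 1" using False by (force simp: slab_def)
    qed
    ultimately show ?thesis using xE y by simp
  qed
  show ?thesis
  proof (intro exI conjI allI ballI)
    show "supp_homeo n (box n 2) (squeeze n G) (squeeze n G')" by (rule supp_homeo_squeeze[OF GG]) simp
    show "supp_homeo n (box n 2) (squeeze n e) (squeeze n e')" by (rule supp_homeo_squeeze[OF ee]) simp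
    \<comment> \<open>The map \<open>f\<close> is squeezed a second time: all letters must be
      conjugated by the same contraction for the word to be preserved.\<close>
    have "near_homeo n {} 0 8 f f'"
      using near_homeo_squeeze[OF TT, of 0] by (simp add: f_def f'_def)
    then show "supp_homeo n (box n 2) (squeeze n f) (squeeze n f')" by (rule supp_homeo_squeeze) simp
    fix m y assume y: "y \<in> eucl n"
    have "(squeeze n e' ^^ m) (squeeze n G ((squeeze n e ^^ m) (squeeze n f ((squeeze n e' ^^ m) (squeeze n G' ((squeeze n e ^^ m) (squeeze n f' y)))))))
        = squeeze n ((e' ^^ m) \<circ> G \<circ> (e ^^ m) \<circ> f \<circ> (e' ^^ m) \<circ> G' \<circ> (e ^^ m) \<circ> f') y"
      by (simp add: squeeze_o squeeze_funpow)
    also have "\<dots> = squeeze n (b m) y" using bx by (intro squeeze_cong y) (simp add: x_def x'_def)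
    also have "\<dots> = b m y" by (rule squeeze_supp[OF b y])
    finally show "b m y = (squeeze n e' ^^ m) (squeeze n G ((squeeze n e ^^ m) (squeeze n f ((squeeze n e' ^^ m) (squeeze n G' ((squeeze n e ^^ m) (squeeze n f' y)))))))"
      by simp
  qed
qed

section \<open>The identity component\<close>

lemma topspace_compact_open: "topspace (compact_open_topology X) = Homeo X"
proof -
  \<comment> \<open>The empty compact set makes \<open>Homeo X\<close> itself a subbasic
    set.\<close>
  have "Homeo X \<in> {{f \<in> Homeo X. f ` K \<subseteq> U} | K U. compactin X K \<and> openin X U}"
    by (intro CollectI exI[of _ "{}"]) auto
  then show ?thesis
    unfolding compact_open_topology_def topspace_subtopology topology_generated_by_topspace by blast
qed

lemma openin_compact_open:
  assumes "compactin X K" "openin X U"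
  shows "openin (compact_open_topology X) {f \<in> Homeo X. f ` K \<subseteq> U}"
proof -
  let ?S = "{{f \<in> Homeo X. f ` K \<subseteq> U} | K U. compactin X K \<and> openin X U}"
  have "openin (topology_generated_by ?S) {f \<in> Homeo X. f ` K \<subseteq> U}"
    using assms by (intro topology_generated_by_Basis) blast
  then have "openin (compact_open_topology X) (Homeo X \<inter> {f \<in> Homeo X. f ` K \<subseteq> U})"
    unfolding compact_open_topology_def by (rule openin_subtopology_Int2)
  moreover have "Homeo X \<inter> {f \<in> Homeo X. f ` K \<subseteq> U} = {f \<in> Homeo X. f ` K \<subseteq> U}" by blast
  ultimately show ?thesis by simp
qed

lemma continuous_map_into_compact_open:
  assumes "\<And>t. t \<in> topspace Y \<Longrightarrow> \<gamma> t \<in> Homeo X"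
    and "\<And>K U. compactin X K \<Longrightarrow> openin X U \<Longrightarrow> openin Y {t \<in> topspace Y. \<gamma> t ` K \<subseteq> U}"
  shows "continuous_map Y (compact_open_topology X) \<gamma>"
  unfolding compact_open_topology_def continuous_map_in_subtopology continuous_on_generated_topo_iff
proof (intro conjI allI impI)
  fix V assume "V \<in> {{f \<in> Homeo X. f ` K \<subseteq> U} | K U. compactin X K \<and> openin X U}"
  then obtain K U where KU: "compactin X K" "openin X U" "V = {f \<in> Homeo X. f ` K \<subseteq> U}" by blast
  have "\<gamma> -` V \<inter> topspace Y = {t \<in> topspace Y. \<gamma> t ` K \<subseteq> U}" using assms(1) KU(3) by blast
  then show "openin Y (\<gamma> -` V \<inter> topspace Y)" using assms(2)[OF KU(1,2)] by simp
next
  have "Homeo X \<in> {{f \<in> Homeo X. f ` K \<subseteq> U} | K U. compactin X K \<and> openin X U}"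
    by (intro CollectI exI[of _ "{}"]) auto
  then show "\<gamma> ` topspace Y \<subseteq> \<Union>{{f \<in> Homeo X. f ` K \<subseteq> U} | K U. compactin X K \<and> openin X U}"
    using assms(1) by blast
  show "\<gamma> \<in> topspace Y \<rightarrow> Homeo X" using assms(1) by blast
qed

lemma continuous_map_left_mult:
  assumes f: "f \<in> Homeo X"
  shows "continuous_map (compact_open_topology X) (compact_open_topology X) (\<lambda>g. f \<circ> g)"
proof (rule continuous_map_into_compact_open)
  fix K U assume KU: "compactin X K" "openin X U"
  have "openin X {x \<in> topspace X. f x \<in> U}" by (rule openin_continuous_map_preimage[OF Homeo_cont[OF f] KU(2)])
  from openin_compact_open[OF KU(1) this]
  have "openin (compact_open_topology X) {g \<in> Homeo X. g ` K \<subseteq> {x \<in> topspace X. f x \<in> U}}" .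
  moreover have "g ` K \<subseteq> topspace X" if "g \<in> Homeo X" for g
    using Homeo_topspace[OF that] compactin_subset_topspace[OF KU(1)] by blast
  then have "{g \<in> Homeo X. g ` K \<subseteq> {x \<in> topspace X. f x \<in> U}} = {g \<in> topspace (compact_open_topology X). (f \<circ> g) ` K \<subseteq> U}"
    unfolding topspace_compact_open by auto
  ultimately show "openin (compact_open_topology X) {g \<in> topspace (compact_open_topology X). (f \<circ> g) ` K \<subseteq> U}" by simp
qed (use f Homeo_comp topspace_compact_open in blast)

text \<open>Compactness of \<open>K\<close> makes the projection along it closed, so the parameters
  that send some point of \<open>K\<close> outside \<open>U\<close> form a closed set.\<close>

lemma continuous_map_family:
  assumes c: "continuous_map (prod_topology Y X) X (\<lambda>z. \<gamma> (fst z) (snd z))" and "\<And>t. t \<in> topspace Y \<Longrightarrow> \<gamma> t \<in> Homeo X"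
  shows "continuous_map Y (compact_open_topology X) \<gamma>"
proof (rule continuous_map_into_compact_open[OF assms(2)])
  fix K U assume KU: "compactin X K" "openin X U"
  have K: "K \<subseteq> topspace X" using compactin_subset_topspace[OF KU(1)] .
  let ?P = "prod_topology Y (subtopology X K)"
  have "?P = subtopology (prod_topology Y X) (topspace Y \<times> K)"
    by (simp add: prod_topology_subtopology)
  then have c': "continuous_map ?P X (\<lambda>z. \<gamma> (fst z) (snd z))"
    using continuous_map_from_subtopology[OF c] by metis
  define Z where "Z = {z \<in> topspace ?P. \<gamma> (fst z) (snd z) \<in> topspace X - U}"
  have "closedin ?P Z" unfolding Z_def
    by (rule closedin_continuous_map_preimage[OF c']) (use KU in blast)
  moreover have "closed_map ?P Y fst"
    by (rule closed_map_fst) (use KU(1) in \<open>simp add: compact_space_subtopology\<close>)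
  ultimately have "closedin Y (fst ` Z)" by (auto simp: closed_map_def)
  moreover have "{t \<in> topspace Y. \<gamma> t ` K \<subseteq> U} = topspace Y - fst ` Z"
  proof -
    have "\<gamma> t x \<in> topspace X" if "t \<in> topspace Y" "x \<in> K" for t x
      using Homeo_topspace[OF assms(2)[OF that(1)]] that K by blast
    then show ?thesis using K by (force simp: Z_def image_iff)
  qed
  ultimately show "openin Y {t \<in> topspace Y. \<gamma> t ` K \<subseteq> U}" by auto
qed

section \<open>The identity component as a group\<close>

lemma Homeo0I: "connectedin (compact_open_topology X) S \<Longrightarrow> id \<in> S \<Longrightarrow> f \<in> S \<Longrightarrow> f \<in> Homeo0 X"
  unfolding Homeo0_def connected_component_of_def by blast

lemma Homeo0_Homeo: "f \<in> Homeo0 X \<Longrightarrow> f \<in> Homeo X"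
  unfolding Homeo0_def mem_Collect_eq using connected_component_in_topspace topspace_compact_open by metis

lemma id_Homeo0: "id \<in> Homeo0 X"
  unfolding Homeo0_def by (simp add: connected_component_of_refl topspace_compact_open Homeo_id)

text \<open>Left translations give the whole subgroup property: \<open>f\<close> carries a
  connection from \<open>id\<close> to \<open>g\<close> to one from \<open>f\<close> to the product,
  and \<open>hinv f\<close> carries one from \<open>id\<close> to \<open>f\<close> to one from
  \<open>hinv f\<close> to \<open>id\<close>.\<close>

lemma connected_component_left_mult:
  assumes "f \<in> Homeo X" "connected_component_of (compact_open_topology X) g h"
  shows "connected_component_of (compact_open_topology X) (f \<circ> g) (f \<circ> h)"
proof -
  obtain S where S: "connectedin (compact_open_topology X) S" "g \<in> S" "h \<in> S"
    using assms(2) unfolding connected_component_of_def by blast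
  have "connectedin (compact_open_topology X) ((\<lambda>g. f \<circ> g) ` S)"
    by (rule connectedin_continuous_map_image[OF continuous_map_left_mult[OF assms(1)] S(1)])
  then show ?thesis unfolding connected_component_of_def using S by blast
qed

lemma Homeo0_comp: "f \<in> Homeo0 X \<Longrightarrow> g \<in> Homeo0 X \<Longrightarrow> f \<circ> g \<in> Homeo0 X"
  using connected_component_left_mult[of f X id g] Homeo0_Homeo connected_component_of_trans
  by (fastforce simp: Homeo0_def)

lemma Homeo0_inv: "f \<in> Homeo0 X \<Longrightarrow> hinv f \<in> Homeo0 X"
proof -
  assume f: "f \<in> Homeo0 X"
  note fH = Homeo0_Homeo[OF f]
  have "connected_component_of (compact_open_topology X) (hinv f \<circ> id) (hinv f \<circ> f)"
    using f by (intro connected_component_left_mult Homeo_inv fH) (simp add: Homeo0_def)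
  moreover have "hinv f \<circ> f = id" using fH by auto
  ultimately show ?thesis by (simp add: Homeo0_def connected_component_of_sym)
qed

lemma group_Homeo0: "group (Homeo0_group X)"
proof (rule groupI)
  fix f assume "f \<in> carrier (Homeo0_group X)"
  then have f: "f \<in> Homeo0 X" by (simp add: Homeo0_group_def)
  have "hinv f \<circ> f = id" using Homeo0_Homeo[OF f] by auto
  then show "\<exists>g\<in>carrier (Homeo0_group X). g \<otimes>\<^bsub>Homeo0_group X\<^esub> f = \<one>\<^bsub>Homeo0_group X\<^esub>"
    using Homeo0_inv[OF f] by (auto simp: Homeo0_group_def intro!: bexI[of _ "hinv f"])
qed (auto simp: Homeo0_group_def Homeo0_comp id_Homeo0 comp_assoc)

section \<open>The Alexander isotopy and its continuity\<close>

definition alexander_isotopy :: "((nat \<Rightarrow> real) \<Rightarrow> (nat \<Rightarrow> real)) \<Rightarrow> real \<Rightarrow> (nat \<Rightarrow> real) \<Rightarrow> (nat \<Rightarrow> real)" where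
  "alexander_isotopy g t x = (if t = 0 then x else (\<lambda>i. t * g (\<lambda>k. x k / t) i))"

lemma supp_homeo_alexander_isotopy:
  assumes g: "supp_homeo n (box n r) g g'" and t: "0 \<le> t" "t \<le> 1"
  shows "supp_homeo n (box n r) (alexander_isotopy g t) (alexander_isotopy g' t)"
proof (cases "t = 0")
  case True
  then show ?thesis by (simp add: alexander_isotopy_def supp_homeo_def)
next
  case False
  define A where "A x = (\<lambda>i. t * x i)" for x :: "nat \<Rightarrow> real"
  define A' where "A' x = (\<lambda>i. x i / t)" for x :: "nat \<Rightarrow> real"
  have AE: "A x \<in> eucl n \<and> A' x \<in> eucl n \<and> A (A' x) = x \<and> A' (A x) = x" if "x \<in> eucl n" for x
    using that False by (auto simp: A_def A'_def eucl_def)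
  have cA: "continuous_on S A" "continuous_on S A'" for S
    unfolding A_def A'_def using False
    by (intro continuous_on_coordinatewise_then_product continuous_intros continuous_on_coord; simp)+
  have supp: "x \<in> box n r" if x: "x \<in> eucl n" "A' x \<in> box n r" for x
  proof -
    have "\<bar>x i\<bar> \<le> r" if "i < n" for i
    proof -
      have "\<bar>x i / t\<bar> \<le> r" using x that by (simp add: slab_def A'_def)
      moreover have "\<bar>x i\<bar> * 1 \<le> \<bar>x i\<bar> * (1 / t)" using False t by (intro mult_left_mono) (auto simp: le_divide_eq)
      then have "\<bar>x i\<bar> \<le> \<bar>x i / t\<bar>" using False t by simp
      ultimately show ?thesis by linarith
    qed
    then show ?thesis using x by (simp add: slab_def)
  qed
  have "alexander_isotopy g t = (\<lambda>x. A (g (A' x)))" "alexander_isotopy g' t = (\<lambda>x. A (g' (A' x)))"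
    using False by (intro ext; simp add: alexander_isotopy_def A_def A'_def)+
  then show ?thesis by (simp only: supp_homeo_conj[OF g cA AE supp])
qed

text \<open>For positive time this is a composition. At time 0 continuity comes from the
  displacement bound \<open>2 r t\<close>, which is uniform in the point.\<close>

lemma continuous_on_alexander_isotopy:
  assumes g: "supp_homeo n (box n r) g g'" and r: "0 \<le> r"
  shows "continuous_on ({0..1::real} \<times> eucl n) (\<lambda>z. alexander_isotopy g (fst z) (snd z))"
proof (rule continuous_on_coordinatewise_then_product)
  fix i
  let ?S = "{0..1::real} \<times> eucl n"
  show "continuous_on ?S (\<lambda>z. alexander_isotopy g (fst z) (snd z) i)"
    unfolding continuous_on_eq_continuous_within
  proof
    fix z assume z: "z \<in> ?S"
    show "continuous (at z within ?S) (\<lambda>z. alexander_isotopy g (fst z) (snd z) i)"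
    proof (cases "fst z = 0")
      case False
      let ?U = "{z :: real \<times> (nat \<Rightarrow> real). 0 < fst z}"
      have op: "open ?U" by (intro open_Collect_less continuous_intros)
      have coord: "continuous_on (?S \<inter> ?U) (\<lambda>z. snd z k)" for k
        by (rule continuous_on_compose2[OF continuous_on_coord[of UNIV k] continuous_on_snd[OF continuous_on_id]]) simp
      have "continuous_on (?S \<inter> ?U) (\<lambda>z. g (\<lambda>k. snd z k / fst z))"
      proof (rule continuous_on_compose2[of "eucl n" g])
        show "continuous_on (eucl n) g" using g by (simp add: supp_homeo_def)
        show "continuous_on (?S \<inter> ?U) (\<lambda>z k. snd z k / fst z)"
          by (intro continuous_on_coordinatewise_then_product continuous_on_divide coord continuous_on_fst continuous_on_id) auto
      qed (auto simp: eucl_def)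
      then have "continuous_on (?S \<inter> ?U) (\<lambda>z. g (\<lambda>k. snd z k / fst z) i)"
        by (rule continuous_on_product_then_coordinatewise)
      then have "continuous_on (?S \<inter> ?U) (\<lambda>z. fst z * g (\<lambda>k. snd z k / fst z) i)"
        by (intro continuous_on_mult continuous_on_fst continuous_on_id)
      then have "continuous_on (?S \<inter> ?U) (\<lambda>z. alexander_isotopy g (fst z) (snd z) i)"
        by (rule continuous_on_eq) (simp add: alexander_isotopy_def)
      moreover have "z \<in> ?U" using z False by auto
      moreover from this have "at z within ?S = at z within (?S \<inter> ?U)"
        using op by (intro at_within_nhd[of z ?U]) auto
      ultimately show ?thesis using z by (simp add: continuous_on_eq_continuous_within)
    next
      case True
      have "((\<lambda>w. fst w * (2 * r)) \<longlongrightarrow> fst z * (2 * r)) (at z within ?S)" by (intro tendsto_intros)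
      then have "((\<lambda>w. fst w * (2 * r)) \<longlongrightarrow> 0) (at z within ?S)" using True by simp
      then have "((\<lambda>w. alexander_isotopy g (fst w) (snd w) i - snd w i) \<longlongrightarrow> 0) (at z within ?S)"
      proof (rule Lim_null_comparison[rotated])
        have "norm (alexander_isotopy g t x i - x i) \<le> t * (2 * r)" if t: "0 \<le> t" "x \<in> eucl n" for t x
        proof (cases "t = 0")
          case False
          have "(\<lambda>k. x k / t) \<in> eucl n" using t by (simp add: eucl_def)
          from supp_homeo_near[OF g this r]
          have "\<bar>g (\<lambda>k. x k / t) i - x i / t\<bar> \<le> 2 * r" by (auto simp: near_def)
          then have "t * \<bar>g (\<lambda>k. x k / t) i - x i / t\<bar> \<le> t * (2 * r)" using t by (intro mult_left_mono) auto
          moreover have "alexander_isotopy g t x i - x i = t * (g (\<lambda>k. x k / t) i - x i / t)"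
            using False by (simp add: alexander_isotopy_def algebra_simps)
          ultimately show ?thesis using t by (simp add: abs_mult)
        qed (simp add: alexander_isotopy_def)
        then show "\<forall>\<^sub>F w in at z within ?S. norm (alexander_isotopy g (fst w) (snd w) i - snd w i) \<le> fst w * (2 * r)"
          unfolding eventually_at_filter by (intro always_eventually) auto
      qed
      moreover have "((\<lambda>w. snd w i) \<longlongrightarrow> snd z i) (at z within ?S)"
      proof -
        have "continuous_on ?S (\<lambda>w. snd w i)"
          by (rule continuous_on_compose2[OF continuous_on_coord[of UNIV i] continuous_on_snd[OF continuous_on_id]]) simp
        then show ?thesis using z unfolding continuous_on_def by blast
      qed
      ultimately have "((\<lambda>w. alexander_isotopy g (fst w) (snd w) i - snd w i + snd w i) \<longlongrightarrow> 0 + snd z i) (at z within ?S)"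
        by (rule tendsto_add)
      then show ?thesis using True by (simp add: continuous_within alexander_isotopy_def)
    qed
  qed
qed

lemma (in embedded_compact) transport_in_Homeo0:
  assumes \<phi>: "chart X n \<phi>" and g: "supp_homeo n (box n r) g g'" and r: "0 \<le> r"
  shows "transport n \<phi> g \<in> Homeo0 X"
proof -
  define \<gamma> where "\<gamma> t = transport n \<phi> (alexander_isotopy g t)" for t
  let ?I = "top_of_set {0..1::real}"
  have s: "supp_homeo n (box n r) (alexander_isotopy g t) (alexander_isotopy g' t)" if "t \<in> {0..1}" for t
    using supp_homeo_alexander_isotopy[OF g] that by auto
  have "continuous_map (prod_topology ?I (top_of_set (eucl n))) (top_of_set (eucl n)) (\<lambda>z. alexander_isotopy g (fst z) (snd z))"
  proof -
    have "alexander_isotopy g (fst z) (snd z) \<in> eucl n" if "z \<in> {0..1} \<times> eucl n" for z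
      using supp_homeoD(1)[OF s, of "fst z" "snd z"] that by auto
    then show ?thesis
      using continuous_on_alexander_isotopy[OF g r] by (auto simp: prod_topology_subtopology_eu image_subset_iff)
  qed
  then have "continuous_map (prod_topology ?I X) X (\<lambda>z. transport n \<phi> (alexander_isotopy g (fst z)) (snd z))"
    using supp_homeoD(5)[OF s] by (intro transport_continuous[OF \<phi> compact_box box_subset]) auto
  then have "continuous_map ?I (compact_open_topology X) \<gamma>"
    unfolding \<gamma>_def
    by (rule continuous_map_family) (use transport_Homeo(1)[OF \<phi> compact_box box_subset s] in auto)
  moreover have "connectedin ?I {0..1}" by (simp add: connectedin_subtopology)
  ultimately have "connectedin (compact_open_topology X) (\<gamma> ` {0..1})"
    using connectedin_continuous_map_image by blast
  moreover have "\<gamma> 0 = id" unfolding \<gamma>_def by (rule ext) (simp add: transport_id[OF \<phi>] alexander_isotopy_def)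
  moreover have "alexander_isotopy g 1 = g" by (rule ext) (simp add: alexander_isotopy_def)
  then have "\<gamma> 1 = transport n \<phi> g" by (simp add: \<gamma>_def)
  ultimately show ?thesis by (intro Homeo0I[of X "\<gamma> ` {0..1}"]) (metis atLeastAtMost_iff image_eqI order_refl zero_le_one)+
qed

text \<open>Finitely many balls of radius \<delta>/3 cover \<open>X\<close>. Sending each closed
  ball of this radius into the concentric ball of radius \<delta>/2 is a compact-open condition, and
  \<delta>/3 + \<delta>/2 is less than \<delta>.\<close>

lemma (in embedded_compact) compact_open_near_id:
  assumes "\<delta> > 0"
  obtains W where "openin (compact_open_topology X) W" "id \<in> W" "\<And>h. h \<in> W \<Longrightarrow> near_id \<delta> h"
proof -
  define B where "B p = {q \<in> topspace X. dist (e p) (e q) < \<delta> / 3}" for p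
  define D where "D p = {q \<in> topspace X. dist (e p) (e q) \<le> \<delta> / 3}" for p
  define U where "U p = {q \<in> topspace X. dist (e p) (e q) < \<delta> / 2}" for p
  have "compactin X (topspace X)" using compact by (simp add: compact_space_def)
  moreover have "\<forall>V\<in>B ` topspace X. openin X V" unfolding B_def using openin_dball by blast
  moreover have "topspace X \<subseteq> \<Union>(B ` topspace X)" using assms by (auto simp: B_def)
  ultimately obtain \<F> where "finite \<F>" "\<F> \<subseteq> B ` topspace X" "topspace X \<subseteq> \<Union>\<F>"
    unfolding compactin_def by metis
  then obtain P where P: "finite P" "P \<subseteq> topspace X" "topspace X \<subseteq> (\<Union>p\<in>P. B p)"
    by (metis finite_subset_image)
  have D: "compactin X (D p)" for p
  proof -
    have "closedin X {q \<in> topspace X. e q \<in> cball (e p) (\<delta> / 3)}"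
      by (rule closedin_continuous_map_preimage[OF cont_e]) simp
    then show ?thesis unfolding D_def using closedin_compact_space[OF compact] by (simp add: mem_cball)
  qed
  define W where "W = Homeo X \<inter> (\<Inter>p\<in>P. {f \<in> Homeo X. f ` D p \<subseteq> U p})"
  have "openin X (U p)" for p unfolding U_def by (rule openin_dball)
  then have "openin (compact_open_topology X) ((\<Inter>p\<in>P. {f \<in> Homeo X. f ` D p \<subseteq> U p}) \<inter> topspace (compact_open_topology X))"
    by (intro openin_INT P(1) openin_compact_open D)
  then have "openin (compact_open_topology X) W" by (simp add: W_def topspace_compact_open Int_commute)
  moreover have "id \<in> W" using assms by (auto simp: W_def Homeo_id D_def U_def)
  moreover have "near_id \<delta> h" if h: "h \<in> W" for h
    unfolding near_id_def
  proof
    fix q assume q: "q \<in> topspace X"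
    then obtain p where p: "p \<in> P" "q \<in> B p" using P by blast
    then have "q \<in> D p" by (auto simp: B_def D_def)
    then have "h q \<in> U p" using h p by (auto simp: W_def)
    then have "dist (e p) (e (h q)) < \<delta> / 2" by (simp add: U_def)
    moreover have "dist (e p) (e q) < \<delta> / 3" using p by (simp add: B_def)
    ultimately show "dist (e (h q)) (e q) < \<delta>"
      using dist_triangle3[of "e (h q)" "e q" "e p"] assms by linarith
  qed
  ultimately show ?thesis by (rule that)
qed

section \<open>Strong boundedness\<close>

lemma transport_comp_fun:
  assumes "chart X n \<phi>" "\<And>x. x \<in> eucl n \<Longrightarrow> h x \<in> eucl n"
  shows "transport n \<phi> (g \<circ> h) = transport n \<phi> g \<circ> transport n \<phi> h"
proof
  show "transport n \<phi> (g \<circ> h) p = (transport n \<phi> g \<circ> transport n \<phi> h) p" for p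
    using transport_comp[OF assms(1), of h g p] assms(2) by (simp add: comp_def)
qed

lemma funpow_in_eucl: "(\<And>x. x \<in> eucl n \<Longrightarrow> g x \<in> eucl n) \<Longrightarrow> x \<in> eucl n \<Longrightarrow> (g ^^ m) x \<in> eucl n"
  by (induction m) auto

lemma transport_funpow:
  assumes "chart X n \<phi>" "\<And>x. x \<in> eucl n \<Longrightarrow> g x \<in> eucl n"
  shows "transport n \<phi> (g ^^ m) = transport n \<phi> g ^^ m"
proof (induction m)
  case 0
  show ?case by (rule ext) (simp add: transport_id[OF assms(1)])
next
  case (Suc m)
  have "transport n \<phi> (g ^^ Suc m) = transport n \<phi> g \<circ> transport n \<phi> (g ^^ m)"
    unfolding funpow.simps using assms funpow_in_eucl by (intro transport_comp_fun) auto
  also have "\<dots> = transport n \<phi> g ^^ Suc m" unfolding Suc funpow.simps by (rule refl)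
  finally show ?case .
qed

definition box_supported :: "'a topology \<Rightarrow> nat \<Rightarrow> ((nat \<Rightarrow> real) \<Rightarrow> 'a) \<Rightarrow> ('a \<Rightarrow> 'a) set" where
  "box_supported X n \<phi> = {g \<in> Homeo X. \<forall>p. p \<notin> \<phi> ` box n 1 \<longrightarrow> g p = p}"

context embedded_compact
begin

lemma box_supported_expression:
  assumes "chart X n \<phi>" "g \<in> box_supported X n \<phi>"
  shows "\<exists>g0 g0'. supp_homeo n (box n 1) g0 g0' \<and> g = transport n \<phi> g0"
proof -
  have g: "g \<in> Homeo X" "\<And>p. p \<notin> \<phi> ` box n 1 \<Longrightarrow> g p = p" using assms(2) by (auto simp: box_supported_def)
  show ?thesis using coordinate_expression[OF assms(1) box_subset g] by metis
qed

lemma box_supported_Homeo0: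
  assumes "chart X n \<phi>" shows "box_supported X n \<phi> \<subseteq> Homeo0 X"
proof
  fix g assume "g \<in> box_supported X n \<phi>"
  then obtain g0 g0' where "supp_homeo n (box n 1) g0 g0'" "g = transport n \<phi> g0"
    using box_supported_expression[OF assms] by blast
  then show "g \<in> Homeo0 X" using transport_in_Homeo0[OF assms] by auto
qed

text \<open>Left invariance turns \<open>d f (f \<circ> g)\<close> into \<open>d id g\<close>, so
  \<open>d id\<close> is a length function, subadditive along words.\<close>

lemma length_bound:
  assumes d: "left_invariant_metric (Homeo0_group X) d"
  shows "f \<in> Homeo0 X \<Longrightarrow> g \<in> Homeo0 X \<Longrightarrow> d id (f \<circ> g) \<le> d id f + d id g"
    and "f \<in> Homeo0 X \<Longrightarrow> f ^^ m \<in> Homeo0 X \<and> d id (f ^^ m) \<le> real m * d id f"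
    and "0 \<le> d id f" and "f \<in> Homeo0 X \<Longrightarrow> g \<in> Homeo0 X \<Longrightarrow> d f g \<le> d id f + d id g"
proof -
  have M: "Metric_space (Homeo0 X) d"
    and inv: "\<And>f g h. f \<in> Homeo0 X \<Longrightarrow> g \<in> Homeo0 X \<Longrightarrow> h \<in> Homeo0 X \<Longrightarrow> d (f \<circ> g) (f \<circ> h) = d g h"
    using d by (auto simp: left_invariant_metric_def Homeo0_group_def)
  interpret Metric_space "Homeo0 X" d by (rule M)
  show comp: "d id (f \<circ> g) \<le> d id f + d id g" if "f \<in> Homeo0 X" "g \<in> Homeo0 X" for f g
    using triangle[of id f "f \<circ> g"] inv[of f id g] that id_Homeo0[of X] Homeo0_comp[of f X g] by simp
  show "0 \<le> d id f" by simp
  show "f ^^ m \<in> Homeo0 X \<and> d id (f ^^ m) \<le> real m * d id f" if f: "f \<in> Homeo0 X"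
  proof (induction m)
    case 0
    then show ?case using id_Homeo0[of X] by (simp flip: id_def)
  next
    case (Suc m)
    have "d id (f \<circ> f ^^ m) \<le> d id f + d id (f ^^ m)" by (rule comp[OF f conjunct1[OF Suc.IH]])
    moreover have "real (Suc m) * d id f = d id f + real m * d id f" by (simp add: distrib_right)
    ultimately have "d id (f \<circ> f ^^ m) \<le> real (Suc m) * d id f" using conjunct2[OF Suc.IH] by linarith
    moreover have "f \<circ> f ^^ m \<in> Homeo0 X" by (rule Homeo0_comp[OF f conjunct1[OF Suc.IH]])
    ultimately show ?case unfolding funpow.simps by blast
  qed
  show "d f g \<le> d id f + d id g" if "f \<in> Homeo0 X" "g \<in> Homeo0 X"
    using triangle[of f id g] commute[of f id] that id_Homeo0[of X] by simp
qed

text \<open>A sequence escaping to infinity would be written in three maps and their inverses, whose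
  lengths have a common bound \<open>K\<close>, and then the term \<open>m\<close> has length at
  most \<open>(4 m + 4) K\<close>. Dimension 0 offers no coordinate to translate in, but there only
  the identity occurs.\<close>

lemma box_supported_bounded:
  assumes \<phi>: "chart X n \<phi>" and d: "left_invariant_metric (Homeo0_group X) d"
  shows "\<exists>B. \<forall>a\<in>box_supported X n \<phi>. d id a \<le> B"
proof (cases "n = 0")
  case True
  have "a = id" if a: "a \<in> box_supported X n \<phi>" for a
  proof -
    obtain g g' where g: "supp_homeo n (box n 1) g g'" "a = transport n \<phi> g"
      using box_supported_expression[OF \<phi> a] by blast
    have "g x = x" if x: "x \<in> eucl n" for x
      using supp_homeoD(1)[OF g(1) x] x True by (intro ext) (auto simp: eucl_def)
    then show ?thesis using g(2) transport_id[OF \<phi>, of g] by (auto simp: fun_eq_iff)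
  qed
  then show ?thesis by (intro exI[of _ "d id id"]) auto
next
  case False
  show ?thesis
  proof (rule ccontr)
    assume "\<not> ?thesis"
    \<comment> \<open>The lower bound is the word length times \<open>m\<close>, so it defeats every
      fixed multiple of the word length.\<close>
    then have "\<forall>m::nat. \<exists>a\<in>box_supported X n \<phi>. d id a > real m * (4 * real m + 4)"
      by (meson not_less)
    then obtain a where a: "\<And>m. a m \<in> box_supported X n \<phi>" "\<And>m. d id (a m) > real m * (4 * real m + 4)"
      by metis
    have "\<exists>g g'. supp_homeo n (box n 1) g g' \<and> a m = transport n \<phi> g" for m
      by (rule box_supported_expression[OF \<phi> a(1)])
    then obtain b b' where b: "\<And>m. supp_homeo n (box n 1) (b m) (b' m)" "\<And>m. a m = transport n \<phi> (b m)"
      by metis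
    have "\<exists>C C' e e' f f'. supp_homeo n (box n 2) C C' \<and> supp_homeo n (box n 2) e e' \<and>
      supp_homeo n (box n 2) f f' \<and>
      (\<forall>m. \<forall>y\<in>eucl n. b m y = (e' ^^ m) (C ((e ^^ m) (f ((e' ^^ m) (C' ((e ^^ m) (f' y))))))))"
      by (rule commutator_words[OF _ b(1)]) (use False in simp)
    then obtain C C' e e' f f' where s: "supp_homeo n (box n 2) C C'" "supp_homeo n (box n 2) e e'"
      "supp_homeo n (box n 2) f f'"
      and w: "\<And>m y. y \<in> eucl n \<Longrightarrow> b m y = (e' ^^ m) (C ((e ^^ m) (f ((e' ^^ m) (C' ((e ^^ m) (f' y)))))))"
      by blast
    have E: "C x \<in> eucl n" "C' x \<in> eucl n" "e x \<in> eucl n" "e' x \<in> eucl n" "f x \<in> eucl n" "f' x \<in> eucl n"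
      if "x \<in> eucl n" for x
      using supp_homeoD(1,2)[OF s(1) that] supp_homeoD(1,2)[OF s(2) that] supp_homeoD(1,2)[OF s(3) that] by simp_all
    have Em: "(e ^^ m) x \<in> eucl n" "(e' ^^ m) x \<in> eucl n" if "x \<in> eucl n" for x m
      using funpow_in_eucl[of n e, OF E(3) that] funpow_in_eucl[of n e', OF E(4) that] by simp_all
    define t where "t = transport n \<phi>"
    have "t g \<in> Homeo0 X" if "supp_homeo n (box n 2) g g'" for g g'
      using transport_in_Homeo0[OF \<phi> that] by (simp add: t_def)
    note t0 = this[OF s(1)] this[OF supp_homeo_sym[OF s(1)]] this[OF s(2)] this[OF supp_homeo_sym[OF s(2)]]
      this[OF s(3)] this[OF supp_homeo_sym[OF s(3)]]
    have word: "a m = t e' ^^ m \<circ> (t C \<circ> (t e ^^ m \<circ> (t f \<circ> (t e' ^^ m \<circ> (t C' \<circ> (t e ^^ m \<circ> t f'))))))" for m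
    proof -
      have "a m = transport n \<phi> (e' ^^ m \<circ> (C \<circ> (e ^^ m \<circ> (f \<circ> (e' ^^ m \<circ> (C' \<circ> (e ^^ m \<circ> f')))))))"
        unfolding b(2) using w by (intro ext transport_cong[OF \<phi>]) simp
      also have "\<dots> = t e' ^^ m \<circ> (t C \<circ> (t e ^^ m \<circ> (t f \<circ> (t e' ^^ m \<circ> (t C' \<circ> (t e ^^ m \<circ> t f'))))))"
        unfolding t_def
        by (simp add: transport_comp_fun[OF \<phi>] transport_funpow[OF \<phi>] E Em)
      finally show ?thesis .
    qed
    define K where "K = Max (d id ` {t C, t C', t e, t e', t f, t f'})"
    have K: "d id (t C) \<le> K" "d id (t C') \<le> K" "d id (t e) \<le> K" "d id (t e') \<le> K" "d id (t f) \<le> K" "d id (t f') \<le> K"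
      unfolding K_def by (rule Max_ge; simp)+
    have pow: "g ^^ m \<in> Homeo0 X" "d id (g ^^ m) \<le> real m * K" if "g \<in> Homeo0 X" "d id g \<le> K" for g m
    proof -
      have "real m * d id g \<le> real m * K" using that(2) by (intro mult_left_mono) auto
      then show "g ^^ m \<in> Homeo0 X" "d id (g ^^ m) \<le> real m * K"
        using length_bound(2)[OF d that(1), of m] by auto
    qed
    have bound: "g \<circ> h \<in> Homeo0 X \<and> d id (g \<circ> h) \<le> r + s"
      if "g \<in> Homeo0 X" "d id g \<le> r" "h \<in> Homeo0 X \<and> d id h \<le> s" for g h r s
      using length_bound(1)[OF d that(1), of h] that Homeo0_comp[of g X h] by linarith
    have am: "d id (a m) \<le> real m * K + (K + (real m * K + (K + (real m * K + (K + (real m * K + K))))))" for m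
      unfolding word
      by (rule bound[THEN conjunct2], (rule pow t0 K)+, rule bound, (rule t0 K)+,
          rule bound, (rule pow t0 K)+, rule bound, (rule t0 K)+,
          rule bound, (rule pow t0 K)+, rule bound, (rule t0 K)+,
          rule bound, (rule pow t0 K)+, intro conjI t0 K)
    obtain m where m: "K \<le> real m" using real_arch_simple by blast
    have "real m * (4 * real m + 4) < (4 * real m + 4) * K"
      using a(2)[of m] am[of m] by (simp add: algebra_simps)
    also have "\<dots> \<le> (4 * real m + 4) * real m" using m by (intro mult_left_mono) auto
    finally show False by simp
  qed
qed

end

section \<open>The generating set from finitely many boxes, and the open subgroup it
  generates\<close>

theorem theorem4p5:
  fixes X :: "'a topology" and n :: nat
  assumes "closed_manifold X n"
  shows "SB_generated (Homeo0_group X)"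
proof -
  let ?G = "Homeo0_group X" and ?T = "compact_open_topology X"
  obtain e :: "'a \<Rightarrow> nat \<Rightarrow> real" where e: "continuous_map X euclidean e" "inj_on e (topspace X)"
    using assms compact_Hausdorff_second_countable_embedding unfolding closed_manifold_def by metis
  interpret embedded_compact X e
    using assms e by unfold_locales (auto simp: closed_manifold_def)
  interpret G: group ?G by (rule group_Homeo0)
  have car: "carrier ?G = Homeo0 X" and mult: "f \<otimes>\<^bsub>?G\<^esub> g = f \<circ> g" and one: "\<one>\<^bsub>?G\<^esub> = id" for f g
    by (auto simp: Homeo0_group_def)
  have minv: "inv\<^bsub>?G\<^esub> f = hinv f" if f: "f \<in> Homeo0 X" for f
  proof (rule G.inv_equality)
    have "hinv f \<circ> f = id" using Homeo0_Homeo[OF f] by auto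
    then show "hinv f \<otimes>\<^bsub>?G\<^esub> f = \<one>\<^bsub>?G\<^esub>" by (simp add: mult one)
  qed (use f Homeo0_inv car in auto)

  have "\<exists>\<phi>. chart X n \<phi> \<and> p = \<phi> (\<lambda>_. 0)" if "p \<in> topspace X" for p
    using chart_exists[OF assms that] by metis
  then obtain ch where ch: "\<And>p. p \<in> topspace X \<Longrightarrow> chart X n (ch p) \<and> p = ch p (\<lambda>_. 0)" by metis
  \<comment> \<open>The open counterpart of the box of radius 1/3, from which compactness extracts a
    finite cover.\<close>
  define V where "V = {x \<in> eucl n. \<forall>i<n. \<bar>x i - 0\<bar> < 1/3}"
  have "compactin X (topspace X)" using compact by (simp add: compact_space_def)
  moreover have "\<forall>U\<in>(\<lambda>p. ch p ` V) ` topspace X. openin X U"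
    unfolding V_def using ch chart_open_map openin_coord_box[of n "\<lambda>_. 0" "\<lambda>_. 1/3"] by blast
  moreover have "topspace X \<subseteq> \<Union>((\<lambda>p. ch p ` V) ` topspace X)"
  proof
    fix p assume p: "p \<in> topspace X"
    have "(\<lambda>_. 0) \<in> V" by (simp add: V_def eucl_def)
    then have "p \<in> ch p ` V" using ch[OF p] by blast
    then show "p \<in> \<Union>((\<lambda>p. ch p ` V) ` topspace X)" using p by blast
  qed
  ultimately obtain \<F> where "finite \<F>" "\<F> \<subseteq> (\<lambda>p. ch p ` V) ` topspace X" "topspace X \<subseteq> \<Union>\<F>"
    unfolding compactin_def by metis
  then obtain P where P: "finite P" "P \<subseteq> topspace X" "topspace X \<subseteq> (\<Union>p\<in>P. ch p ` V)"
    by (metis finite_subset_image)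
  define \<Phi> where "\<Phi> = ch ` P"
  have \<Phi>: "finite \<Phi>" "\<And>\<phi>. \<phi> \<in> \<Phi> \<Longrightarrow> chart X n \<phi>" using P ch by (auto simp: \<Phi>_def)
  have VS: "V \<subseteq> box n (1/3)" by (auto simp: V_def slab_def)
  have cov: "topspace X = (\<Union>\<phi>\<in>\<Phi>. \<phi> ` box n (1/3))"
  proof
    show "topspace X \<subseteq> (\<Union>\<phi>\<in>\<Phi>. \<phi> ` box n (1/3))" using P(3) VS by (fastforce simp: \<Phi>_def)
    show "(\<Union>\<phi>\<in>\<Phi>. \<phi> ` box n (1/3)) \<subseteq> topspace X"
      using chart_in_topspace[OF \<Phi>(2)] box_subset by blast
  qed

  define A where "A = (\<Union>\<phi>\<in>\<Phi>. box_supported X n \<phi>)"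
  have A0: "A \<subseteq> Homeo0 X" using box_supported_Homeo0 \<Phi> by (auto simp: A_def)
  have "strongly_bounded ?G A"
    unfolding strongly_bounded_def
  proof (intro conjI allI impI)
    show "A \<subseteq> carrier ?G" using A0 car by simp
    fix d assume d: "left_invariant_metric ?G d"
    have "\<forall>\<phi>\<in>\<Phi>. \<exists>B. \<forall>a\<in>box_supported X n \<phi>. d id a \<le> B"
      using box_supported_bounded[OF \<Phi>(2) d] by blast
    then obtain B where B: "\<And>\<phi> a. \<phi> \<in> \<Phi> \<Longrightarrow> a \<in> box_supported X n \<phi> \<Longrightarrow> d id a \<le> B \<phi>" by metis
    have bd: "d id a \<le> (\<Sum>\<phi>\<in>\<Phi>. \<bar>B \<phi>\<bar>)" if "a \<in> A" for a
    proof -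
      obtain \<phi> where \<phi>: "\<phi> \<in> \<Phi>" "a \<in> box_supported X n \<phi>" using \<open>a \<in> A\<close> by (auto simp: A_def)
      have "d id a \<le> \<bar>B \<phi>\<bar>" using B[OF \<phi>] by linarith
      also have "\<dots> \<le> (\<Sum>\<phi>\<in>\<Phi>. \<bar>B \<phi>\<bar>)" using \<phi> \<Phi> by (intro member_le_sum) auto
      finally show ?thesis .
    qed
    have "d a b \<le> 2 * (\<Sum>\<phi>\<in>\<Phi>. \<bar>B \<phi>\<bar>)" if "a \<in> A" "b \<in> A" for a b
    proof -
      have "d a b \<le> d id a + d id b" using that A0 by (intro length_bound(4)[OF d]) auto
      then show ?thesis using bd[OF that(1)] bd[OF that(2)] by linarith
    qed
    then show "\<exists>B. \<forall>a\<in>A. \<forall>b\<in>A. d a b \<le> B" by blast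
  qed

  define F where "F = generate ?G A"
  have "subgroup F ?G" unfolding F_def by (rule G.generate_is_subgroup) (use A0 car in simp)
  then have F: "F \<subseteq> Homeo0 X" "id \<in> F" "\<And>f g. f \<in> F \<Longrightarrow> g \<in> F \<Longrightarrow> f \<circ> g \<in> F" "\<And>f. f \<in> F \<Longrightarrow> hinv f \<in> F"
    using subgroup.subset[of F ?G] subgroup.one_closed[of F ?G] subgroup.m_closed[of F ?G]
      subgroup.m_inv_closed[of F ?G] minv
    by (auto simp: car mult one subset_iff)
  have trF: "transport n \<phi> g \<in> F" if "\<phi> \<in> \<Phi>" "supp_homeo n (box n 1) g g'" for \<phi> g g'
  proof -
    have "transport n \<phi> g p = p" if "p \<notin> \<phi> ` box n 1" for p
      using transport_supp[OF \<Phi>(2)[OF \<open>\<phi> \<in> \<Phi>\<close>], of "box n 1" g p] supp_homeoD(5)[OF \<open>supp_homeo n _ g g'\<close>] that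
        box_subset by (auto simp: Int_absorb2)
    then have "transport n \<phi> g \<in> box_supported X n \<phi>"
      using transport_Homeo(1)[OF \<Phi>(2)[OF that(1)] compact_box box_subset that(2)] by (auto simp: box_supported_def)
    then show ?thesis unfolding F_def A_def using that(1) by (intro generate.incl) blast
  qed
  have "\<exists>\<delta>>0. \<forall>h\<in>Homeo X. near_id \<delta> h \<longrightarrow> h \<in> F"
    by (rule fragmentation[OF \<Phi> cov trF F(2,3)])
  then obtain \<delta> where \<delta>: "\<delta> > 0" "\<And>h. h \<in> Homeo X \<Longrightarrow> near_id \<delta> h \<Longrightarrow> h \<in> F" by blast
  obtain W where W: "openin ?T W" "id \<in> W" "\<And>h. h \<in> W \<Longrightarrow> near_id \<delta> h"
    using compact_open_near_id[OF \<delta>(1)] by metis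
  have WF: "W \<subseteq> F" using W \<delta>(2) openin_subset[OF W(1)] topspace_compact_open by blast
  \<comment> \<open>The translate of \<open>W\<close> by \<open>h\<close>. As \<open>W\<close> lies
    in \<open>F\<close>, it is contained in the left coset of \<open>h\<close>, so both
    \<open>F\<close> and its complement are open.\<close>
  define N where "N h = {g \<in> topspace ?T. hinv h \<circ> g \<in> W}" for h
  have N: "openin ?T (N h)" "h \<in> N h" if "h \<in> Homeo X" for h
  proof -
    show "openin ?T (N h)"
      unfolding N_def by (rule openin_continuous_map_preimage[OF continuous_map_left_mult[OF Homeo_inv[OF that]] W(1)])
    have "hinv h \<circ> h = id" using that by auto
    then show "h \<in> N h" using that W(2) by (simp add: N_def topspace_compact_open)
  qed
  have N_F: "g \<in> F \<longleftrightarrow> h \<in> F" if "h \<in> Homeo X" "g \<in> N h" for g h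
  proof -
    have w: "hinv h \<circ> g \<in> F" using that WF by (auto simp: N_def)
    have g: "g = h \<circ> (hinv h \<circ> g)" using that(1) by auto
    have "h = g \<circ> hinv (hinv h \<circ> g)"
    proof
      fix x
      have "(hinv h \<circ> g) (hinv (hinv h \<circ> g) x) = x"
        by (rule Homeo_inv_f(2)[OF Homeo0_Homeo[OF subsetD[OF F(1) w]]])
      then have "h (hinv h (g (hinv (hinv h \<circ> g) x))) = h x" by simp
      then show "h x = (g \<circ> hinv (hinv h \<circ> g)) x" using that(1) by simp
    qed
    then show ?thesis using g w F(3,4) by metis
  qed
  have FH: "F \<subseteq> Homeo X" using F(1) Homeo0_Homeo by blast
  have "openin ?T F"
  proof (subst openin_subopen, intro ballI)
    fix h assume h: "h \<in> F"
    then show "\<exists>U. openin ?T U \<and> h \<in> U \<and> U \<subseteq> F" using N[of h] N_F[of h] FH by blast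
  qed
  moreover have "openin ?T (topspace ?T - F)"
  proof (subst openin_subopen, intro ballI)
    fix h assume h: "h \<in> topspace ?T - F"
    then have hH: "h \<in> Homeo X" by (simp add: topspace_compact_open)
    have "N h \<subseteq> topspace ?T - F" using N_F[OF hH] h by (auto simp: N_def)
    then show "\<exists>U. openin ?T U \<and> h \<in> U \<and> U \<subseteq> topspace ?T - F" using N[OF hH] by blast
  qed
  then have "closedin ?T F" using FH by (simp add: closedin_def topspace_compact_open)
  moreover have "connectedin ?T (Homeo0 X)"
    using connectedin_connected_component_of[of ?T id] by (simp add: Homeo0_def)
  ultimately have "Homeo0 X \<subseteq> F \<or> disjnt (Homeo0 X) F"
    by (intro connectedin_clopen_cases)
  then have "F = Homeo0 X" using F(1,2) id_Homeo0 by (auto simp: disjnt_iff)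
  then show ?thesis
    unfolding SB_generated_def using \<open>strongly_bounded ?G A\<close> car F_def by blast
qed

end
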